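(* Let $\mathbb{K}$ be a field, $R_n=\mathbb{K}[x_1,\dots,x_n]$, and let $(C_n,\Pi)$ be a parcycle with $\Pi=\{V_1,\dots,V_k\}$ and $n\in V_k$. Let $M_\Pi$ be the $G$-parking function ideal of $(C_n,\Pi)$ with sink $V_k$. Then the complex $\mathcal{F}_{0,\Pi}$ of $R_n$-modules minimally resolves $R_n/M_\Pi$, i.e. it is a minimal free resolution of $R_n/M_\Pi$.
   Context: For $n\ge3$, $C_n$ is the cycle with vertices $1,\dots,n$ and edges $\{i,i+1\}$ ($1\le i\le n-1$), $\{1,n\}$. A parcycle $(C_n,\Pi)$ is $C_n$ with a partition $\Pi=\{V_1,\dots,V_k\}$ of its vertex set such that every $V_i$ induces a connected subgraph; the $V_i$ are the main vertices. A connected-parset is a nonempty union of main vertices inducing a connected subgraph. For a union $S$ of main vertices with complement $\overline S$, $\mathbf{x}^{S\to\overline S}=\prod_{i\in S}x_i^{d_i}$, where $d_i$ is the number of edges from $i$ to $\overline S$. $M_\Pi=\langle\mathbf{x}^{S\to\overline S}: S\text{ a connected-parset not containing }V_k\rangle$. A connected $j$-partition of $(C_n,\Pi)$ is a partition $\tilde\Pi=\{W_1,\dots,W_j\}$ of $V(C_n)$ into connected-parsets. The multigraph $(C_n)_{\tilde\Pi}$ has vertex set $\tilde\Pi$, the number of edges between $W_s\neq W_l$ being the number of edges of $C_n$ between them. An acyclic $j$-partition is a pair $\mathcal{C}=(\tilde\Pi,\mathcal{O})$ with $\mathcal{O}$ an acyclic orientation of $(C_n)_{\tilde\Pi}$;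 parallel edges have the same direction and are treated as one directed edge. It is $V_k$-acyclic if $\mathcal{O}$ has a unique sink, namely the block containing $V_k$. For $i\in W_s$, $\mathrm{out}_{\mathcal{C}}(i)$ is the number of edges of $C_n$ from $i$ to blocks $W_l$ with $(W_s,W_l)$ a directed edge of $\mathcal{C}$; $D(\mathcal{C})=(\mathrm{out}_{\mathcal{C}}(i))_i\in\mathbb{Z}^n$. A directed edge $f=(U,W)$ of $\mathcal{C}$ is contractible if merging $U$ and $W$ (keeping the other orientations) gives an acyclic partition, denoted $\mathcal{C}/f$. Signs: two acyclic $j$-partitions are chip firing equivalent if they have the same underlying $\tilde\Pi$ and their outdegree vectors in $\mathbb{Z}^{\tilde\Pi}$ (as orientations of $(C_n)_{\tilde\Pi}$) differ by an element of the Laplacian lattice of $(C_n)_{\tilde\Pi}$; an edge $f$ is contractible in a class $\mathbf{c}$ if it is contractible in some $\mathcal{C}\in\mathbf{c}$, and then $\mathbf{c}/f:=[\mathcal{C}/f]$ is independent of $\mathcal{C}$. Fix signs $\mathrm{sign}_{\mathbf{c}}(f)\in\{1,-1\}$ for all classes $\mathbf{c}$ and contractible $f$ with: (i) $\mathrm{sign}_{\mathbf{c}}(f_1)\mathrm{sign}_{\mathbf{c}/f_1}(f_2)=-\mathrm{sign}_{\mathbf{c}}(f_2)\mathrm{sign}_{\mathbf{c}/f_2}(f_1)$ for distinct contractible edges $f_1,f_2$ of $\mathbf{c}$ (whenever $f_2$ is contractible in $\mathbf{c}/f_1$ and $f_1$ in $\mathbf{c}/f_2$); (ii) $\mathrm{sign}_{\mathbf{c}}((U,W))=-\mathrm{sign}_{\mathbf{c}}((W,U))$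 if both are contractible in $\mathbf{c}$. Such signs exist. Put $\mathrm{sign}_{\mathcal{C}}(f)=\mathrm{sign}_{[\mathcal{C}]}(f)$. The complex $\mathcal{F}_{0,\Pi}$: in homological degree $j$ ($0\le j\le k-1$) it is $\bigoplus_{\mathcal{C}}R_n(-D(\mathcal{C}))$ with basis elements $e_{\mathcal{C}}$, over all $V_k$-acyclic $(j+1)$-partitions $\mathcal{C}$ of $(C_n,\Pi)$, with differential $$\delta_{0,j}(e_{\mathcal{C}})=\sum_f\mathrm{sign}_{\mathcal{C}}(f)\,\mathbf{x}^{D(\mathcal{C})-D(\mathcal{C}/f)}\,e_{\mathcal{C}/f},$$ the sum over the contractible edges $f$ of $\mathcal{C}$. *)

theory Defs
  imports
    "HOL-Library.Poly_Mapping"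
    "HOL-Library.Disjoint_Sets"
    "HOL-Algebra.QuotRing"
    "HOL-Algebra.Module"
begin

section \<open>Complexes of free modules\<close>

text \<open>The ring-multiplication fields of a module record play no role and are left unspecified.\<close>

definition free_module :: "('r, 's) ring_scheme \<Rightarrow> 'b set \<Rightarrow> ('r, 'b \<Rightarrow> 'r) module" where
  "free_module R B =
    \<lparr>carrier = {v. (\<forall>b\<in>B. v b \<in> carrier R) \<and> (\<forall>b. b \<notin> B \<longrightarrow> v b = \<zero>\<^bsub>R\<^esub>)
                   \<and> finite {b. v b \<noteq> \<zero>\<^bsub>R\<^esub>}},
     mult = undefined, one = undefined,
     zero = (\<lambda>b. \<zero>\<^bsub>R\<^esub>), add = (\<lambda>v w b. v b \<oplus>\<^bsub>R\<^esub> w b),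
     smult = (\<lambda>r v b. r \<otimes>\<^bsub>R\<^esub> v b)\<rparr>"

text \<open>The quotient \<open>R/I\<close> viewed as an \<open>R\<close>-module.\<close>

definition quotient_module :: "('r, 's) ring_scheme \<Rightarrow> 'r set \<Rightarrow> ('r, 'r set) module" where
  "quotient_module R I =
    \<lparr>carrier = carrier (R Quot I), mult = mult (R Quot I), one = \<one>\<^bsub>R Quot I\<^esub>,
     zero = \<zero>\<^bsub>R Quot I\<^esub>, add = add (R Quot I),
     smult = (\<lambda>r X. (I +>\<^bsub>R\<^esub> r) \<otimes>\<^bsub>R Quot I\<^esub> X)\<rparr>"

definition module_hom_set ::
    "('r, 's) ring_scheme \<Rightarrow> ('r, 'm, 't) module_scheme \<Rightarrow> ('r, 'n, 'u) module_scheme \<Rightarrow> ('m \<Rightarrow> 'n) set" where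
  "module_hom_set R M N =
    {h. h \<in> carrier M \<rightarrow> carrier N
      \<and> (\<forall>x\<in>carrier M. \<forall>y\<in>carrier M. h (x \<oplus>\<^bsub>M\<^esub> y) = h x \<oplus>\<^bsub>N\<^esub> h y)
      \<and> (\<forall>r\<in>carrier R. \<forall>x\<in>carrier M. h (r \<odot>\<^bsub>M\<^esub> x) = r \<odot>\<^bsub>N\<^esub> h x)}"

text \<open>
  \<open>B j\<close> is the basis in homological degree \<open>j\<close>, and \<open>d j\<close> is the differential from degree \<open>j\<close>
  to degree \<open>j - 1\<close> (for \<open>j \<ge> 1\<close>). The cokernel of \<open>d 1\<close> is identified with \<open>M\<close> by the
  augmentation \<open>h\<close>.
\<close>

definition free_resolution ::
    "('r, 's) ring_scheme \<Rightarrow> (nat \<Rightarrow> 'b set) \<Rightarrow> (nat \<Rightarrow> ('b \<Rightarrow> 'r) \<Rightarrow> ('b \<Rightarrow> 'r))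
      \<Rightarrow> ('r, 'm, 't) module_scheme \<Rightarrow> bool" where
  "free_resolution R B d M \<longleftrightarrow>
    (let F = (\<lambda>j. free_module R (B j)) in
      (\<forall>j. d (Suc j) \<in> module_hom_set R (F (Suc j)) (F j))
      \<and> (\<forall>j. {v \<in> carrier (F (Suc j)). d (Suc j) v = \<zero>\<^bsub>F j\<^esub>}
              = d (Suc (Suc j)) ` carrier (F (Suc (Suc j))))
      \<and> (\<exists>h \<in> module_hom_set R (F 0) M.
            h ` carrier (F 0) = carrier M
            \<and> {v \<in> carrier (F 0). h v = \<zero>\<^bsub>M\<^esub>} = d 1 ` carrier (F 1)))"

text \<open>Minimality with respect to the ideal \<open>m\<close>: the image of each differential lies in \<open>m F\<close>,
  i.e. all its coordinates lie in \<open>m\<close>.\<close>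

definition minimal_free_resolution ::
    "('r, 's) ring_scheme \<Rightarrow> 'r set \<Rightarrow> (nat \<Rightarrow> 'b set) \<Rightarrow> (nat \<Rightarrow> ('b \<Rightarrow> 'r) \<Rightarrow> ('b \<Rightarrow> 'r))
      \<Rightarrow> ('r, 'm, 't) module_scheme \<Rightarrow> bool" where
  "minimal_free_resolution R m B d M \<longleftrightarrow>
    free_resolution R B d M
    \<and> (\<forall>j. \<forall>v \<in> carrier (free_module R (B (Suc j))). \<forall>b \<in> B j. d (Suc j) v b \<in> m)"

section \<open>The polynomial ring in the variables 1, ..., n\<close>

type_synonym 'a mpoly = "(nat \<Rightarrow>\<^sub>0 nat) \<Rightarrow>\<^sub>0 'a"

definition mpoly_ring :: "nat \<Rightarrow> ('a::field) mpoly ring" where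
  "mpoly_ring n =
    \<lparr>carrier = {p. \<forall>m \<in> Poly_Mapping.keys p. Poly_Mapping.keys m \<subseteq> {1..n}},
     mult = (*), one = 1, zero = 0, add = (+)\<rparr>"

definition monomial :: "(nat \<Rightarrow>\<^sub>0 nat) \<Rightarrow> ('a::field) mpoly" where
  "monomial a = Poly_Mapping.single a 1"

definition irrelevant_ideal :: "nat \<Rightarrow> ('a::field) mpoly set" where
  "irrelevant_ideal n =
    Idl\<^bsub>mpoly_ring n\<^esub> {monomial (Poly_Mapping.single i 1) | i. i \<in> {1..n}}"

text \<open>For a free module with basis element \<open>b\<close> placed in degree \<open>D b\<close> (the summand
  \<open>R(-D b)\<close>): the differentials are homogeneous of multidegree 0.\<close>

definition multigraded_differential ::
    "(nat \<Rightarrow> 'b set) \<Rightarrow> ('b \<Rightarrow> (nat \<Rightarrow>\<^sub>0 nat))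
      \<Rightarrow> (nat \<Rightarrow> ('b \<Rightarrow> ('a::field) mpoly) \<Rightarrow> ('b \<Rightarrow> 'a mpoly)) \<Rightarrow> bool" where
  "multigraded_differential B D d \<longleftrightarrow>
    (\<forall>j. \<forall>b \<in> B (Suc j). \<forall>b' \<in> B j.
      \<forall>m \<in> Poly_Mapping.keys (d (Suc j) (\<lambda>x. if x = b then 1 else 0) b'). m + D b' = D b)"

section \<open>Parcycles\<close>

definition cycle_edges :: "nat \<Rightarrow> nat set set" where
  "cycle_edges n = {{i, i + 1} | i. 1 \<le> i \<and> i + 1 \<le> n} \<union> {{1, n}}"

definition induces_connected :: "nat \<Rightarrow> nat set \<Rightarrow> bool" where
  "induces_connected n S \<longleftrightarrow>
    S \<noteq> {} \<and> S \<subseteq> {1..n}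
    \<and> (\<forall>u\<in>S. \<forall>v\<in>S. (u, v) \<in> {(a, b). a \<in> S \<and> b \<in> S \<and> {a, b} \<in> cycle_edges n}\<^sup>*)"

definition parcycle :: "nat \<Rightarrow> nat set set \<Rightarrow> bool" where
  "parcycle n \<P> \<longleftrightarrow>
    3 \<le> n \<and> partition_on {1..n} \<P> \<and> (\<forall>A\<in>\<P>. induces_connected n A)"

definition connected_parset :: "nat \<Rightarrow> nat set set \<Rightarrow> nat set \<Rightarrow> bool" where
  "connected_parset n \<P> S \<longleftrightarrow>
    (\<exists>T. T \<subseteq> \<P> \<and> T \<noteq> {} \<and> S = \<Union>T) \<and> induces_connected n S"

definition cut_exponent :: "nat \<Rightarrow> nat set \<Rightarrow> (nat \<Rightarrow>\<^sub>0 nat)" where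
  "cut_exponent n S =
    (\<Sum>i\<in>S. Poly_Mapping.single i (card {w \<in> {1..n} - S. {i, w} \<in> cycle_edges n}))"

text \<open>The sink \<open>q\<close> is a main vertex; a parset that does not contain it is disjoint from it.\<close>

definition parking_ideal :: "nat \<Rightarrow> nat set set \<Rightarrow> nat set \<Rightarrow> ('a::field) mpoly set" where
  "parking_ideal n \<P> q =
    Idl\<^bsub>mpoly_ring n\<^esub> {monomial (cut_exponent n S) | S. connected_parset n \<P> S \<and> \<not> q \<subseteq> S}"

section \<open>Acyclic partitions\<close>

text \<open>An acyclic partition is a pair of the set of blocks and the set of directed edges between
  blocks; parallel edges of the quotient multigraph give a single directed edge.\<close>

type_synonym oriented_partition = "nat set set \<times> (nat set \<times> nat set) set"

definition num_edges :: "nat \<Rightarrow> nat set \<Rightarrow> nat set \<Rightarrow> nat" where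
  "num_edges n U W = card {e \<in> cycle_edges n. \<exists>u\<in>U. \<exists>w\<in>W. e = {u, w}}"

definition connected_partition :: "nat \<Rightarrow> nat set set \<Rightarrow> nat set set \<Rightarrow> bool" where
  "connected_partition n \<P> P \<longleftrightarrow>
    partition_on {1..n} P \<and> (\<forall>W\<in>P. connected_parset n \<P> W)"

definition orientation :: "nat \<Rightarrow> nat set set \<Rightarrow> (nat set \<times> nat set) set \<Rightarrow> bool" where
  "orientation n P E \<longleftrightarrow>
    (\<forall>(U, W) \<in> E. U \<in> P \<and> W \<in> P \<and> U \<noteq> W \<and> num_edges n U W > 0)
    \<and> (\<forall>U\<in>P. \<forall>W\<in>P. U \<noteq> W \<and> num_edges n U W > 0 \<longrightarrow> ((U, W) \<in> E) \<noteq> ((W, U) \<in> E))"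

definition acyclic_partition :: "nat \<Rightarrow> nat set set \<Rightarrow> oriented_partition \<Rightarrow> bool" where
  "acyclic_partition n \<P> C \<longleftrightarrow>
    connected_partition n \<P> (fst C) \<and> orientation n (fst C) (snd C) \<and> acyclic (snd C)"

definition has_unique_sink_at :: "nat set \<Rightarrow> oriented_partition \<Rightarrow> bool" where
  "has_unique_sink_at q C \<longleftrightarrow>
    (\<exists>W\<in>fst C. q \<subseteq> W \<and> {S \<in> fst C. \<forall>T. (S, T) \<notin> snd C} = {W})"

definition out_edges :: "nat \<Rightarrow> oriented_partition \<Rightarrow> nat \<Rightarrow> nat" where
  "out_edges n C i =
    card {w \<in> {1..n}. {i, w} \<in> cycle_edges n \<and> (\<exists>(U, W) \<in> snd C. i \<in> U \<and> w \<in> W)}"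

definition outdeg_exponent :: "nat \<Rightarrow> oriented_partition \<Rightarrow> (nat \<Rightarrow>\<^sub>0 nat)" where
  "outdeg_exponent n C = (\<Sum>i\<in>{1..n}. Poly_Mapping.single i (out_edges n C i))"

text \<open>Contraction of \<open>f = (U, W)\<close>: both \<open>U\<close> and \<open>W\<close> are replaced by \<open>U \<union> W\<close>. Directed edges are
  identified with their images under this map.\<close>

definition merge_block :: "nat set \<times> nat set \<Rightarrow> nat set \<Rightarrow> nat set" where
  "merge_block f A = (if A = fst f \<or> A = snd f then fst f \<union> snd f else A)"

definition merge_edge :: "nat set \<times> nat set \<Rightarrow> nat set \<times> nat set \<Rightarrow> nat set \<times> nat set" where
  "merge_edge f g = (merge_block f (fst g), merge_block f (snd g))"

definition contract :: "oriented_partition \<Rightarrow> nat set \<times> nat set \<Rightarrow> oriented_partition" where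
  "contract C f =
    (merge_block f ` fst C, {(A, B) \<in> merge_edge f ` snd C. A \<noteq> B})"

definition contractible :: "nat \<Rightarrow> nat set set \<Rightarrow> oriented_partition \<Rightarrow> nat set \<times> nat set \<Rightarrow> bool" where
  "contractible n \<P> C f \<longleftrightarrow> f \<in> snd C \<and> acyclic_partition n \<P> (contract C f)"

section \<open>Chip firing classes and signs\<close>

definition block_outdeg :: "nat \<Rightarrow> oriented_partition \<Rightarrow> nat set \<Rightarrow> int" where
  "block_outdeg n C W = (\<Sum>U | (W, U) \<in> snd C. int (num_edges n W U))"

definition laplacian :: "nat \<Rightarrow> nat set set \<Rightarrow> nat set \<Rightarrow> nat set \<Rightarrow> int" where
  "laplacian n P W U =
    (if W = U then (\<Sum>T\<in>P - {W}. int (num_edges n W T)) else - int (num_edges n W U))"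

definition chip_firing_equiv :: "nat \<Rightarrow> oriented_partition \<Rightarrow> oriented_partition \<Rightarrow> bool" where
  "chip_firing_equiv n C C' \<longleftrightarrow>
    fst C = fst C'
    \<and> (\<exists>s :: nat set \<Rightarrow> int. \<forall>W\<in>fst C.
          block_outdeg n C W - block_outdeg n C' W = (\<Sum>U\<in>fst C. laplacian n (fst C) W U * s U))"

definition chip_class :: "nat \<Rightarrow> nat set set \<Rightarrow> oriented_partition \<Rightarrow> oriented_partition set" where
  "chip_class n \<P> C = {C'. acyclic_partition n \<P> C' \<and> chip_firing_equiv n C C'}"

definition chip_classes :: "nat \<Rightarrow> nat set set \<Rightarrow> oriented_partition set set" where
  "chip_classes n \<P> = chip_class n \<P> ` {C. acyclic_partition n \<P> C}"

definition class_contractible ::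
    "nat \<Rightarrow> nat set set \<Rightarrow> oriented_partition set \<Rightarrow> nat set \<times> nat set \<Rightarrow> bool" where
  "class_contractible n \<P> c f \<longleftrightarrow> (\<exists>C\<in>c. contractible n \<P> C f)"

text \<open>The class of \<open>contract C f\<close> does not depend on the choice of \<open>C\<close> in \<open>c\<close> in which \<open>f\<close> is
  contractible, so the following union consists of a single class.\<close>

definition class_contract ::
    "nat \<Rightarrow> nat set set \<Rightarrow> oriented_partition set \<Rightarrow> nat set \<times> nat set \<Rightarrow> oriented_partition set" where
  "class_contract n \<P> c f = (\<Union>C\<in>{C\<in>c. contractible n \<P> C f}. chip_class n \<P> (contract C f))"

definition sign_system ::
    "nat \<Rightarrow> nat set set \<Rightarrow> (oriented_partition set \<Rightarrow> nat set \<times> nat set \<Rightarrow> int) \<Rightarrow> bool" where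
  "sign_system n \<P> sg \<longleftrightarrow>
    (\<forall>c \<in> chip_classes n \<P>.
      (\<forall>f. class_contractible n \<P> c f \<longrightarrow> sg c f \<in> {1, -1})
      \<and> (\<forall>f g. f \<noteq> g
            \<and> class_contractible n \<P> c f \<and> class_contractible n \<P> c g
            \<and> class_contractible n \<P> (class_contract n \<P> c f) (merge_edge f g)
            \<and> class_contractible n \<P> (class_contract n \<P> c g) (merge_edge g f) \<longrightarrow>
          sg c f * sg (class_contract n \<P> c f) (merge_edge f g)
          = - (sg c g * sg (class_contract n \<P> c g) (merge_edge g f)))
      \<and> (\<forall>U W. class_contractible n \<P> c (U, W) \<and> class_contractible n \<P> c (W, U) \<longrightarrow>
          sg c (U, W) = - sg c (W, U)))"

section \<open>The complex\<close>

text \<open>The basis in homological degree \<open>j\<close>, \<open>0 \<le> j \<le> k - 1\<close> where \<open>k\<close> is the number of main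
  vertices, consists of the \<open>q\<close>-acyclic \<open>(j+1)\<close>-partitions.\<close>

definition F0_basis :: "nat \<Rightarrow> nat set set \<Rightarrow> nat set \<Rightarrow> nat \<Rightarrow> oriented_partition set" where
  "F0_basis n \<P> q j =
    {C. j < card \<P> \<and> acyclic_partition n \<P> C \<and> card (fst C) = j + 1 \<and> has_unique_sink_at q C}"

text \<open>The subtraction of exponents below is truncated; that no truncation takes place is part of
  \<^const>\<open>multigraded_differential\<close>.\<close>

definition F0_diff ::
    "nat \<Rightarrow> nat set set \<Rightarrow> nat set \<Rightarrow> (oriented_partition set \<Rightarrow> nat set \<times> nat set \<Rightarrow> int) \<Rightarrow> nat
      \<Rightarrow> (oriented_partition \<Rightarrow> ('a::field) mpoly) \<Rightarrow> (oriented_partition \<Rightarrow> 'a mpoly)" where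
  "F0_diff n \<P> q sg j v = (\<lambda>C'.
    \<Sum>C \<in> F0_basis n \<P> q j. \<Sum>f | contractible n \<P> C f \<and> contract C f = C'.
      of_int (sg (chip_class n \<P> C) f)
      * monomial (outdeg_exponent n C - outdeg_exponent n (contract C f)) * v C)"

end

theory Submission
  imports Defs
begin

text \<open>
  An oriented connected partition is a set of directed cut edges, each of them joining two different
  main vertices. It is \<open>V k\<close>-acyclic if there is no cut edge at all or if, going around from \<open>n\<close>,
  the cut edges first point backwards and then forwards, and both directions occur.
  Such sets of directed cut edges are called cells. Contracting an edge deletes it from the cell, except
  that a cell with two elements is sent to the empty cell, and the multidegree of a cell counts the
  tails of its edges.

  The complex is multigraded, hence exact in positive degrees as soon as each of its strands is. The
  strand in degree \<open>m\<close> consists of the cells whose multidegree divides \<open>m\<close>. If it contains a nonempty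
  cell, let \<open>p\<close> be the first backward edge that is admissible in the strand and \<open>q\<close> a forward edge that
  is compatible with it: inserting or deleting \<open>p\<close> matches all cells except those with \<open>p\<close> as only
  backward edge, among these inserting or deleting \<open>q\<close> matches all but \<open>{p, q}\<close>, and that one is
  matched with the empty cell. In degree 0 the image of the differential is generated by the
  monomials of the two-element cells, which are the cuts of the connected parsets that avoid \<open>n\<close>.

  The signs only enter through \<open>d \<circ> d = 0\<close>, which follows from their anticommutation once it is known
  that contraction is well defined on chip firing classes.
\<close>

section \<open>Exactness of the strands\<close>

text \<open>The sink forces the shape of the cells. Number the blocks from the one containing
  \<open>n\<close>. That block has no outgoing edge, so the first cut points backwards and the last
  one forwards. Once a cut points forwards into another block, this block needs an exit, so the next
  cut points forwards too. A multidegree \<open>m\<close> restricts the cells of its strand in two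
  ways: every tail must be a variable of \<open>m\<close>, and where \<open>m\<close> has exponent
  1, the backward and the forward edge leaving that vertex exclude each other. This exclusion is the
  obstacle to a matching. Taking \<open>p\<close> first among the admissible backward edges avoids
  it: any other backward edge of a cell lies beyond \<open>p\<close>, so the forward edges lie
  beyond \<open>p + 1\<close>. As \<open>q\<close> one can take any forward edge of a cell of the
  strand. Contraction descends to chip firing classes because a firing potential between two acyclic
  orientations takes equal values at both ends of every edge on which they agree, and so passes to
  the quotient by that edge.\<close>

definition exact_on :: "('c \<Rightarrow> 'c \<Rightarrow> 'a::field) \<Rightarrow> 'c set \<Rightarrow> bool" where
  "exact_on w G \<longleftrightarrow>
    (\<forall>a. (\<forall>Y\<in>G. (\<Sum>X\<in>G. a X * w X Y) = 0) \<longrightarrow> (\<exists>a'. \<forall>Y\<in>G. a Y = (\<Sum>X\<in>G. a' X * w X Y)))"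

text \<open>Cancellation of an acyclic quotient: \<open>closed\<close> makes \<open>H\<close> a
  subcomplex, and in the quotient, whose basis is \<open>L\<close> together with its image under
  \<open>u\<close>, the matrix from the image to \<open>L\<close> is diagonal with nonzero
  entries.\<close>

lemma exact_on_toggle:
  fixes w :: "'c \<Rightarrow> 'c \<Rightarrow> 'a::field"
  assumes fin: "finite G" and LG: "L \<subseteq> G" and uL: "u ` L \<subseteq> G - L" and inj: "inj_on u L"
    and cc: "\<And>X Z. X \<in> G \<Longrightarrow> Z \<in> G \<Longrightarrow> (\<Sum>Y\<in>G. w X Y * w Y Z) = 0"
    and key: "\<And>Y Z. Y \<in> L \<Longrightarrow> Z \<in> G - L \<Longrightarrow> w Z Y \<noteq> 0 \<longleftrightarrow> Z = u Y"
    and H: "H = G - L - u ` L"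
    and closed: "\<And>X Y. X \<in> H \<Longrightarrow> Y \<in> G - H \<Longrightarrow> w X Y = 0"
    and ex: "exact_on w H"
  shows "exact_on w G"
  unfolding exact_on_def
proof (intro allI impI)
  fix a assume cyc: "\<forall>Y\<in>G. (\<Sum>X\<in>G. a X * w X Y) = 0"
  \<comment> \<open>\<open>g\<close> is supported on the image of \<open>L\<close>, with the
    coefficients that make its boundary agree with \<open>a\<close> on \<open>L\<close>; subtracting
    this boundary leaves \<open>c\<close>.\<close>
  define g where "g X = (if X \<in> u ` L then a (inv_into L u X) / w X (inv_into L u X) else 0)" for X
  define c where "c Y = a Y - (\<Sum>X\<in>G. g X * w X Y)" for Y
  have HG: "H \<subseteq> G" using H by auto
  have one_term: "(\<Sum>X\<in>G. h X * w X Y) = h (u Y) * w (u Y) Y"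
    if Y: "Y \<in> L" and h: "\<And>X. X \<in> L \<Longrightarrow> h X = 0" for h Y
  proof -
    have uY: "u Y \<in> G" using uL Y by auto
    have z: "h X * w X Y = 0" if "X \<in> G - {u Y}" for X
      using h key[OF Y, of X] that by (cases "X \<in> L") auto
    have "(\<Sum>X\<in>G. h X * w X Y) = (\<Sum>X\<in>{u Y}. h X * w X Y)"
      by (rule sum.mono_neutral_right) (use fin uY z in auto)
    then show ?thesis by simp
  qed
  have wu: "w (u Y) Y \<noteq> 0" if "Y \<in> L" for Y using key[OF that, of "u Y"] uL that by auto
  have gL: "g X = 0" if "X \<in> L" for X using uL that by (auto simp: g_def)
  have cL: "c Y = 0" if "Y \<in> L" for Y
    using one_term[of Y g, OF that gL] that inj wu[OF that] by (simp add: c_def g_def)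
  have "(\<Sum>X\<in>G. c X * w X Z) = 0" if "Z \<in> G" for Z
  proof -
    have "(\<Sum>X\<in>G. c X * w X Z)
        = (\<Sum>X\<in>G. a X * w X Z) - (\<Sum>X\<in>G. \<Sum>X'\<in>G. g X' * w X' X * w X Z)"
      by (simp add: c_def left_diff_distrib sum_subtractf sum_distrib_right)
    also have "(\<Sum>X\<in>G. \<Sum>X'\<in>G. g X' * w X' X * w X Z) = (\<Sum>X'\<in>G. g X' * (\<Sum>X\<in>G. w X' X * w X Z))"
      by (subst sum.swap) (simp add: sum_distrib_left mult.assoc)
    also have "\<dots> = 0" using cc[OF _ that] by simp
    finally show ?thesis using cyc that by simp
  qed
  note ccyc = this
  \<comment> \<open>Once \<open>c\<close> vanishes on \<open>L\<close>, only \<open>u Y\<close>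
    contributes to the boundary of \<open>c\<close> at \<open>Y\<close>, so the cycle condition
    kills the coefficient of \<open>u Y\<close>.\<close>
  have cuL: "c Z = 0" if Z: "Z \<in> u ` L" for Z
  proof -
    obtain Y where Y: "Y \<in> L" "Z = u Y" using Z by auto
    have "(\<Sum>X\<in>G. c X * w X Y) = c (u Y) * w (u Y) Y" by (rule one_term[OF Y(1) cL])
    then show ?thesis using ccyc[of Y] Y LG wu[OF Y(1)] by auto
  qed
  have "(\<Sum>X\<in>H. c X * w X Y) = 0" if "Y \<in> H" for Y
  proof -
    have "(\<Sum>X\<in>G. c X * w X Y) = (\<Sum>X\<in>H. c X * w X Y)"
      by (rule sum.mono_neutral_right) (use fin HG cL cuL H in auto)
    then show ?thesis using ccyc[of Y] that HG by auto
  qed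
  then obtain c' where c': "\<And>Y. Y \<in> H \<Longrightarrow> c Y = (\<Sum>X\<in>H. c' X * w X Y)"
    using ex unfolding exact_on_def by blast
  show "\<exists>a'. \<forall>Y\<in>G. a Y = (\<Sum>X\<in>G. a' X * w X Y)"
  proof (intro exI ballI)
    fix Y assume Y: "Y \<in> G"
    have e: "(\<Sum>X\<in>G. (if X \<in> H then c' X else 0) * w X Y) = (\<Sum>X\<in>H. c' X * w X Y)"
      by (rule sum.mono_neutral_cong_right) (use fin HG in auto)
    have "(\<Sum>X\<in>G. (g X + (if X \<in> H then c' X else 0)) * w X Y) =
        (\<Sum>X\<in>G. g X * w X Y) + (\<Sum>X\<in>H. c' X * w X Y)"
      by (simp only: distrib_right sum.distrib e)
    also have "(\<Sum>X\<in>H. c' X * w X Y) = c Y"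
    proof (cases "Y \<in> H")
      case True then show ?thesis using c' by simp
    next
      case False
      then have "(\<Sum>X\<in>H. c' X * w X Y) = 0" using closed Y by (intro sum.neutral) auto
      moreover have "c Y = 0" using False Y H cL cuL by blast
      ultimately show ?thesis by simp
    qed
    finally show "a Y = (\<Sum>X\<in>G. (g X + (if X \<in> H then c' X else 0)) * w X Y)"
      by (simp add: c_def)
  qed
qed

text \<open>A cut position \<open>t\<close> stands for the edge of the cycle from \<open>t\<close> to \<open>t + 1\<close>, where the vertex
  \<open>n\<close> is also called \<open>0\<close>; the flag tells whether the edge is directed from \<open>t\<close> to \<open>t + 1\<close>. The
  orientations with unique sink at the block of \<open>0\<close> are those which point backwards on an initial
  segment of the cut positions and forwards on the remaining ones.\<close>

definition sink_cell :: "(nat \<times> bool) set \<Rightarrow> bool" where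
  "sink_cell X \<longleftrightarrow> X = {} \<or>
    ((\<exists>s. (s, False) \<in> X) \<and> (\<exists>t. (t, True) \<in> X) \<and> (\<forall>s t. (s, False) \<in> X \<longrightarrow> (t, True) \<in> X \<longrightarrow> s < t))"

definition cell_face :: "(nat \<times> bool) set \<Rightarrow> (nat \<times> bool) set \<Rightarrow> bool" where
  "cell_face X Y \<longleftrightarrow> (if Y = {} then card X = 2 else \<exists>x\<in>X. Y = X - {x})"

text \<open>The matchings below apply this to every \<open>Z\<close> outside the lower half; such a
  \<open>Z\<close> either contains the inserted edge or is empty.\<close>

lemma cell_face_iff_insert:
  assumes "Y \<noteq> {}" "x \<notin> Y" "x \<in> Z \<or> Z = {}"
  shows "cell_face Z Y \<longleftrightarrow> Z = insert x Y"
  using assms unfolding cell_face_def by auto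

text \<open>\<open>P\<close> stands for the directed cuts whose tail variable divides the
  multidegree, and \<open>N\<close> for the positions \<open>t\<close> where the multidegree has
  exponent 1 at \<open>t + 1\<close>, the common tail of \<open>(t, False)\<close> and
  \<open>(Suc t, True)\<close>.\<close>

lemma strand_exact:
  fixes w :: "(nat \<times> bool) set \<Rightarrow> (nat \<times> bool) set \<Rightarrow> 'a::field"
  assumes P: "finite P"
    and G: "G = {X. sink_cell X \<and> X \<subseteq> P \<and> (\<forall>t\<in>N. \<not> ((t, False) \<in> X \<and> (Suc t, True) \<in> X))}"
    and X0: "X0 \<in> G" "X0 \<noteq> {}"
    and w: "\<And>X Y. X \<in> G \<Longrightarrow> Y \<in> G \<Longrightarrow> w X Y \<noteq> 0 \<longleftrightarrow> cell_face X Y"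
    and cc: "\<And>X Z. X \<in> G \<Longrightarrow> Z \<in> G \<Longrightarrow> (\<Sum>Y\<in>G. w X Y * w Y Z) = 0"
  shows "exact_on w G"
proof -
  have fG: "finite G" by (rule finite_subset[of _ "Pow P"]) (use P G in auto)
  define p where "p = Min {s. (s, False) \<in> P}"
  have "finite ((\<lambda>s. (s, False)) -` P)"
    by (rule finite_vimageI) (use P in \<open>auto simp: inj_on_def\<close>)
  then have fF: "finite {s. (s, False) \<in> P}" by (simp add: vimage_def)
  obtain s0 t0 where st: "(s0, False) \<in> X0" "(t0, True) \<in> X0" "s0 < t0"
    using X0 unfolding G sink_cell_def by blast
  have pP: "(p, False) \<in> P"
  proof -
    have "p \<in> {s. (s, False) \<in> P}" unfolding p_def
      by (rule Min_in[OF fF]) (use st X0 G in blast)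
    then show ?thesis by simp
  qed
  have pmin: "p \<le> s" if "(s, False) \<in> P" for s
    unfolding p_def by (rule Min_le[OF fF]) (use that in simp)
  define q where "q = t0"
  have ps0: "p \<le> s0" using pmin st X0 G by blast
  have pq: "p < q" using ps0 st q_def by simp
  have qP: "(q, True) \<in> P" using st X0 G q_def by blast
  \<comment> \<open>\<open>p \<le> s0 < t0 = Suc p\<close> would force \<open>s0 = p\<close>, and
    then \<open>X0\<close> itself would contain the excluded pair.\<close>
  have qN: "\<not> (p \<in> N \<and> q = Suc p)"
  proof
    assume A: "p \<in> N \<and> q = Suc p"
    then have "s0 = p" using ps0 st q_def by simp
    then show False using A st X0 q_def unfolding G by blast
  qed
  have GI: "X \<in> G" if "sink_cell X" "X \<subseteq> P" "\<And>t. t \<in> N \<Longrightarrow> (t, False) \<in> X \<Longrightarrow> (Suc t, True) \<in> X \<Longrightarrow> False" for X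
    using that unfolding G by blast
  have GD: "sink_cell X" "X \<subseteq> P" "t \<in> N \<Longrightarrow> (t, False) \<in> X \<Longrightarrow> (Suc t, True) \<in> X \<Longrightarrow> False" if "X \<in> G" for X t
    using that unfolding G by blast+
  have Gsub: "Y \<in> G" if "X \<in> G" "Y \<subseteq> X" "sink_cell Y" for X Y
    by (rule GI) (use GD[OF that(1)] that in blast)+
  have ne: "\<exists>s. (s, False) \<in> X" "\<exists>t. (t, True) \<in> X" if "X \<in> G" "X \<noteq> {}" for X
    using GD(1)[OF that(1)] that unfolding sink_cell_def by blast+
  have lt: "s < t" if "X \<in> G" "(s, False) \<in> X" "(t, True) \<in> X" for X s t
    using GD(1)[OF that(1)] that unfolding sink_cell_def by blast
  \<comment> \<open>Both directions remain present because another edge of the deleted direction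
    stays.\<close>
  have rem: "X - {(r, d)} \<in> G" if XG: "X \<in> G" and r: "(r', d) \<in> X" "r' \<noteq> r" for X r r' d
  proof (rule Gsub[OF XG])
    have X: "X \<noteq> {}" using r by auto
    obtain s t where "(s, False) \<in> X" "(t, True) \<in> X" using ne[OF XG X] by blast
    then have "\<exists>s. (s, False) \<in> X - {(r, d)}" "\<exists>t. (t, True) \<in> X - {(r, d)}"
      using r by (cases d; blast)+
    then show "sink_cell (X - {(r, d)})" using lt[OF XG] unfolding sink_cell_def by blast
  qed blast
  define L1 where "L1 = {Y \<in> G. Y \<noteq> {} \<and> (p, False) \<notin> Y}"
  define G1 where "G1 = {Y \<in> G. Y = {} \<or> (\<forall>s. (s, False) \<in> Y \<longleftrightarrow> s = p)}"
  define L2 where "L2 = {Y \<in> G1. Y \<noteq> {} \<and> (q, True) \<notin> Y}"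
  define E where "E = {(p, False), (q, True)}"
  define G2 where "G2 = {{}, E}"
  have EG: "E \<in> G"
    by (rule GI) (use pP qP pq qN in \<open>auto simp: E_def sink_cell_def\<close>)
  have eG: "{} \<in> G" by (rule GI) (auto simp: sink_cell_def)
  have EG1: "E \<in> G1" using EG by (auto simp: G1_def E_def)
  have G1G: "G1 \<subseteq> G" by (auto simp: G1_def)
  have u1: "insert (p, False) Y \<in> G" if Y: "Y \<in> L1" for Y
  proof -
    have YG: "Y \<in> G" "Y \<noteq> {}" "(p, False) \<notin> Y" using Y by (auto simp: L1_def)
    obtain s t where s: "(s, False) \<in> Y" and t: "(t, True) \<in> Y" using ne YG by blast
    have sp: "p < s" using pmin[of s] s YG GD(2)[OF YG(1)] by (metis le_neq_implies_less subsetD)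
    \<comment> \<open>The only conflict with \<open>p\<close> could come from a forward edge at
      \<open>Suc p\<close>; the backward edge \<open>s > p\<close> of \<open>Y\<close> pushes all
      forward edges past it.\<close>
    have pt: "Suc p < t" if "(t, True) \<in> Y" for t using lt[OF YG(1) s that] sp by simp
    show ?thesis
    proof (rule GI)
      show "sink_cell (insert (p, False) Y)"
        using lt[OF YG(1)] pt t unfolding sink_cell_def by (auto intro: Suc_lessD)
      show "insert (p, False) Y \<subseteq> P" using pP GD(2)[OF YG(1)] by blast
      show False if "r \<in> N" "(r, False) \<in> insert (p, False) Y" "(Suc r, True) \<in> insert (p, False) Y" for r
        using that pt[of "Suc r"] GD(3)[OF YG(1), of r] by auto
    qed
  qed
  have u2: "insert (q, True) Y \<in> G1" if Y: "Y \<in> L2" for Y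
  proof -
    have YG: "Y \<in> G" "Y \<noteq> {}" "\<And>s. (s, False) \<in> Y \<longleftrightarrow> s = p" using Y by (auto simp: L2_def G1_def)
    have "insert (q, True) Y \<in> G"
    proof (rule GI)
      show "sink_cell (insert (q, True) Y)"
        using lt[OF YG(1)] pq YG(3) unfolding sink_cell_def by auto
      show "insert (q, True) Y \<subseteq> P" using qP GD(2)[OF YG(1)] by blast
      show False if "r \<in> N" "(r, False) \<in> insert (q, True) Y" "(Suc r, True) \<in> insert (q, True) Y" for r
        using that YG(3) qN GD(3)[OF YG(1), of r] by auto
    qed
    then show ?thesis using YG by (auto simp: G1_def)
  qed
  have G1_eq: "G1 = G - L1 - insert (p, False) ` L1"
  proof (intro equalityI subsetI)
    fix X assume X: "X \<in> G1"
    have "X \<notin> insert (p, False) ` L1"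
    proof
      assume "X \<in> insert (p, False) ` L1"
      then obtain Y where Y: "Y \<in> L1" "X = insert (p, False) Y" by blast
      then obtain s where "(s, False) \<in> Y" using ne[of Y] by (auto simp: L1_def)
      then have "s = p" using X Y unfolding G1_def by blast
      then show False using Y \<open>(s, False) \<in> Y\<close> unfolding L1_def by blast
    qed
    then show "X \<in> G - L1 - insert (p, False) ` L1" using X unfolding G1_def L1_def by blast
  next
    fix X assume X: "X \<in> G - L1 - insert (p, False) ` L1"
    show "X \<in> G1"
    proof (cases "X = {}")
      case True then show ?thesis using X unfolding G1_def by blast
    next
      case False
      then have pX: "(p, False) \<in> X" using X unfolding L1_def by blast
      \<comment> \<open>A second backward edge would exhibit \<open>X\<close> as the upper partner
        of \<open>X - {(p, False)}\<close>.\<close>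
      have "s = p" if "(s, False) \<in> X" for s
      proof (rule ccontr)
        assume n: "s \<noteq> p"
        then have "X - {(p, False)} \<in> L1" using rem[of X s False p] X that unfolding L1_def by blast
        moreover have "X = insert (p, False) (X - {(p, False)})" using pX by blast
        ultimately show False using X by blast
      qed
      then show ?thesis using X pX unfolding G1_def by blast
    qed
  qed
  have G2_eq: "G2 = G1 - L2 - insert (q, True) ` L2"
  proof (intro equalityI subsetI)
    fix X assume X: "X \<in> G2"
    have "X \<notin> insert (q, True) ` L2"
    proof
      assume "X \<in> insert (q, True) ` L2"
      then obtain Y where Y: "Y \<in> L2" "X = insert (q, True) Y" by blast
      then obtain s where "(s, True) \<in> Y" using ne[of Y] by (auto simp: L2_def G1_def)
      then have "s = q" using X Y unfolding G2_def E_def by blast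
      then show False using Y \<open>(s, True) \<in> Y\<close> unfolding L2_def by blast
    qed
    then show "X \<in> G1 - L2 - insert (q, True) ` L2"
      using X EG1 eG unfolding G2_def L2_def E_def G1_def by blast
  next
    fix X assume X: "X \<in> G1 - L2 - insert (q, True) ` L2"
    show "X \<in> G2"
    proof (cases "X = {}")
      case True then show ?thesis by (auto simp: G2_def)
    next
      case False
      then have pX: "(q, True) \<in> X" using X unfolding L2_def by blast
      have XF: "\<And>s. (s, False) \<in> X \<longleftrightarrow> s = p" using X False unfolding G1_def by blast
      have XT: "s = q" if "(s, True) \<in> X" for s
      proof (rule ccontr)
        assume n: "s \<noteq> q"
        then have "X - {(q, True)} \<in> L2" using rem[of X s True q] X that XF unfolding L2_def G1_def by blast
        moreover have "X = insert (q, True) (X - {(q, True)})" using pX by blast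
        ultimately show False using X by blast
      qed
      have "z \<in> X \<longleftrightarrow> z \<in> E" for z
        using XF[of "fst z"] XT[of "fst z"] pX by (cases z; cases "snd z") (auto simp: E_def)
      then show ?thesis by (auto simp: G2_def)
    qed
  qed
  have nface: "X \<noteq> {}" if "cell_face X Y" for X Y using that by (auto simp: cell_face_def split: if_splits)
  \<comment> \<open>A nonempty face has some backward edge and inherits it from \<open>X\<close>, so
    it cannot leave \<open>G1\<close>.\<close>
  have cG1: "w X Y = 0" if X: "X \<in> G1" and Y: "Y \<in> G - G1" for X Y
  proof (rule ccontr)
    assume "w X Y \<noteq> 0"
    then have f: "cell_face X Y" using w X Y G1G by blast
    have Yn: "Y \<noteq> {}" using Y by (auto simp: G1_def)
    then have "Y \<subseteq> X" using f by (auto simp: cell_face_def)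
    moreover obtain s where "(s, False) \<in> Y" using ne[of Y] Y Yn by blast
    ultimately show False using X Y nface[OF f] by (auto simp: G1_def)
  qed
  \<comment> \<open>The last pair, with the empty cell below and \<open>E\<close> above; nothing is
    left over.\<close>
  have ex2: "exact_on w G2"
  proof (rule exact_on_toggle[where L = "{{}}" and u = "\<lambda>_. E" and H = "{}"])
    show "(\<Sum>Y\<in>G2. w X Y * w Y Z) = 0" if "X \<in> G2" "Z \<in> G2" for X Z
      using that w[of E E] w[of "{}" E] w[of "{}" "{}"] eG EG
      by (auto simp: G2_def cell_face_def E_def)
    show "w Z Y \<noteq> 0 \<longleftrightarrow> Z = E" if "Y \<in> {{}}" "Z \<in> G2 - {{}}" for Y Z
      using that w[of E "{}"] eG EG pq by (auto simp: G2_def cell_face_def E_def)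
    show "exact_on w {}" by (simp add: exact_on_def)
  qed (auto simp: G2_def E_def)
  have G2G1: "G2 \<subseteq> G1" using G2_eq by blast
  have ex1: "exact_on w G1"
  proof (rule exact_on_toggle[where L = L2 and u = "insert (q, True)" and H = G2])
    show "finite G1" using fG G1G by (rule rev_finite_subset)
    show "(\<Sum>Y\<in>G1. w X Y * w Y Z) = 0" if "X \<in> G1" "Z \<in> G1" for X Z
    proof -
      have "(\<Sum>Y\<in>G. w X Y * w Y Z) = (\<Sum>Y\<in>G1. w X Y * w Y Z)"
        by (rule sum.mono_neutral_right) (use fG G1G cG1 that in auto)
      then show ?thesis using cc that G1G by (metis subsetD)
    qed
    show "w Z Y \<noteq> 0 \<longleftrightarrow> Z = insert (q, True) Y" if Y: "Y \<in> L2" and Z: "Z \<in> G1 - L2" for Y Z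
    proof -
      have "w Z Y \<noteq> 0 \<longleftrightarrow> cell_face Z Y" using w Y Z G1G by (auto simp: L2_def)
      also have "\<dots> \<longleftrightarrow> Z = insert (q, True) Y"
        by (rule cell_face_iff_insert) (use Y Z in \<open>unfold L2_def, blast\<close>)+
      finally show ?thesis .
    qed
    \<comment> \<open>Deleting either edge of \<open>E\<close> leaves a single direction, so
      \<open>E\<close> has no nonempty face.\<close>
    show "w X Y = 0" if X: "X \<in> G2" and Y: "Y \<in> G1 - G2" for X Y
    proof (rule ccontr)
      assume "w X Y \<noteq> 0"
      then have f: "cell_face X Y" using w X Y G1G G2G1 by blast
      have Yn: "Y \<noteq> {}" using Y unfolding G2_def by blast
      have YG: "Y \<in> G" using Y G1G by blast
      obtain x where "x \<in> X" "Y = X - {x}" using f Yn unfolding cell_face_def by (auto split: if_splits)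
      moreover from this have "X = E" using X unfolding G2_def by blast
      ultimately have x: "x = (p, False) \<or> x = (q, True)" "Y = E - {x}" unfolding E_def by blast+
      obtain s t where "(s, False) \<in> Y" "(t, True) \<in> Y" using ne[OF YG Yn] by blast
      then show False using x unfolding E_def by blast
    qed
    show "inj_on (insert (q, True)) L2"
      by (rule inj_onI) (metis (no_types, lifting) L2_def insert_ident mem_Collect_eq)
    show "L2 \<subseteq> G1" unfolding L2_def by blast
    show "insert (q, True) ` L2 \<subseteq> G1 - L2" using u2 unfolding L2_def by blast
  qed (fact G2_eq ex2)+
  show ?thesis
  proof (rule exact_on_toggle[where L = L1 and u = "insert (p, False)" and H = G1])
    show "w Z Y \<noteq> 0 \<longleftrightarrow> Z = insert (p, False) Y" if Y: "Y \<in> L1" and Z: "Z \<in> G - L1" for Y Z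
    proof -
      have "w Z Y \<noteq> 0 \<longleftrightarrow> cell_face Z Y" using w Y Z by (auto simp: L1_def)
      also have "\<dots> \<longleftrightarrow> Z = insert (p, False) Y"
        by (rule cell_face_iff_insert) (use Y Z in \<open>unfold L1_def, blast\<close>)+
      finally show ?thesis .
    qed
    show "inj_on (insert (p, False)) L1"
      by (rule inj_onI) (metis (no_types, lifting) L1_def insert_ident mem_Collect_eq)
    show "L1 \<subseteq> G" unfolding L1_def by blast
    show "insert (p, False) ` L1 \<subseteq> G - L1" using u1 unfolding L1_def by blast
  qed (fact fG cc G1_eq ex1 cG1)+
qed

section \<open>Multigraded complexes of free modules\<close>

abbreviation lookup :: "('k \<Rightarrow>\<^sub>0 'v::zero) \<Rightarrow> 'k \<Rightarrow> 'v" where "lookup \<equiv> Poly_Mapping.lookup"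

definition exp_le :: "(nat \<Rightarrow>\<^sub>0 nat) \<Rightarrow> (nat \<Rightarrow>\<^sub>0 nat) \<Rightarrow> bool" where
  "exp_le a b \<longleftrightarrow> (\<forall>i. lookup a i \<le> lookup b i)"

lemma exp_le_add_diff: "exp_le a b \<Longrightarrow> a + (b - a) = b"
  by (rule poly_mapping_eqI) (simp add: lookup_add lookup_minus exp_le_def)

lemma exp_le_diff_diff:
  assumes "exp_le c a" "exp_le c m"
  shows "exp_le (a - c) (m - c) \<longleftrightarrow> exp_le a m" "(m - c) - (a - c) = m - a"
proof -
  show "exp_le (a - c) (m - c) \<longleftrightarrow> exp_le a m"
    using assms by (auto simp: exp_le_def lookup_minus le_diff_iff)
  show "(m - c) - (a - c) = m - a"
    using assms by (auto intro!: poly_mapping_eqI simp: exp_le_def lookup_minus)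
qed

lemma exp_le_plus [simp]: "exp_le a (a + b)" "exp_le a (b + a)"
  by (simp_all add: exp_le_def lookup_add)

lemma exp_le_trans: "exp_le a b \<Longrightarrow> exp_le b c \<Longrightarrow> exp_le a c"
  unfolding exp_le_def by (meson order_trans)

lemma lookup_single_mult:
  fixes p :: "(nat \<Rightarrow>\<^sub>0 nat) \<Rightarrow>\<^sub>0 'a::comm_ring_1"
  shows "lookup (Poly_Mapping.single a c * p) m = (if exp_le a m then c * lookup p (m - a) else 0)"
proof -
  have e: "m = a + q \<longleftrightarrow> exp_le a m \<and> q = m - a" for q
    using exp_le_add_diff[of a m] by auto
  have "lookup (Poly_Mapping.single a c * p) m
      = (\<Sum>l. (c * (\<Sum>q. lookup p q when m = l + q)) when a = l)"
    by (simp add: lookup_mult lookup_single when_mult)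
  also have "\<dots> = c * (\<Sum>q. lookup p q when m = a + q)" by simp
  also have "\<dots> = (if exp_le a m then c * lookup p (m - a) else 0)"
    by (cases "exp_le a m") (simp_all add: e)
  finally show ?thesis .
qed

section \<open>The polynomial ring as a commutative ring\<close>

lemma mpoly_ring_simps [simp]:
  "p \<oplus>\<^bsub>mpoly_ring n\<^esub> q = p + q" "p \<otimes>\<^bsub>mpoly_ring n\<^esub> q = p * q"
  "\<zero>\<^bsub>mpoly_ring n\<^esub> = 0" "\<one>\<^bsub>mpoly_ring n\<^esub> = 1"
  by (simp_all add: mpoly_ring_def)

lemma mpoly_ring_carrier:
  "p \<in> carrier (mpoly_ring n) \<longleftrightarrow> (\<forall>m\<in>Poly_Mapping.keys p. Poly_Mapping.keys m \<subseteq> {1..n})"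
  by (simp add: mpoly_ring_def)

lemma mpoly_carrier_zero [simp]: "0 \<in> carrier (mpoly_ring n)"
  by (simp add: mpoly_ring_carrier)

lemma mpoly_carrier_one [simp]: "1 \<in> carrier (mpoly_ring n)"
  by (simp add: mpoly_ring_carrier)

lemma mpoly_carrier_add:
  "p \<in> carrier (mpoly_ring n) \<Longrightarrow> q \<in> carrier (mpoly_ring n) \<Longrightarrow> p + q \<in> carrier (mpoly_ring n)"
  using Poly_Mapping.keys_add[of p q] unfolding mpoly_ring_carrier by blast

lemma mpoly_carrier_uminus:
  "p \<in> carrier (mpoly_ring n) \<Longrightarrow> - p \<in> carrier (mpoly_ring n)"
  unfolding mpoly_ring_carrier by (simp add: in_keys_iff)

lemma mpoly_carrier_mult:
  assumes "p \<in> carrier (mpoly_ring n)" "q \<in> carrier (mpoly_ring n)"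
  shows "p * q \<in> carrier (mpoly_ring n)"
  unfolding mpoly_ring_carrier
proof
  fix m assume "m \<in> Poly_Mapping.keys (p * q)"
  then obtain a b where "m = a + b" "a \<in> Poly_Mapping.keys p" "b \<in> Poly_Mapping.keys q"
    using keys_mult[of p q] by blast
  then show "Poly_Mapping.keys m \<subseteq> {1..n}"
    using assms Poly_Mapping.keys_add[of a b] unfolding mpoly_ring_carrier by blast
qed

lemma mpoly_carrier_single:
  "Poly_Mapping.keys e \<subseteq> {1..n} \<Longrightarrow> Poly_Mapping.single e c \<in> carrier (mpoly_ring n)"
  by (simp add: mpoly_ring_carrier)

lemma mpoly_carrier_sum:
  "(\<And>x. x \<in> S \<Longrightarrow> f x \<in> carrier (mpoly_ring n)) \<Longrightarrow> (\<Sum>x\<in>S. f x) \<in> carrier (mpoly_ring n)"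
  by (induction S rule: infinite_finite_induct) (auto intro: mpoly_carrier_add)

lemma cring_mpoly_ring: "cring (mpoly_ring n :: 'a::field mpoly ring)"
proof (rule cringI)
  show "abelian_group (mpoly_ring n :: 'a mpoly ring)"
  proof (rule abelian_groupI)
    fix p :: "'a mpoly" assume "p \<in> carrier (mpoly_ring n)"
    then show "\<exists>q\<in>carrier (mpoly_ring n). q \<oplus>\<^bsub>mpoly_ring n\<^esub> p = \<zero>\<^bsub>mpoly_ring n\<^esub>"
      by (intro bexI[of _ "- p"]) (auto intro: mpoly_carrier_uminus)
  qed (auto intro: mpoly_carrier_add simp: ac_simps)
  show "comm_monoid (mpoly_ring n :: 'a mpoly ring)"
    by (rule comm_monoidI) (auto intro: mpoly_carrier_mult simp: ac_simps)
qed (auto simp: algebra_simps)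

lemma mpoly_ring_a_inv:
  assumes "p \<in> carrier (mpoly_ring n :: 'a::field mpoly ring)"
  shows "\<ominus>\<^bsub>mpoly_ring n\<^esub> p = - p"
proof -
  interpret cring "mpoly_ring n :: 'a mpoly ring" by (rule cring_mpoly_ring)
  show ?thesis by (rule minus_equality) (use assms mpoly_carrier_uminus in auto)
qed

lemma sum_mem_ideal:
  assumes "ideal I (mpoly_ring n :: 'a::field mpoly ring)" "\<And>x. x \<in> S \<Longrightarrow> f x \<in> I"
  shows "(\<Sum>x\<in>S. f x) \<in> I"
proof -
  interpret ideal I "mpoly_ring n :: 'a mpoly ring" by fact
  show ?thesis using assms(2)
  proof (induction S rule: infinite_finite_induct)
    case (insert x S)
    then have "f x \<oplus>\<^bsub>mpoly_ring n\<^esub> sum f S \<in> I" by (intro additive_subgroup.a_closed[OF is_additive_subgroup]) auto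
    then show ?case using insert by simp
  qed (use additive_subgroup.zero_closed[OF is_additive_subgroup] in auto)
qed

section \<open>Free modules and complexes given by scalar matrices\<close>

lemma free_module_simps [simp]:
  "v \<oplus>\<^bsub>free_module (mpoly_ring n) B\<^esub> u = (\<lambda>b. v b + u b)"
  "r \<odot>\<^bsub>free_module (mpoly_ring n) B\<^esub> u = (\<lambda>b. r * u b)"
  "\<zero>\<^bsub>free_module (mpoly_ring n) B\<^esub> = (\<lambda>b. 0)"
  by (simp_all add: free_module_def)

lemma free_module_carrier:
  assumes "finite B"
  shows "v \<in> carrier (free_module (mpoly_ring n) B) \<longleftrightarrow>
    (\<forall>b\<in>B. v b \<in> carrier (mpoly_ring n)) \<and> (\<forall>b. b \<notin> B \<longrightarrow> v b = 0)"
proof -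
  have "finite {b. v b \<noteq> 0}" if "\<forall>b. b \<notin> B \<longrightarrow> v b = 0"
    by (rule finite_subset[OF _ assms]) (use that in auto)
  then show ?thesis by (auto simp: free_module_def)
qed

text \<open>The differential is the scalar matrix \<open>w\<close>, homogenized by the monomials of
  exponent \<open>D b - D b'\<close>. The assumption \<open>strand\<close> is exactness in the
  single multidegree \<open>m\<close> and homological degree \<open>Suc j\<close>;
  \<open>w_first\<close> makes the image in degree 0 the full monomial ideal.\<close>

locale multigraded_complex =
  fixes n :: nat and B :: "nat \<Rightarrow> 'b set" and D :: "'b \<Rightarrow> (nat \<Rightarrow>\<^sub>0 nat)"
    and w :: "'b \<Rightarrow> 'b \<Rightarrow> 'a::field" and b0 :: 'b
  assumes fin: "finite (B j)"
    and B0: "B 0 = {b0}"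
    and D0: "D b0 = 0"
    and D_keys: "b \<in> B j \<Longrightarrow> Poly_Mapping.keys (D b) \<subseteq> {1..n}"
    and w_mem: "b \<in> B (Suc j) \<Longrightarrow> w b b' \<noteq> 0 \<Longrightarrow> b' \<in> B j"
    and w_deg: "b \<in> B (Suc j) \<Longrightarrow> w b b' \<noteq> 0 \<Longrightarrow> exp_le (D b') (D b) \<and> D b' \<noteq> D b"
    and w_w: "b \<in> B (Suc (Suc j)) \<Longrightarrow> b'' \<in> B j \<Longrightarrow> (\<Sum>b'\<in>B (Suc j). w b b' * w b' b'') = 0"
    and w_first: "b \<in> B 1 \<Longrightarrow> w b b0 \<noteq> 0"
    and strand: "(\<And>b'. b' \<in> B j \<Longrightarrow> exp_le (D b') m \<Longrightarrow>
          (\<Sum>b\<in>{b \<in> B (Suc j). exp_le (D b) m}. a b * w b b') = 0) \<Longrightarrow>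
        \<exists>a'. \<forall>b\<in>B (Suc j). exp_le (D b) m \<longrightarrow>
          a b = (\<Sum>b''\<in>{b'' \<in> B (Suc (Suc j)). exp_le (D b'') m}. a' b'' * w b'' b)"
begin

definition d :: "nat \<Rightarrow> ('b \<Rightarrow> 'a mpoly) \<Rightarrow> ('b \<Rightarrow> 'a mpoly)" where
  "d j v = (\<lambda>b'. \<Sum>b\<in>B j. Poly_Mapping.single (D b - D b') (w b b') * v b)"

abbreviation R :: "'a mpoly ring" where "R \<equiv> mpoly_ring n"
abbreviation F where "F j \<equiv> free_module R (B j)"

lemmas F_carrier = free_module_carrier[OF fin]

lemma keys_D_diff: "b \<in> B j \<Longrightarrow> Poly_Mapping.keys (D b - e) \<subseteq> {1..n}"
  using D_keys[of b j] by (auto simp: in_keys_iff lookup_minus)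

lemma generators_closed: "{monomial (D b) | b. b \<in> B 1} \<subseteq> carrier R"
  using mpoly_carrier_single[OF D_keys] unfolding monomial_def by blast

lemma d_closed:
  assumes "v \<in> carrier (F (Suc j))"
  shows "d (Suc j) v \<in> carrier (F j)"
proof -
  have "d (Suc j) v b' \<in> carrier R" for b' unfolding d_def
    by (intro mpoly_carrier_sum mpoly_carrier_mult mpoly_carrier_single keys_D_diff)
      (use assms in \<open>auto simp: F_carrier\<close>)
  moreover have "d (Suc j) v b' = 0" if "b' \<notin> B j" for b'
    unfolding d_def by (rule sum.neutral) (use w_mem that in force)
  ultimately show ?thesis by (auto simp: F_carrier)
qed

lemma d_hom: "d (Suc j) \<in> module_hom_set R (F (Suc j)) (F j)"
  unfolding module_hom_set_def
  using d_closed
  by (auto simp: d_def fun_eq_iff distrib_left sum.distrib sum_distrib_left mult.left_commute)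

text \<open>The coefficient at \<open>m - D b\<close> in coordinate \<open>b\<close> is the
  component of multidegree \<open>m\<close>. On these components the differential is
  \<open>w\<close>, restricted to the generators whose degree divides \<open>m\<close>.\<close>

lemma lookup_d:
  assumes "exp_le (D b') m"
  shows "lookup (d (Suc j) v b') (m - D b') =
    (\<Sum>b\<in>{b \<in> B (Suc j). exp_le (D b) m}. lookup (v b) (m - D b) * w b b')"
proof -
  have "lookup (d (Suc j) v b') (m - D b') =
      (\<Sum>b\<in>B (Suc j). if exp_le (D b) m then lookup (v b) (m - D b) * w b b' else 0)"
    unfolding d_def lookup_sum
  proof (rule sum.cong[OF refl])
    fix b assume b: "b \<in> B (Suc j)"
    show "lookup (Poly_Mapping.single (D b - D b') (w b b') * v b) (m - D b') =
      (if exp_le (D b) m then lookup (v b) (m - D b) * w b b' else 0)"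
    proof (cases "w b b' = 0")
      case False
      \<comment> \<open>With this divisibility the truncated differences compose: removing
        \<open>D b - D b'\<close> from \<open>m - D b'\<close> leaves
        \<open>m - D b\<close>.\<close>
      then have "exp_le (D b') (D b)" using w_deg[OF b] by simp
      then show ?thesis using assms by (simp add: lookup_single_mult exp_le_diff_diff mult.commute[of "w b b'"])
    qed (simp add: lookup_single_mult)
  qed
  also have "\<dots> = (\<Sum>b\<in>{b \<in> B (Suc j). exp_le (D b) m}. lookup (v b) (m - D b) * w b b')"
    by (rule sum.inter_filter[symmetric, OF fin])
  finally show ?thesis .
qed

text \<open>Every exponent \<open>k\<close> equals \<open>m - e\<close> for
  \<open>m = k + e\<close>, so the components seen by the strands determine the polynomial.\<close>

lemma mpoly_eq_shiftI:
  fixes p q :: "'a mpoly"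
  assumes "\<And>m. exp_le e m \<Longrightarrow> lookup p (m - e) = lookup q (m - e)"
  shows "p = q"
proof (rule poly_mapping_eqI)
  fix k show "lookup p k = lookup q k" using assms[of "k + e"] by simp
qed

lemma d_d:
  assumes v: "v \<in> carrier (F (Suc (Suc j)))"
  shows "d (Suc j) (d (Suc (Suc j)) v) = (\<lambda>b. 0)"
proof
  fix b'' show "d (Suc j) (d (Suc (Suc j)) v) b'' = 0"
  proof (cases "b'' \<in> B j")
    case False
    then show ?thesis using d_closed[OF d_closed[OF v]] by (auto simp: F_carrier)
  next
    case b'': True
    show ?thesis
    proof (rule mpoly_eq_shiftI[of "D b''"])
      fix m assume m: "exp_le (D b'') m"
      let ?S = "\<lambda>j. {b \<in> B j. exp_le (D b) m}"
      have "lookup (d (Suc j) (d (Suc (Suc j)) v) b'') (m - D b'') =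
          (\<Sum>b'\<in>?S (Suc j). (\<Sum>b\<in>?S (Suc (Suc j)). lookup (v b) (m - D b) * w b b') * w b' b'')"
        unfolding lookup_d[OF m] by (rule sum.cong) (auto simp: lookup_d)
      also have "\<dots> = (\<Sum>b\<in>?S (Suc (Suc j)). lookup (v b) (m - D b) *
          (\<Sum>b'\<in>?S (Suc j). w b b' * w b' b''))"
        by (simp add: sum_distrib_right, subst sum.swap) (simp add: sum_distrib_left mult.assoc)
      also have "\<dots> = 0"
      proof (rule sum.neutral, rule ballI)
        fix b assume b: "b \<in> ?S (Suc (Suc j))"
        \<comment> \<open>Intermediate generators outside the strand contribute nothing: a nonzero
          \<open>w b b'\<close> means that \<open>D b'\<close> divides \<open>D b\<close>, which
          divides \<open>m\<close>.\<close>
        have "(\<Sum>b'\<in>?S (Suc j). w b b' * w b' b'') = (\<Sum>b'\<in>B (Suc j). w b b' * w b' b'')"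
        proof (rule sum.mono_neutral_left[OF fin])
          have "w b b' = 0" if "\<not> exp_le (D b') m" for b'
            using b w_deg[of b "Suc j" b'] exp_le_trans[of "D b'" "D b" m] that by blast
          then show "\<forall>b'\<in>B (Suc j) - ?S (Suc j). w b b' * w b' b'' = 0" by auto
        qed blast
        then show "lookup (v b) (m - D b) * (\<Sum>b'\<in>?S (Suc j). w b b' * w b' b'') = 0"
          using w_w b b'' by simp
      qed
      finally show "lookup (d (Suc j) (d (Suc (Suc j)) v) b'') (m - D b'') = lookup 0 (m - D b'')"
        by simp
    qed
  qed
qed

text \<open>The cycle is split into multihomogeneous components, \<open>strand\<close> bounds each
  of them, and finitely many of these choices are reassembled into one preimage.\<close>

lemma exact:
  assumes v: "v \<in> carrier (F (Suc j))" and dv: "d (Suc j) v = (\<lambda>b. 0)"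
  shows "\<exists>u \<in> carrier (F (Suc (Suc j))). d (Suc (Suc j)) u = v"
proof -
  have "\<forall>m. \<exists>a'. \<forall>b\<in>B (Suc j). exp_le (D b) m \<longrightarrow> lookup (v b) (m - D b) =
      (\<Sum>b''\<in>{b'' \<in> B (Suc (Suc j)). exp_le (D b'') m}. a' b'' * w b'' b)"
  proof
    fix m
    show "\<exists>a'. \<forall>b\<in>B (Suc j). exp_le (D b) m \<longrightarrow> lookup (v b) (m - D b) =
      (\<Sum>b''\<in>{b'' \<in> B (Suc (Suc j)). exp_le (D b'') m}. a' b'' * w b'' b)"
    proof (rule strand)
      fix b' assume "exp_le (D b') m"
      from lookup_d[OF this, of j v]
      show "(\<Sum>b\<in>{b \<in> B (Suc j). exp_le (D b) m}. lookup (v b) (m - D b) * w b b') = 0"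
        by (simp add: dv)
    qed
  qed
  from choice[OF this]
  obtain A where A: "\<And>m b. b \<in> B (Suc j) \<Longrightarrow> exp_le (D b) m \<Longrightarrow> lookup (v b) (m - D b) =
      (\<Sum>b''\<in>{b'' \<in> B (Suc (Suc j)). exp_le (D b'') m}. A m b'' * w b'' b)"
    by blast
  \<comment> \<open>The multidegrees in which \<open>v\<close> has a nonzero component; their
    finiteness is what allows the choices to be summed to polynomials.\<close>
  define M where "M = {m. \<exists>b\<in>B (Suc j). exp_le (D b) m \<and> lookup (v b) (m - D b) \<noteq> 0}"
  have Msub: "M \<subseteq> (\<Union>b\<in>B (Suc j). (+) (D b) ` Poly_Mapping.keys (v b))"
  proof
    fix m assume "m \<in> M"
    then obtain b where b: "b \<in> B (Suc j)" "exp_le (D b) m" "m - D b \<in> Poly_Mapping.keys (v b)"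
      unfolding M_def in_keys_iff by blast
    then have "m = D b + (m - D b)" by (simp add: exp_le_add_diff)
    then show "m \<in> (\<Union>b\<in>B (Suc j). (+) (D b) ` Poly_Mapping.keys (v b))" using b by blast
  qed
  then have finM: "finite M" by (rule finite_subset) (simp add: fin)
  \<comment> \<open>This keeps the exponents of the preimage within the variables
    \<open>1..n\<close>.\<close>
  have Mkeys: "Poly_Mapping.keys m \<subseteq> {1..n}" if m: "m \<in> M" for m
  proof -
    obtain b k where b: "b \<in> B (Suc j)" "k \<in> Poly_Mapping.keys (v b)" "m = D b + k"
      using Msub m by blast
    then have "Poly_Mapping.keys k \<subseteq> {1..n}" using v unfolding F_carrier mpoly_ring_carrier by blast
    then show ?thesis using b D_keys[OF b(1)] Poly_Mapping.keys_add[of "D b" k] by blast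
  qed
  define u where "u b = (if b \<in> B (Suc (Suc j)) then
      (\<Sum>m\<in>{m \<in> M. exp_le (D b) m}. Poly_Mapping.single (m - D b) (A m b)) else 0)" for b
  have uF: "u \<in> carrier (F (Suc (Suc j)))"
  proof -
    have "Poly_Mapping.keys (m - e) \<subseteq> {1..n}" if "m \<in> M" for m e
      using Mkeys[OF that] by (rule order_trans[rotated]) (auto simp: in_keys_iff lookup_minus)
    then have "Poly_Mapping.single (m - e) c \<in> carrier R" if "m \<in> M" for m e c
      using that by (blast intro: mpoly_carrier_single)
    then have "u b \<in> carrier R" for b
      unfolding u_def by (auto intro!: mpoly_carrier_sum)
    moreover have "u b = 0" if "b \<notin> B (Suc (Suc j))" for b using that by (simp add: u_def)
    ultimately show ?thesis by (simp add: F_carrier)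
  qed
  have lu: "lookup (u b) (m - D b) = (if m \<in> M then A m b else 0)"
    if b: "b \<in> B (Suc (Suc j))" "exp_le (D b) m" for b m
  proof -
    \<comment> \<open>Different multidegrees give different exponents after subtracting
      \<open>D b\<close>, so the chosen coefficients do not collide in \<open>u b\<close>.\<close>
    have "(m' - D b = m - D b) \<longleftrightarrow> m' = m" if "exp_le (D b) m'" for m'
      using exp_le_add_diff[OF b(2)] exp_le_add_diff[OF that] by metis
    then have "lookup (u b) (m - D b) = (\<Sum>m'\<in>{m \<in> M. exp_le (D b) m}. if m' = m then A m b else 0)"
      using b by (auto simp: u_def lookup_sum lookup_single when_def intro!: sum.cong)
    then show ?thesis using finM b by simp
  qed
  have "d (Suc (Suc j)) u b = v b" for b
  proof (cases "b \<in> B (Suc j)")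
    case False
    then show ?thesis using v d_closed[OF uF] by (auto simp: F_carrier)
  next
    case b: True
    show ?thesis
    proof (rule mpoly_eq_shiftI[of "D b"])
      fix m assume m: "exp_le (D b) m"
      have "lookup (d (Suc (Suc j)) u b) (m - D b) =
         (\<Sum>b''\<in>{b'' \<in> B (Suc (Suc j)). exp_le (D b'') m}. (if m \<in> M then A m b'' else 0) * w b'' b)"
        unfolding lookup_d[OF m] by (rule sum.cong) (auto simp: lu)
      also have "\<dots> = lookup (v b) (m - D b)"
      proof (cases "m \<in> M")
        case True
        then show ?thesis using A[OF b m] by simp
      next
        case False
        then have "lookup (v b) (m - D b) = 0" using b m unfolding M_def by blast
        then show ?thesis using False by simp
      qed
      finally show "lookup (d (Suc (Suc j)) u b) (m - D b) = lookup (v b) (m - D b)" .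
    qed
  qed
  then show ?thesis using uF by blast
qed

lemma d_first: "d (Suc 0) v b0 = (\<Sum>b\<in>B 1. Poly_Mapping.single (D b) (w b b0) * v b)"
  by (simp add: d_def D0)

lemma image_d_first_ideal: "ideal ((\<lambda>v. d (Suc 0) v b0) ` carrier (F 1)) R"
proof -
  interpret cring R by (rule cring_mpoly_ring)
  let ?J = "(\<lambda>v. d (Suc 0) v b0) ` carrier (F 1)"
  have sub: "?J \<subseteq> carrier R"
  proof (rule image_subsetI)
    fix v assume "v \<in> carrier (F 1)"
    then have "d (Suc 0) v \<in> carrier (F 0)" using d_closed[of v 0] by simp
    then show "d (Suc 0) v b0 \<in> carrier R" unfolding F_carrier using B0 by simp
  qed
  have lin: "x * p \<in> ?J" if p: "p \<in> ?J" and x: "x \<in> carrier R" for x p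
  proof -
    obtain v where v: "v \<in> carrier (F 1)" "p = d (Suc 0) v b0" using p by blast
    have "x * p = d (Suc 0) (\<lambda>b. x * v b) b0"
      by (simp add: v d_first sum_distrib_left mult.left_commute)
    moreover have "(\<lambda>b. x * v b) \<in> carrier (F 1)"
      using v x by (auto simp: F_carrier intro: mpoly_carrier_mult)
    ultimately show ?thesis by blast
  qed
  show ?thesis
  proof (rule idealI)
    show "ring R" by (rule ring_axioms)
    show "subgroup ?J (add_monoid R)"
    proof (rule add.subgroupI)
      have "(\<lambda>b. 0) \<in> carrier (F 1)" by (simp add: F_carrier)
      then show "?J \<noteq> {}" by blast
      show "\<ominus>\<^bsub>R\<^esub> p \<in> ?J" if "p \<in> ?J" for p
      proof -
        have "(- 1) * p \<in> ?J" by (rule lin[OF that]) (auto simp: mpoly_ring_carrier)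
        then show ?thesis using that sub by (simp add: mpoly_ring_a_inv subset_iff)
      qed
      show "p \<oplus>\<^bsub>R\<^esub> q \<in> ?J" if pq: "p \<in> ?J" "q \<in> ?J" for p q
      proof -
        obtain u v where uv: "u \<in> carrier (F 1)" "p = d (Suc 0) u b0" "v \<in> carrier (F 1)" "q = d (Suc 0) v b0"
          using pq by blast
        have "p + q = d (Suc 0) (\<lambda>b. u b + v b) b0"
          by (simp add: uv d_first sum.distrib distrib_left)
        moreover have "(\<lambda>b. u b + v b) \<in> carrier (F 1)"
          using uv by (auto simp: F_carrier intro: mpoly_carrier_add)
        ultimately show ?thesis by auto
      qed
    qed (use sub in auto)
  qed (use lin in \<open>auto simp: mult.commute\<close>)
qed

text \<open>Over a field the nonzero scalars \<open>w b b0\<close> can be divided out, so the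
  entries of the first differential generate the same ideal as the bare monomials.\<close>

lemma mem_ideal_iff:
  "p \<in> Idl\<^bsub>R\<^esub> {monomial (D b) | b. b \<in> B 1} \<longleftrightarrow> (\<exists>v\<in>carrier (F 1). d (Suc 0) v b0 = p)"
proof -
  interpret cring R by (rule cring_mpoly_ring)
  let ?G = "{monomial (D b) :: 'a mpoly | b. b \<in> B 1}" and ?J = "(\<lambda>v. d (Suc 0) v b0) ` carrier (F 1)"
  note G = generators_closed
  have "?G \<subseteq> ?J"
  proof
    fix p assume "p \<in> ?G"
    then obtain b where b: "b \<in> B 1" "p = monomial (D b)" by blast
    define v where "v = (\<lambda>x. if x = b then Poly_Mapping.single 0 (inverse (w b b0)) else (0 :: 'a mpoly))"
    have "v \<in> carrier (F 1)" using b by (auto simp: v_def F_carrier intro!: mpoly_carrier_single)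
    moreover have "d (Suc 0) v b0 = Poly_Mapping.single (D b) (w b b0) * v b"
      unfolding d_first by (subst sum.remove[OF fin b(1)]) (auto simp: v_def intro!: sum.neutral)
    then have "d (Suc 0) v b0 = p" using w_first[OF b(1)] by (simp add: b v_def monomial_def mult_single)
    ultimately show "p \<in> ?J" by blast
  qed
  then have 1: "Idl\<^bsub>R\<^esub> ?G \<subseteq> ?J" by (rule genideal_minimal[OF image_d_first_ideal])
  have 2: "d (Suc 0) v b0 \<in> Idl\<^bsub>R\<^esub> ?G" if v: "v \<in> carrier (F 1)" for v
    unfolding d_first
  proof (rule sum_mem_ideal[OF genideal_ideal[OF G]])
    fix b assume b: "b \<in> B 1"
    interpret I: ideal "Idl\<^bsub>R\<^esub> ?G" R by (rule genideal_ideal[OF G])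
    have "monomial (D b) \<in> Idl\<^bsub>R\<^esub> ?G" using genideal_self[OF G] b by blast
    moreover have "Poly_Mapping.single 0 (w b b0) * v b \<in> carrier R"
      using v b by (auto simp: F_carrier intro!: mpoly_carrier_mult mpoly_carrier_single)
    ultimately have "(Poly_Mapping.single 0 (w b b0) * v b) \<otimes>\<^bsub>R\<^esub> monomial (D b) \<in> Idl\<^bsub>R\<^esub> ?G"
      by (rule I.I_l_closed)
    moreover have "(Poly_Mapping.single 0 (w b b0) * v b) * monomial (D b) =
        (Poly_Mapping.single 0 (w b b0) * monomial (D b)) * v b" by (simp only: ac_simps)
    moreover have "Poly_Mapping.single 0 (w b b0) * monomial (D b) = Poly_Mapping.single (D b) (w b b0)"
      by (simp add: monomial_def mult_single)
    ultimately show "Poly_Mapping.single (D b) (w b b0) * v b \<in> Idl\<^bsub>R\<^esub> ?G" by simp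
  qed
  show ?thesis using 1 2 by blast
qed

text \<open>As \<open>B 0\<close> is a singleton, evaluation at \<open>b0\<close> identifies the
  degree-0 module with the ring; the augmentation is this evaluation followed by reduction modulo
  \<open>I\<close>.\<close>

lemma free_resolution:
  assumes I: "I = Idl\<^bsub>R\<^esub> {monomial (D b) | b. b \<in> B 1}"
  shows "free_resolution R B d (quotient_module R I)"
proof -
  interpret cring R by (rule cring_mpoly_ring)
  interpret I: ideal I R unfolding I by (rule genideal_ideal[OF generators_closed])
  define h where "h v = I +>\<^bsub>R\<^esub> v b0" for v :: "'b \<Rightarrow> 'a mpoly"
  have rh: "(+>\<^bsub>R\<^esub>) I \<in> ring_hom R (R Quot I)" by (rule I.rcos_ring_hom)
  have h0: "v b0 \<in> carrier R" if "v \<in> carrier (F 0)" for v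
    using that unfolding F_carrier using B0 by simp
  have hom: "h \<in> module_hom_set R (F 0) (quotient_module R I)"
    unfolding module_hom_set_def
  proof (intro CollectI conjI ballI Pi_I)
    fix v assume v: "v \<in> carrier (F 0)"
    show "h v \<in> carrier (quotient_module R I)"
      using ring_hom_closed[OF rh h0[OF v]] by (simp add: quotient_module_def h_def)
    show "h (v \<oplus>\<^bsub>F 0\<^esub> u) = h v \<oplus>\<^bsub>quotient_module R I\<^esub> h u" if u: "u \<in> carrier (F 0)" for u
      using ring_hom_add[OF rh h0[OF v] h0[OF u]] by (simp add: quotient_module_def h_def)
    show "h (r \<odot>\<^bsub>F 0\<^esub> v) = r \<odot>\<^bsub>quotient_module R I\<^esub> h v" if r: "r \<in> carrier R" for r
      using ring_hom_mult[OF rh r h0[OF v]] by (simp add: quotient_module_def h_def)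
  qed
  have onto: "h ` carrier (F 0) = carrier (quotient_module R I)"
  proof
    show "h ` carrier (F 0) \<subseteq> carrier (quotient_module R I)"
      using hom by (auto simp: module_hom_set_def)
    show "carrier (quotient_module R I) \<subseteq> h ` carrier (F 0)"
    proof
      fix X assume "X \<in> carrier (quotient_module R I)"
      then obtain p where p: "p \<in> carrier R" "X = I +>\<^bsub>R\<^esub> p"
        by (auto simp: quotient_module_def FactRing_def A_RCOSETS_def' a_r_coset_def r_coset_def)
      then have "X = h (\<lambda>b. if b = b0 then p else 0)" by (simp add: h_def)
      moreover have "(\<lambda>b. if b = b0 then p else 0) \<in> carrier (F 0)"
        unfolding F_carrier using p B0 by simp
      ultimately show "X \<in> h ` carrier (F 0)" by blast
    qed
  qed
  have ker: "{v \<in> carrier (F 0). h v = \<zero>\<^bsub>quotient_module R I\<^esub>} = d 1 ` carrier (F 1)"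
  proof -
    have z: "\<zero>\<^bsub>quotient_module R I\<^esub> = I" by (simp add: quotient_module_def FactRing_def)
    have hI: "h v = I \<longleftrightarrow> v b0 \<in> I" if v: "v \<in> carrier (F 0)" for v
    proof
      assume "h v = I"
      then show "v b0 \<in> I" using I.a_rcos_self[OF h0[OF v]] by (simp add: h_def)
    next
      assume "v b0 \<in> I"
      then show "h v = I" unfolding h_def by (rule I.a_rcos_const)
    qed
    have "v b0 \<in> I \<longleftrightarrow> v \<in> d 1 ` carrier (F 1)" if v: "v \<in> carrier (F 0)" for v
    proof -
      have e: "v = d 1 u \<longleftrightarrow> d (Suc 0) u b0 = v b0" if "u \<in> carrier (F 1)" for u
      proof
        assume e: "d (Suc 0) u b0 = v b0"
        show "v = d 1 u"
        proof
          fix b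
          have "d (Suc 0) u \<in> carrier (F 0)" using d_closed[of u 0] that by simp
          then have "b \<noteq> b0 \<Longrightarrow> d (Suc 0) u b = 0" "b \<noteq> b0 \<Longrightarrow> v b = 0"
            using v B0 unfolding F_carrier by blast+
          then show "v b = d 1 u b" using e by (cases "b = b0") auto
        qed
      qed auto
      have "v b0 \<in> I \<longleftrightarrow> (\<exists>u\<in>carrier (F 1). d (Suc 0) u b0 = v b0)" unfolding I by (rule mem_ideal_iff)
      also have "\<dots> \<longleftrightarrow> v \<in> d 1 ` carrier (F 1)" unfolding image_iff using e by blast
      finally show ?thesis .
    qed
    moreover have "d 1 ` carrier (F 1) \<subseteq> carrier (F 0)" using d_closed[of _ 0] by auto
    ultimately show ?thesis unfolding z using hI by blast
  qed
  have ex: "{v \<in> carrier (F (Suc j)). d (Suc j) v = \<zero>\<^bsub>F j\<^esub>} = d (Suc (Suc j)) ` carrier (F (Suc (Suc j)))" for j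
  proof (intro equalityI subsetI)
    fix v assume "v \<in> {v \<in> carrier (F (Suc j)). d (Suc j) v = \<zero>\<^bsub>F j\<^esub>}"
    then show "v \<in> d (Suc (Suc j)) ` carrier (F (Suc (Suc j)))" using exact[of v j] by auto
  next
    fix v assume "v \<in> d (Suc (Suc j)) ` carrier (F (Suc (Suc j)))"
    then obtain u where "u \<in> carrier (F (Suc (Suc j)))" "v = d (Suc (Suc j)) u" by blast
    then show "v \<in> {v \<in> carrier (F (Suc j)). d (Suc j) v = \<zero>\<^bsub>F j\<^esub>}"
      using d_d[of u j] d_closed[of u "Suc j"] by simp
  qed
  show ?thesis
    unfolding free_resolution_def Let_def using d_hom ex onto ker by (intro conjI allI bexI[OF _ hom])
qed

lemma irrelevant_ideal: "ideal (irrelevant_ideal n) R"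
proof -
  interpret cring R by (rule cring_mpoly_ring)
  show ?thesis unfolding irrelevant_ideal_def
    by (rule genideal_ideal) (auto simp: monomial_def intro!: mpoly_carrier_single)
qed

text \<open>A nonzero entry connects different comparable degrees, so its monomial has a positive
  exponent at some variable, which can be split off.\<close>

lemma d_irrelevant:
  assumes v: "v \<in> carrier (F (Suc j))"
  shows "d (Suc j) v b' \<in> irrelevant_ideal n"
  unfolding d_def
proof (rule sum_mem_ideal[OF irrelevant_ideal])
  fix b assume b: "b \<in> B (Suc j)"
  interpret cring R by (rule cring_mpoly_ring)
  interpret I: ideal "irrelevant_ideal n" R by (rule irrelevant_ideal)
  show "Poly_Mapping.single (D b - D b') (w b b') * v b \<in> irrelevant_ideal n"
  proof (cases "w b b' = 0")
    case True
    then show ?thesis using additive_subgroup.zero_closed[OF I.is_additive_subgroup] by simp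
  next
    case False
    have le: "exp_le (D b') (D b)" and ne: "D b' \<noteq> D b" using w_deg[OF b False] by blast+
    have "lookup (D b') \<noteq> lookup (D b)" using ne by (simp add: poly_mapping.lookup_inject)
    then obtain i where i: "lookup (D b') i \<noteq> lookup (D b) i" by blast
    have "lookup (D b') i \<le> lookup (D b) i" using le by (simp add: exp_le_def)
    then have pos: "lookup (D b - D b') i > 0" using i by (simp add: lookup_minus)
    have "i \<in> Poly_Mapping.keys (D b - D b')" using pos by (simp add: in_keys_iff)
    then have i: "i \<in> {1..n}" using keys_D_diff[OF b] by blast
    define e where "e = D b - D b' - Poly_Mapping.single i 1"
    have "exp_le (Poly_Mapping.single i 1) (D b - D b')"
      using pos by (auto simp: exp_le_def lookup_single when_def)
    then have e: "D b - D b' = Poly_Mapping.single i 1 + e" unfolding e_def by (rule exp_le_add_diff[symmetric])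
    have "Poly_Mapping.keys e \<subseteq> Poly_Mapping.keys (D b - D b')"
      by (auto simp: e_def in_keys_iff lookup_minus)
    then have ek: "Poly_Mapping.keys e \<subseteq> {1..n}" using keys_D_diff[OF b] by blast
    have sub: "{monomial (Poly_Mapping.single i 1) | i. i \<in> {1..n}} \<subseteq> carrier R"
      by (auto simp: monomial_def intro!: mpoly_carrier_single)
    have m: "(monomial (Poly_Mapping.single i 1) :: 'a mpoly) \<in> irrelevant_ideal n"
      unfolding irrelevant_ideal_def using i by (intro subsetD[OF genideal_self[OF sub]]) blast
    have "(Poly_Mapping.single e (w b b') * v b) \<otimes>\<^bsub>R\<^esub> monomial (Poly_Mapping.single i 1) \<in> irrelevant_ideal n"
    proof (rule I.I_l_closed[OF m])
      have "v b \<in> carrier R" using v b unfolding F_carrier by blast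
      then show "Poly_Mapping.single e (w b b') * v b \<in> carrier R"
        by (rule mpoly_carrier_mult[OF mpoly_carrier_single[OF ek]])
    qed
    moreover have "(Poly_Mapping.single e (w b b') * v b) \<otimes>\<^bsub>R\<^esub> monomial (Poly_Mapping.single i 1)
        = Poly_Mapping.single (D b - D b') (w b b') * v b"
    proof -
      have "Poly_Mapping.single (D b - D b') (w b b') =
          monomial (Poly_Mapping.single i 1) * Poly_Mapping.single e (w b b')"
        by (simp only: e monomial_def mult_single mult_1)
      then show ?thesis by (simp only: mpoly_ring_simps ac_simps)
    qed
    ultimately show ?thesis by (simp only:)
  qed
qed

lemma multigraded: "multigraded_differential B D d"
  unfolding multigraded_differential_def
proof (intro allI ballI)
  fix j b b' m
  assume b: "b \<in> B (Suc j)" "b' \<in> B j"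
    and m: "m \<in> Poly_Mapping.keys (d (Suc j) (\<lambda>x. if x = b then 1 else 0) b')"
  have "d (Suc j) (\<lambda>x. if x = b then 1 else 0) b' = Poly_Mapping.single (D b - D b') (w b b')"
    unfolding d_def by (subst sum.remove[OF fin b(1)]) (auto intro!: sum.neutral)
  then have "w b b' \<noteq> 0" "m = D b - D b'"
    using m by (auto simp: in_keys_iff lookup_single when_def split: if_splits)
  moreover from this have "exp_le (D b') (D b)" using w_deg[OF b(1)] by simp
  ultimately show "m + D b' = D b" by (metis add.commute exp_le_add_diff)
qed

theorem minimal_resolution:
  assumes "I = Idl\<^bsub>R\<^esub> {monomial (D b) | b. b \<in> B 1}"
  shows "minimal_free_resolution R (irrelevant_ideal n) B d (quotient_module R I)"
  unfolding minimal_free_resolution_def using free_resolution[OF assms] d_irrelevant by blast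

end

section \<open>Contraction of chip firing classes\<close>

lemma num_edges_commute: "num_edges n U W = num_edges n W U"
proof -
  have "{e \<in> cycle_edges n. \<exists>u\<in>U. \<exists>w\<in>W. e = {u, w}} = {e \<in> cycle_edges n. \<exists>u\<in>W. \<exists>w\<in>U. e = {u, w}}"
    by (rule Collect_cong) (metis insert_commute)
  then show ?thesis by (simp add: num_edges_def)
qed

lemma finite_cycle_edges: "finite (cycle_edges n)"
proof -
  have "cycle_edges n = (\<lambda>i. {i, i + 1}) ` {i. 1 \<le> i \<and> i + 1 \<le> n} \<union> {{1, n}}"
    by (auto simp: cycle_edges_def)
  moreover have "finite {i. 1 \<le> i \<and> i + 1 \<le> n}" by (rule finite_subset[of _ "{..n}"]) auto
  ultimately show ?thesis by simp
qed

lemma num_edges_Un: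
  assumes "U \<inter> W = {}" "U \<inter> Y = {}" "W \<inter> Y = {}"
  shows "num_edges n (U \<union> W) Y = num_edges n U Y + num_edges n W Y"
proof -
  let ?N = "\<lambda>U. {e \<in> cycle_edges n. \<exists>u\<in>U. \<exists>w\<in>Y. e = {u, w}}"
  have "?N (U \<union> W) = ?N U \<union> ?N W" by blast
  moreover have "?N U \<inter> ?N W = {}" using assms by (auto simp: doubleton_eq_iff)
  ultimately show ?thesis
    unfolding num_edges_def by (simp add: card_Un_disjoint finite_cycle_edges)
qed

definition directed_edges :: "nat \<Rightarrow> oriented_partition \<Rightarrow> nat set \<Rightarrow> nat set \<Rightarrow> int" where
  "directed_edges n C X Y = (if (X, Y) \<in> snd C then int (num_edges n X Y) else 0)"

lemma block_outdeg_eq: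
  assumes "finite (fst C)" "snd C \<subseteq> fst C \<times> fst C"
  shows "block_outdeg n C X = (\<Sum>Y\<in>fst C. directed_edges n C X Y)"
proof -
  have "(\<Sum>Y\<in>fst C. directed_edges n C X Y) = (\<Sum>Y\<in>{Y \<in> fst C. (X, Y) \<in> snd C}. int (num_edges n X Y))"
    using assms(1) unfolding directed_edges_def by (rule sum.inter_filter[symmetric])
  also have "{Y \<in> fst C. (X, Y) \<in> snd C} = {Y. (X, Y) \<in> snd C}" using assms(2) by blast
  finally show ?thesis by (simp add: block_outdeg_def)
qed

text \<open>The Laplacian as a sum of differences over neighbours. The edges inside a block, counted
  by \<open>num_edges n X X\<close>, get the factor \<open>s X - s X\<close>.\<close>

lemma laplacian_sum_eq:
  fixes s :: "nat set \<Rightarrow> int"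
  assumes "finite P" "X \<in> P"
  shows "(\<Sum>Y\<in>P. laplacian n P X Y * s Y) = (\<Sum>Y\<in>P. int (num_edges n X Y) * (s X - s Y))"
proof -
  have "(\<Sum>Y\<in>P. laplacian n P X Y * s Y)
      = (\<Sum>T\<in>P - {X}. int (num_edges n X T)) * s X + (\<Sum>Y\<in>P - {X}. laplacian n P X Y * s Y)"
    by (subst sum.remove[OF assms]) (simp add: laplacian_def)
  also have "(\<Sum>Y\<in>P - {X}. laplacian n P X Y * s Y) = (\<Sum>Y\<in>P - {X}. - int (num_edges n X Y) * s Y)"
    by (rule sum.cong) (auto simp: laplacian_def)
  also have "(\<Sum>T\<in>P - {X}. int (num_edges n X T)) * s X + \<dots>
      = (\<Sum>Y\<in>P - {X}. int (num_edges n X Y) * (s X - s Y))"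
    unfolding sum_distrib_right sum.distrib[symmetric]
    by (rule sum.cong) (simp_all add: right_diff_distrib)
  also have "\<dots> = (\<Sum>Y\<in>P. int (num_edges n X Y) * (s X - s Y))"
    using sum.remove[OF assms, of "\<lambda>Y. int (num_edges n X Y) * (s X - s Y)"] by simp
  finally show ?thesis .
qed

text \<open>\<open>s\<close> is a firing script: block \<open>X\<close> fires \<open>s X\<close>
  times in passing from the outdegree vector of \<open>C\<close> to that of
  \<open>C'\<close>.\<close>

definition firing_potential ::
    "nat \<Rightarrow> oriented_partition \<Rightarrow> oriented_partition \<Rightarrow> (nat set \<Rightarrow> int) \<Rightarrow> bool" where
  "firing_potential n C C' s \<longleftrightarrow> (\<forall>X\<in>fst C.
    (\<Sum>Y\<in>fst C. directed_edges n C X Y - directed_edges n C' X Y)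
      = (\<Sum>Y\<in>fst C. int (num_edges n X Y) * (s X - s Y)))"

lemma chip_firing_equiv_iff:
  assumes "finite (fst C)" "snd C \<subseteq> fst C \<times> fst C" "snd C' \<subseteq> fst C' \<times> fst C'"
  shows "chip_firing_equiv n C C' \<longleftrightarrow> fst C = fst C' \<and> (\<exists>s. firing_potential n C C' s)"
proof (cases "fst C = fst C'")
  case True
  have "block_outdeg n C X - block_outdeg n C' X
      = (\<Sum>Y\<in>fst C. directed_edges n C X Y - directed_edges n C' X Y)" for X
    using block_outdeg_eq[of C n X] block_outdeg_eq[of C' n X] assms True
    by (simp add: sum_subtractf)
  then show ?thesis
    using True laplacian_sum_eq[OF assms(1)] unfolding chip_firing_equiv_def firing_potential_def by simp
qed (simp add: chip_firing_equiv_def)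

section \<open>Chip firing classes\<close>

lemma chip_firing_equiv_refl: "chip_firing_equiv n C C"
  unfolding chip_firing_equiv_def by (intro conjI refl exI[of _ "\<lambda>_. 0"]) simp

lemma chip_firing_equiv_sym: "chip_firing_equiv n C C' \<Longrightarrow> chip_firing_equiv n C' C"
  unfolding chip_firing_equiv_def
proof (elim conjE exE, intro conjI)
  fix s :: "nat set \<Rightarrow> int"
  assume e: "fst C = fst C'" and s: "\<forall>W\<in>fst C. block_outdeg n C W - block_outdeg n C' W =
    (\<Sum>U\<in>fst C. laplacian n (fst C) W U * s U)"
  show "\<exists>s. \<forall>W\<in>fst C'. block_outdeg n C' W - block_outdeg n C W = (\<Sum>U\<in>fst C'. laplacian n (fst C') W U * s U)"
  proof (intro exI ballI)
    fix W assume "W \<in> fst C'"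
    then have "block_outdeg n C W - block_outdeg n C' W = (\<Sum>U\<in>fst C'. laplacian n (fst C') W U * s U)"
      using s e by simp
    then show "block_outdeg n C' W - block_outdeg n C W = (\<Sum>U\<in>fst C'. laplacian n (fst C') W U * (- s U))"
      by (simp add: sum_negf)
  qed
qed simp

lemma chip_firing_equiv_trans:
  "chip_firing_equiv n C C' \<Longrightarrow> chip_firing_equiv n C' C'' \<Longrightarrow> chip_firing_equiv n C C''"
  unfolding chip_firing_equiv_def
proof (elim conjE exE, intro conjI)
  fix s t :: "nat set \<Rightarrow> int"
  assume e: "fst C = fst C'" "fst C' = fst C''"
    and s: "\<forall>W\<in>fst C. block_outdeg n C W - block_outdeg n C' W =
      (\<Sum>U\<in>fst C. laplacian n (fst C) W U * s U)"
    and t: "\<forall>W\<in>fst C'. block_outdeg n C' W - block_outdeg n C'' W =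
      (\<Sum>U\<in>fst C'. laplacian n (fst C') W U * t U)"
  show "\<exists>s. \<forall>W\<in>fst C. block_outdeg n C W - block_outdeg n C'' W = (\<Sum>U\<in>fst C. laplacian n (fst C) W U * s U)"
  proof (intro exI ballI)
    fix W assume "W \<in> fst C"
    then have "block_outdeg n C W - block_outdeg n C' W = (\<Sum>U\<in>fst C. laplacian n (fst C) W U * s U)"
      "block_outdeg n C' W - block_outdeg n C'' W = (\<Sum>U\<in>fst C. laplacian n (fst C) W U * t U)"
      using s t e by simp_all
    then show "block_outdeg n C W - block_outdeg n C'' W = (\<Sum>U\<in>fst C. laplacian n (fst C) W U * (s U + t U))"
      by (simp add: distrib_left sum.distrib)
  qed
qed simp

lemma chip_class_eq:
  assumes "chip_firing_equiv n C C'"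
  shows "chip_class n \<P> C = chip_class n \<P> C'"
proof -
  have "chip_firing_equiv n C X \<longleftrightarrow> chip_firing_equiv n C' X" for X
    using chip_firing_equiv_trans[OF assms, of X]
      chip_firing_equiv_trans[OF chip_firing_equiv_sym[OF assms], of X] by blast
  then show ?thesis by (simp add: chip_class_def)
qed

lemma sum_antisymmetric:
  fixes g :: "'b \<Rightarrow> 'b \<Rightarrow> int"
  assumes "\<And>X Y. X \<in> S \<Longrightarrow> Y \<in> S \<Longrightarrow> g X Y = - g Y X"
  shows "(\<Sum>X\<in>S. \<Sum>Y\<in>S. g X Y) = 0"
proof -
  have "(\<Sum>X\<in>S. \<Sum>Y\<in>S. g X Y) = (\<Sum>X\<in>S. \<Sum>Y\<in>S. - g Y X)"
    using assms by (intro sum.cong refl) blast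
  also have "\<dots> = - (\<Sum>X\<in>S. \<Sum>Y\<in>S. g Y X)" by (simp add: sum_negf)
  also have "(\<Sum>X\<in>S. \<Sum>Y\<in>S. g Y X) = (\<Sum>X\<in>S. \<Sum>Y\<in>S. g X Y)" by (rule sum.swap)
  finally show ?thesis by linarith
qed

lemma acyclic_partition_facts:
  assumes "acyclic_partition n \<P> C"
  shows "finite (fst C)" "partition_on {1..n} (fst C)" "snd C \<subseteq> fst C \<times> fst C"
    "(X, Y) \<in> snd C \<Longrightarrow> X \<noteq> Y" "(X, Y) \<in> snd C \<Longrightarrow> num_edges n X Y > 0"
    "X \<in> fst C \<Longrightarrow> Y \<in> fst C \<Longrightarrow> X \<noteq> Y \<Longrightarrow> num_edges n X Y > 0 \<Longrightarrow> (X, Y) \<in> snd C \<or> (Y, X) \<in> snd C"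
    "(X, Y) \<in> snd C \<Longrightarrow> (Y, X) \<notin> snd C"
proof -
  have o: "orientation n (fst C) (snd C)" and p: "partition_on {1..n} (fst C)" and a: "acyclic (snd C)"
    using assms by (auto simp: acyclic_partition_def connected_partition_def)
  show "partition_on {1..n} (fst C)" by (rule p)
  show "finite (fst C)" using p by (rule finite_elements[OF finite_atLeastAtMost])
  have o1: "X \<in> fst C \<and> Y \<in> fst C \<and> X \<noteq> Y \<and> num_edges n X Y > 0" if "(X, Y) \<in> snd C" for X Y
    using bspec[OF conjunct1[OF o[unfolded orientation_def]] that] by simp
  show "snd C \<subseteq> fst C \<times> fst C" using o1 by auto
  show "(X, Y) \<in> snd C \<Longrightarrow> X \<noteq> Y" "(X, Y) \<in> snd C \<Longrightarrow> num_edges n X Y > 0"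
    using o1[of X Y] by simp_all
  show "(X, Y) \<in> snd C \<or> (Y, X) \<in> snd C"
    if "X \<in> fst C" "Y \<in> fst C" "X \<noteq> Y" "num_edges n X Y > 0"
    using bspec[OF bspec[OF conjunct2[OF o[unfolded orientation_def]] that(1)] that(2)] that(3,4) by simp
  show "(Y, X) \<notin> snd C" if "(X, Y) \<in> snd C"
  proof
    assume "(Y, X) \<in> snd C"
    then have "(X, X) \<in> (snd C)\<^sup>+" by (rule trancl_into_trancl[OF r_into_trancl[OF that]])
    then show False using a by (simp add: acyclic_def)
  qed
qed

lemma directed_edges_add:
  assumes "acyclic_partition n \<P> C" "X \<in> fst C" "Y \<in> fst C" "X \<noteq> Y"
  shows "directed_edges n C X Y + directed_edges n C Y X = int (num_edges n X Y)"
  using acyclic_partition_facts(6,7)[OF assms(1), of X Y] assms(2-4)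
  by (auto simp: directed_edges_def num_edges_commute[of n Y X])

lemma directed_edges_refl: "acyclic_partition n \<P> C \<Longrightarrow> directed_edges n C X X = 0"
  using acyclic_partition_facts(4)[of n \<P> C X X] by (auto simp: directed_edges_def)

text \<open>Sum the defining equation of the potential over a superlevel set of \<open>s\<close>: across its boundary
  every edge must leave the set in the first orientation and enter it in the second one.\<close>

lemma firing_potential_common_edge:
  assumes C: "acyclic_partition n \<P> C" and C': "acyclic_partition n \<P> C'" and e: "fst C = fst C'"
    and s: "firing_potential n C C' s" and f: "(U, W) \<in> snd C" "(U, W) \<in> snd C'"
  shows "s U = s W"
proof (rule ccontr)
  assume ne: "s U \<noteq> s W"
  define S where "S = {X \<in> fst C. s X \<ge> max (s U) (s W)}"
  note facts = acyclic_partition_facts[OF C] and facts' = acyclic_partition_facts[OF C']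
  \<comment> \<open>\<open>g\<close> compares the two sides of the potential equation pair by pair.
    It is antisymmetric with zero row sums, so its total across the boundary of \<open>S\<close> is
    zero.\<close>
  define g where "g X Y = int (num_edges n X Y) * (s X - s Y)
      - (directed_edges n C X Y - directed_edges n C' X Y)" for X Y
  have UW: "U \<in> fst C" "W \<in> fst C" "U \<noteq> W" using facts(3) f(1) facts(4)[OF f(1)] by auto
  have finS: "finite S" using facts(1) by (simp add: S_def)
  have anti: "g X Y = - g Y X" if "X \<in> fst C" "Y \<in> fst C" for X Y
  proof (cases "X = Y")
    case True
    then show ?thesis by (simp add: g_def directed_edges_refl[OF C] directed_edges_refl[OF C'])
  next
    case False
    show ?thesis
    proof -
      have "directed_edges n C X Y + directed_edges n C Y X = int (num_edges n X Y)"
        "directed_edges n C' X Y + directed_edges n C' Y X = int (num_edges n X Y)"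
        using directed_edges_add[OF C] directed_edges_add[OF C'] that e False by auto
      then show ?thesis
        unfolding g_def num_edges_commute[of n Y X] right_diff_distrib by linarith
    qed
  qed
  have row: "(\<Sum>Y\<in>fst C. g X Y) = 0" if "X \<in> fst C" for X
  proof -
    have "(\<Sum>Y\<in>fst C. directed_edges n C X Y - directed_edges n C' X Y)
        = (\<Sum>Y\<in>fst C. int (num_edges n X Y) * (s X - s Y))"
      using bspec[OF s[unfolded firing_potential_def] that] .
    then show ?thesis unfolding g_def by (subst sum_subtractf) simp
  qed
  have "(\<Sum>X\<in>S. \<Sum>Y\<in>fst C. g X Y) = 0" by (rule sum.neutral) (use row in \<open>auto simp: S_def\<close>)
  moreover have "(\<Sum>Y\<in>fst C. g X Y) = (\<Sum>Y\<in>fst C - S. g X Y) + (\<Sum>Y\<in>S. g X Y)" for X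
    by (rule sum.subset_diff[OF _ facts(1)]) (auto simp: S_def)
  moreover have "(\<Sum>X\<in>S. \<Sum>Y\<in>S. g X Y) = 0"
    by (rule sum_antisymmetric, rule anti) (simp_all add: S_def)
  ultimately have "(\<Sum>X\<in>S. \<Sum>Y\<in>fst C - S. g X Y) = 0" by (simp add: sum.distrib)
  then have z: "(\<Sum>(X, Y)\<in>S \<times> (fst C - S). g X Y) = 0" by (simp add: sum.cartesian_product)
  \<comment> \<open>\<open>s\<close> is integer-valued, so a strict drop is at least 1; together
    with \<open>low0\<close> this makes every boundary term nonnegative.\<close>
  have low: "g X Y \<ge> int (num_edges n X Y) - directed_edges n C X Y + directed_edges n C' X Y"
    if "s X > s Y" for X Y
  proof -
    have "int (num_edges n X Y) * 1 \<le> int (num_edges n X Y) * (s X - s Y)"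
      using that by (intro mult_left_mono) auto
    then show ?thesis by (simp add: g_def)
  qed
  have low0: "int (num_edges n X Y) - directed_edges n C X Y + directed_edges n C' X Y \<ge> 0" for X Y
    by (simp add: directed_edges_def)
  have gt: "s X > s Y" if "(X, Y) \<in> S \<times> (fst C - S)" for X Y using that by (auto simp: S_def)
  have nn: "0 \<le> (case p of (X, Y) \<Rightarrow> g X Y)" if "p \<in> S \<times> (fst C - S)" for p
  proof -
    obtain X Y where p: "p = (X, Y)" by (cases p)
    show ?thesis using low[OF gt[OF that[unfolded p]]] low0[of X Y] by (simp add: p)
  qed
  have g0: "g X Y = 0" if "(X, Y) \<in> S \<times> (fst C - S)" for X Y
  proof -
    have "finite (S \<times> (fst C - S))" using finS facts(1) by simp
    from sum_nonneg_eq_0_iff[OF this nn] z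
    have "\<forall>p\<in>S \<times> (fst C - S). (case p of (X, Y) \<Rightarrow> g X Y) = 0" by simp
    from bspec[OF this that] show ?thesis by simp
  qed
  have pos: "num_edges n U W > 0" using facts(5)[OF f(1)] .
  \<comment> \<open>Whichever end is higher, agreement of the orientations bounds the boundary term
    of this edge below by \<open>num_edges n U W > 0\<close>.\<close>
  show False
  proof (cases "s U > s W")
    case True
    then have "(U, W) \<in> S \<times> (fst C - S)" using UW by (auto simp: S_def)
    then have "g U W = 0" by (rule g0)
    then show False using low[OF True] pos f by (simp add: directed_edges_def)
  next
    case False
    then have gt: "s W > s U" using ne by simp
    then have "(W, U) \<in> S \<times> (fst C - S)" using UW by (auto simp: S_def)
    then have "g W U = 0" by (rule g0)
    then show False
      using low[OF gt] pos facts(7)[OF f(1)] facts'(7)[OF f(2)]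
      by (simp add: directed_edges_def num_edges_commute[of n W U])
  qed
qed

section \<open>Contraction of an edge and its effect on potentials\<close>

lemma contract_simps:
  assumes "acyclic_partition n \<P> C" "(U, W) \<in> snd C"
  shows "U \<union> W \<notin> fst C"
    and "fst (contract C (U, W)) = insert (U \<union> W) (fst C - {U, W})"
    and "X \<in> fst C - {U, W} \<Longrightarrow> Y \<in> fst C - {U, W} \<Longrightarrow>
      (X, Y) \<in> snd (contract C (U, W)) \<longleftrightarrow> (X, Y) \<in> snd C"
    and "Y \<in> fst C - {U, W} \<Longrightarrow>
      (U \<union> W, Y) \<in> snd (contract C (U, W)) \<longleftrightarrow> (U, Y) \<in> snd C \<or> (W, Y) \<in> snd C"
    and "Y \<in> fst C - {U, W} \<Longrightarrow>
      (Y, U \<union> W) \<in> snd (contract C (U, W)) \<longleftrightarrow> (Y, U) \<in> snd C \<or> (Y, W) \<in> snd C"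
proof -
  note facts = acyclic_partition_facts[OF assms(1)]
  have UW: "U \<in> fst C" "W \<in> fst C" "U \<noteq> W" using facts(3) assms(2) facts(4)[OF assms(2)] by auto
  show M: "U \<union> W \<notin> fst C"
  proof
    assume M: "U \<union> W \<in> fst C"
    have ne: "U \<noteq> {}" "W \<noteq> {}" using partition_onD3[OF facts(2)] UW by metis+
    have "U = U \<union> W" using disjointD[OF partition_onD2[OF facts(2)] UW(1) M] ne by blast
    moreover have "W = U \<union> W" using disjointD[OF partition_onD2[OF facts(2)] UW(2) M] ne by blast
    ultimately show False using UW(3) by simp
  qed
  show "fst (contract C (U, W)) = insert (U \<union> W) (fst C - {U, W})"
    using UW by (auto simp: contract_def merge_block_def image_iff)
  have mb: "merge_block (U, W) X = Y \<longleftrightarrow> X = Y" if "X \<in> fst C" "Y \<in> fst C - {U, W}" for X Y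
    using that M by (auto simp: merge_block_def)
  have mM: "merge_block (U, W) X = U \<union> W \<longleftrightarrow> X = U \<or> X = W" if "X \<in> fst C" for X
    using that M by (auto simp: merge_block_def)
  have mem: "(A, B) \<in> snd (contract C (U, W)) \<longleftrightarrow>
      A \<noteq> B \<and> (\<exists>X Y. (X, Y) \<in> snd C \<and> merge_block (U, W) X = A \<and> merge_block (U, W) Y = B)" for A B
  proof -
    have "(A, B) \<in> snd (contract C (U, W)) \<longleftrightarrow> A \<noteq> B \<and> (\<exists>p\<in>snd C. merge_edge (U, W) p = (A, B))"
      unfolding contract_def image_iff by (simp add: conj_commute) metis
    also have "\<dots> \<longleftrightarrow> A \<noteq> B \<and> (\<exists>X Y. (X, Y) \<in> snd C \<and> merge_edge (U, W) (X, Y) = (A, B))"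
      by (simp add: Bex_def split_paired_Ex)
    finally show ?thesis by (simp add: merge_edge_def)
  qed
  have sub: "X \<in> fst C" "Y \<in> fst C" if "(X, Y) \<in> snd C" for X Y using facts(3) that by auto
  show "(X, Y) \<in> snd (contract C (U, W)) \<longleftrightarrow> (X, Y) \<in> snd C"
    if X: "X \<in> fst C - {U, W}" and Y: "Y \<in> fst C - {U, W}"
    unfolding mem
  proof
    assume "X \<noteq> Y \<and> (\<exists>X' Y'. (X', Y') \<in> snd C \<and> merge_block (U, W) X' = X \<and> merge_block (U, W) Y' = Y)"
    then obtain X' Y' where "(X', Y') \<in> snd C" "merge_block (U, W) X' = X" "merge_block (U, W) Y' = Y"
      by blast
    then show "(X, Y) \<in> snd C"
      using mb[OF _ X, of X'] mb[OF _ Y, of Y'] sub[of X' Y'] by simp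
  next
    assume XY: "(X, Y) \<in> snd C"
    then show "X \<noteq> Y \<and> (\<exists>X' Y'. (X', Y') \<in> snd C \<and> merge_block (U, W) X' = X \<and> merge_block (U, W) Y' = Y)"
      using mb[OF _ X, of X] mb[OF _ Y, of Y] sub[OF XY] facts(4)[OF XY] by blast
  qed
  show "(U \<union> W, Y) \<in> snd (contract C (U, W)) \<longleftrightarrow> (U, Y) \<in> snd C \<or> (W, Y) \<in> snd C"
    if Y: "Y \<in> fst C - {U, W}"
  proof -
    have "U \<union> W \<noteq> Y" using Y M by blast
    then show ?thesis unfolding mem using mb[OF _ Y] mM sub by metis
  qed
  show "(Y, U \<union> W) \<in> snd (contract C (U, W)) \<longleftrightarrow> (Y, U) \<in> snd C \<or> (Y, W) \<in> snd C"
    if Y: "Y \<in> fst C - {U, W}"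
  proof -
    have "U \<union> W \<noteq> Y" using Y M by blast
    then show ?thesis unfolding mem using mb[OF _ Y] mM sub by metis
  qed
qed

text \<open>Acyclicity of the contraction excludes opposite edges between the merged block and
  \<open>Y\<close>. Hence the edges joining \<open>Y\<close> to \<open>U\<close> and those joining
  it to \<open>W\<close> are directed alike, and the counts add up.\<close>

lemma directed_edges_contract:
  assumes C: "acyclic_partition n \<P> C" and f: "contractible n \<P> C (U, W)"
    and Y: "Y \<in> fst C - {U, W}"
  shows "num_edges n (U \<union> W) Y = num_edges n U Y + num_edges n W Y"
    and "directed_edges n (contract C (U, W)) (U \<union> W) Y = directed_edges n C U Y + directed_edges n C W Y"
    and "directed_edges n (contract C (U, W)) Y (U \<union> W) = directed_edges n C Y U + directed_edges n C Y W"
proof -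
  have fC: "(U, W) \<in> snd C" and K: "acyclic_partition n \<P> (contract C (U, W))"
    using f by (auto simp: contractible_def)
  note facts = acyclic_partition_facts[OF C] and cs = contract_simps[OF C fC]
  have UW: "U \<in> fst C" "W \<in> fst C" "U \<noteq> W" using fC facts(3,4) by blast+
  have "U \<inter> W = {}" "U \<inter> Y = {}" "W \<inter> Y = {}"
    using partition_onD2[OF facts(2)] UW Y unfolding disjoint_def by blast+
  then show w: "num_edges n (U \<union> W) Y = num_edges n U Y + num_edges n W Y" by (rule num_edges_Un)
  have one: "\<not> ((U \<union> W, Y) \<in> snd (contract C (U, W)) \<and> (Y, U \<union> W) \<in> snd (contract C (U, W)))"
    using acyclic_partition_facts(7)[OF K] by blast
  have dichotomy: "num_edges n X Y = 0 \<or> (X, Y) \<in> snd C \<or> (Y, X) \<in> snd C" if "X \<in> {U, W}" for X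
    using facts(6)[of X Y] UW Y that by (cases "num_edges n X Y") auto
  show "directed_edges n (contract C (U, W)) (U \<union> W) Y = directed_edges n C U Y + directed_edges n C W Y"
    using one dichotomy[of U] dichotomy[of W] facts(7)[of U Y] facts(7)[of W Y] w
    unfolding directed_edges_def cs(4)[OF Y] cs(5)[OF Y] by auto
  show "directed_edges n (contract C (U, W)) Y (U \<union> W) = directed_edges n C Y U + directed_edges n C Y W"
    using one dichotomy[of U] dichotomy[of W] facts(7)[of U Y] facts(7)[of W Y] w
    unfolding directed_edges_def cs(4)[OF Y] cs(5)[OF Y] num_edges_commute[of n Y] by auto
qed

text \<open>A potential has equal values at \<open>U\<close> and \<open>W\<close>, because the
  contracted edge occurs in both orientations, so it descends to the merged block.\<close>

lemma contract_chip_firing_equiv: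
  assumes C: "acyclic_partition n \<P> C" and C': "acyclic_partition n \<P> C'"
    and eq: "chip_firing_equiv n C C'" and f: "contractible n \<P> C f" "contractible n \<P> C' f"
  shows "chip_firing_equiv n (contract C f) (contract C' f)"
proof -
  obtain U W where fUW: "f = (U, W)" by (cases f)
  note f = f[unfolded fUW]
  have fC: "(U, W) \<in> snd C" "(U, W) \<in> snd C'"
    and K: "acyclic_partition n \<P> (contract C (U, W))" "acyclic_partition n \<P> (contract C' (U, W))"
    using f by (auto simp: contractible_def)
  note facts = acyclic_partition_facts[OF C] and facts' = acyclic_partition_facts[OF C']
  note kfacts = acyclic_partition_facts[OF K(1)] and kfacts' = acyclic_partition_facts[OF K(2)]
  have e: "fst C = fst C'" using eq by (simp add: chip_firing_equiv_def)
  have "\<exists>s. firing_potential n C C' s"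
    using chip_firing_equiv_iff[OF facts(1,3) facts'(3)] eq by blast
  then obtain s where s: "firing_potential n C C' s" by blast
  have sUW: "s U = s W" by (rule firing_potential_common_edge[OF C C' e s fC])
  define Q where "Q = fst C - {U, W}"
  define M where "M = U \<union> W"
  define t where "t Z = (if Z = M then s U else s Z)" for Z
  note cs = contract_simps[OF C fC(1), folded M_def Q_def]
  note cs' = contract_simps[OF C' fC(2), folded e, folded M_def Q_def]
  note de = directed_edges_contract[OF C f(1), folded M_def Q_def]
  note de' = directed_edges_contract[OF C' f(2), folded e, folded M_def Q_def]
  let ?K = "contract C (U, W)" and ?K' = "contract C' (U, W)"
  have UW: "U \<in> fst C" "W \<in> fst C" "U \<noteq> W" using fC facts(3,4) by blast+
  have finQ: "finite Q" using facts(1) by (simp add: Q_def)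
  have MQ: "M \<notin> Q" using cs(1) by (simp add: Q_def)
  have tQ: "t Y = s Y" if "Y \<in> Q" for Y using that MQ by (auto simp: t_def)
  have tM: "t M = s U" by (simp add: t_def)
  have split: "(\<Sum>Y\<in>fst C. h Y) = h U + h W + (\<Sum>Y\<in>Q. h Y)" for h :: "nat set \<Rightarrow> int"
  proof -
    have "fst C = insert U (insert W Q)" using UW by (auto simp: Q_def)
    moreover have "U \<notin> insert W Q" "W \<notin> Q" using UW by (auto simp: Q_def)
    ultimately show ?thesis using finQ by simp
  qed
  have splitK: "(\<Sum>Y\<in>fst ?K. h Y) = h M + (\<Sum>Y\<in>Q. h Y)" for h :: "nat set \<Rightarrow> int"
    unfolding cs(2) using finQ MQ by simp
  have pot: "h U + h W + (\<Sum>Y\<in>Q. h Y) = k U + k W + (\<Sum>Y\<in>Q. k Y)"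
    if "X \<in> fst C" "h = (\<lambda>Y. directed_edges n C X Y - directed_edges n C' X Y)"
      "k = (\<lambda>Y. int (num_edges n X Y) * (s X - s Y))" for X h k
    using s that unfolding firing_potential_def split by auto
  have "firing_potential n ?K ?K' t"
    unfolding firing_potential_def
  proof
    fix X assume "X \<in> fst ?K"
    then consider "X = M" | "X \<in> Q" using cs(2) by blast
    then show "(\<Sum>Y\<in>fst ?K. directed_edges n ?K X Y - directed_edges n ?K' X Y)
        = (\<Sum>Y\<in>fst ?K. int (num_edges n X Y) * (t X - t Y))"
    proof cases
      case 1
      \<comment> \<open>The equation at the merged block is the sum of those at \<open>U\<close> and
        \<open>W\<close>. The terms between \<open>U\<close> and \<open>W\<close> vanish on both
        sides, since the orientations agree there and \<open>s U = s W\<close>.\<close>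
      have l: "(\<Sum>Y\<in>Q. directed_edges n ?K M Y - directed_edges n ?K' M Y) =
          (\<Sum>Y\<in>Q. directed_edges n C U Y - directed_edges n C' U Y) +
          (\<Sum>Y\<in>Q. directed_edges n C W Y - directed_edges n C' W Y)"
        unfolding sum.distrib[symmetric] by (rule sum.cong) (simp_all add: de de')
      have r: "(\<Sum>Y\<in>Q. int (num_edges n M Y) * (t M - t Y)) =
          (\<Sum>Y\<in>Q. int (num_edges n U Y) * (s U - s Y)) + (\<Sum>Y\<in>Q. int (num_edges n W Y) * (s W - s Y))"
        unfolding sum.distrib[symmetric]
        by (rule sum.cong) (simp_all add: de tQ tM sUW algebra_simps)
      have "directed_edges n C U W = directed_edges n C' U W" "directed_edges n C W U = directed_edges n C' W U"
        using fC facts(7)[OF fC(1)] facts'(7)[OF fC(2)] by (simp_all add: directed_edges_def)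
      then show ?thesis
        using pot[OF UW(1) refl refl] pot[OF UW(2) refl refl] sUW
        unfolding 1 splitK l r
        by (simp add: directed_edges_refl[OF C] directed_edges_refl[OF C']
            directed_edges_refl[OF K(1)] directed_edges_refl[OF K(2)])
    next
      case 2
      have XM: "X \<noteq> M" using 2 MQ by blast
      have l: "(\<Sum>Y\<in>Q. directed_edges n ?K X Y - directed_edges n ?K' X Y) =
          (\<Sum>Y\<in>Q. directed_edges n C X Y - directed_edges n C' X Y)"
        by (rule sum.cong) (use 2 cs(3) cs'(3) in \<open>auto simp: directed_edges_def\<close>)
      have r: "(\<Sum>Y\<in>Q. int (num_edges n X Y) * (t X - t Y)) = (\<Sum>Y\<in>Q. int (num_edges n X Y) * (s X - s Y))"
        by (rule sum.cong) (use 2 tQ in auto)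
      have m: "int (num_edges n X M) * (t X - t M)
          = int (num_edges n X U) * (s X - s U) + int (num_edges n X W) * (s X - s W)"
        using de(1)[OF 2] by (simp add: num_edges_commute[of n X] tQ[OF 2] tM sUW algebra_simps)
      have "X \<in> fst C" using 2 by (simp add: Q_def)
      from pot[OF this refl refl] show ?thesis
        unfolding splitK l r m by (simp add: de(3)[OF 2] de'(3)[OF 2])
    qed
  qed
  moreover have "fst ?K = fst ?K'" using cs(2) cs'(2) by simp
  ultimately show ?thesis
    using chip_firing_equiv_iff[OF kfacts(1,3) kfacts'(3)] unfolding fUW by blast
qed

text \<open>The union in \<open>class_contract\<close> collapses to one class, so the signs of
  iterated contractions can be read off at a representative.\<close>

lemma class_contract_chip_class:
  assumes C: "acyclic_partition n \<P> C" and f: "contractible n \<P> C f"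
  shows "class_contract n \<P> (chip_class n \<P> C) f = chip_class n \<P> (contract C f)"
proof -
  have self: "C \<in> chip_class n \<P> C" using C chip_firing_equiv_refl by (simp add: chip_class_def)
  have "chip_class n \<P> (contract C' f) = chip_class n \<P> (contract C f)"
    if "C' \<in> chip_class n \<P> C" "contractible n \<P> C' f" for C'
  proof -
    have "acyclic_partition n \<P> C'" "chip_firing_equiv n C C'" using that by (auto simp: chip_class_def)
    then show ?thesis
      using chip_class_eq[OF contract_chip_firing_equiv[OF C _ _ f that(2)]] by simp
  qed
  then show ?thesis using self f unfolding class_contract_def by blast
qed

section \<open>Cutting the cycle\<close>

definition vtx :: "nat \<Rightarrow> nat \<Rightarrow> nat" where
  "vtx n t = (if t = 0 then n else t)"

text \<open>The cut \<open>t\<close> lies between the vertices \<open>t\<close> and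
  \<open>t + 1\<close>, whence the strict inequality: the cuts counted are those crossed on the way
  from \<open>0\<close> to \<open>v\<close>. At \<open>v = n\<close> all are counted, which agrees
  with \<open>0\<close> modulo \<open>card T\<close>.\<close>

definition cnt :: "nat set \<Rightarrow> nat \<Rightarrow> nat" where
  "cnt T v = card {t \<in> T. t < v}"

text \<open>The blocks cut out by \<open>T\<close> are numbered cyclically, starting with the block of the vertex \<open>n\<close>.\<close>

definition lab :: "nat set \<Rightarrow> nat \<Rightarrow> nat" where
  "lab T v = cnt T v mod card T"

definition blk :: "nat \<Rightarrow> nat set \<Rightarrow> nat \<Rightarrow> nat set" where
  "blk n T v = {w \<in> {1..n}. lab T w = lab T v}"

section \<open>Counting cuts along the cycle\<close>

lemma cycle_edges_eq: "3 \<le> n \<Longrightarrow> cycle_edges n = (\<lambda>t. {vtx n t, Suc t}) ` {..<n}"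
proof (intro equalityI subsetI)
  fix e assume n: "3 \<le> n" and e: "e \<in> cycle_edges n"
  then consider i where "1 \<le> i" "i + 1 \<le> n" "e = {i, i + 1}" | "e = {1, n}"
    by (auto simp: cycle_edges_def)
  then show "e \<in> (\<lambda>t. {vtx n t, Suc t}) ` {..<n}"
  proof cases
    case 1
    then have "e = (\<lambda>t. {vtx n t, Suc t}) i" "i \<in> {..<n}" by (auto simp: vtx_def)
    then show ?thesis by blast
  next
    case 2
    then have "e = (\<lambda>t. {vtx n t, Suc t}) 0" "0 \<in> {..<n}" using n by (auto simp: vtx_def)
    then show ?thesis by blast
  qed
next
  fix e assume n: "3 \<le> n" and "e \<in> (\<lambda>t. {vtx n t, Suc t}) ` {..<n}"
  then obtain t where t: "t < n" "e = {vtx n t, Suc t}" by blast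
  show "e \<in> cycle_edges n"
  proof (cases "t = 0")
    case True
    then show ?thesis using t by (auto simp: vtx_def cycle_edges_def)
  next
    case False
    then have "1 \<le> t \<and> t + 1 \<le> n \<and> e = {t, t + 1}" using t by (auto simp: vtx_def)
    then show ?thesis unfolding cycle_edges_def by blast
  qed
qed

lemma cycle_edge_iff:
  assumes "3 \<le> n"
  shows "{u, v} \<in> cycle_edges n \<longleftrightarrow>
    (\<exists>t<n. (u = vtx n t \<and> v = Suc t) \<or> (u = Suc t \<and> v = vtx n t))"
  unfolding cycle_edges_eq[OF assms] by (auto simp: image_iff doubleton_eq_iff)

lemma vtx_mem: "t < n \<Longrightarrow> vtx n t \<in> {1..n}"
  by (auto simp: vtx_def)

lemma cnt_Suc: "finite T \<Longrightarrow> cnt T (Suc t) = cnt T t + (if t \<in> T then 1 else 0)"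
proof -
  assume T: "finite T"
  have "{s \<in> T. s < Suc t} = (if t \<in> T then insert t {s \<in> T. s < t} else {s \<in> T. s < t})"
    by (auto simp: less_Suc_eq)
  then show ?thesis using T by (simp add: cnt_def)
qed

lemma cnt_le: "finite T \<Longrightarrow> cnt T v \<le> card T"
  unfolding cnt_def by (rule card_mono) auto

lemma cnt_mono: "finite T \<Longrightarrow> u \<le> v \<Longrightarrow> cnt T u \<le> cnt T v"
  unfolding cnt_def by (rule card_mono) auto

lemma cnt_less: "finite T \<Longrightarrow> t \<in> T \<Longrightarrow> t < v \<longleftrightarrow> cnt T t < cnt T v"
  using cnt_mono[of T "Suc t" v] cnt_mono[of T v t] cnt_Suc[of T t] by (cases "t < v") auto

lemma cnt_less_card: "finite T \<Longrightarrow> t \<in> T \<Longrightarrow> cnt T t < card T"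
  using cnt_le[of T "Suc t"] cnt_Suc[of T t] by auto

lemma cnt_top: "T \<subseteq> {..<n} \<Longrightarrow> cnt T n = card T"
proof -
  assume "T \<subseteq> {..<n}"
  then have "{t \<in> T. t < n} = T" by auto
  then show ?thesis by (simp add: cnt_def)
qed

lemma cnt_remove:
  assumes "finite T" "t \<in> T"
  shows "cnt (T - {t}) v = (if t < v then cnt T v - 1 else cnt T v)"
proof -
  have "{s \<in> T - {t}. s < v} = (if t < v then {s \<in> T. s < v} - {t} else {s \<in> T. s < v})" by auto
  then show ?thesis using assms by (simp add: cnt_def)
qed

text \<open>Counts never exceed \<open>card T\<close>, so the remainder only folds the stretch after
  the last cut onto the one before the first. For \<open>T = {}\<close> both sides are 0.\<close>

lemma lab_eq: "finite T \<Longrightarrow> lab T v = (if cnt T v = card T then 0 else cnt T v)"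
  using cnt_le[of T v] by (simp add: lab_def)

lemma lab_vtx: "T \<subseteq> {..<n} \<Longrightarrow> lab T (vtx n t) = lab T t"
  using cnt_top[of T n] by (simp add: vtx_def lab_def cnt_def)

lemma lab_top: "T \<subseteq> {..<n} \<Longrightarrow> lab T n = 0"
  using cnt_top[of T n] by (simp add: lab_def)

lemma lab_Suc_uncut: "finite T \<Longrightarrow> t \<notin> T \<Longrightarrow> lab T (Suc t) = lab T t"
  by (simp add: lab_def cnt_Suc)

lemma lab_cut:
  assumes "finite T" "t \<in> T"
  shows "lab T t = cnt T t" "lab T (Suc t) = (if Suc (cnt T t) = card T then 0 else Suc (cnt T t))"
  using cnt_less_card[OF assms] assms by (simp_all add: lab_eq cnt_Suc)

lemma lab_cut_neq: "finite T \<Longrightarrow> t \<in> T \<Longrightarrow> 2 \<le> card T \<Longrightarrow> lab T (Suc t) \<noteq> lab T t"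
  using lab_cut[of T t] cnt_less_card[of T t] by (auto split: if_splits)

lemma inj_on_cnt: "finite T \<Longrightarrow> inj_on (cnt T) T"
  by (rule inj_onI) (metis cnt_less less_irrefl linorder_neqE_nat)

lemma lab_image_cuts: "finite T \<Longrightarrow> lab T ` T = {..<card T}"
proof (rule card_subset_eq)
  assume T: "finite T"
  show "lab T ` T \<subseteq> {..<card T}" using lab_cut(1)[OF T] cnt_less_card[OF T] by auto
  have "card (lab T ` T) = card (cnt T ` T)" using lab_cut(1)[OF T] by (metis image_cong)
  then show "card (lab T ` T) = card {..<card T}" using card_image[OF inj_on_cnt[OF T]] by simp
qed simp

lemma lab_less: "finite T \<Longrightarrow> T \<noteq> {} \<Longrightarrow> lab T v < card T"
  by (simp add: lab_def card_gt_0_iff)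

section \<open>Blocks between the cuts\<close>

lemma blk_self: "v \<in> {1..n} \<Longrightarrow> v \<in> blk n T v"
  by (simp add: blk_def)

lemma blk_eq_iff: "v \<in> {1..n} \<Longrightarrow> blk n T v = blk n T u \<longleftrightarrow> lab T v = lab T u"
  by (auto simp: blk_def)

lemma blk_empty: "blk n {} v = {1..n}"
  by (auto simp: blk_def lab_def cnt_def)

text \<open>A single cut does not disconnect the cycle; this is the origin of the special treatment
  of cells with two elements.\<close>

lemma lab_card_1: "card T = 1 \<Longrightarrow> lab T v = 0"
  by (simp add: lab_def)

text \<open>Deleting a cut identifies the two labels at its ends and no others.\<close>

lemma lab_remove:
  assumes T: "finite T" "t \<in> T" "2 \<le> card T"
  shows "lab (T - {t}) u = lab (T - {t}) v \<longleftrightarrow>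
    lab T u = lab T v \<or> (lab T u \<in> {lab T t, lab T (Suc t)} \<and> lab T v \<in> {lab T t, lab T (Suc t)})"
proof -
  let ?m = "card T" and ?c = "cnt T t"
  have f: "finite (T - {t})" using T by simp
  have m: "card (T - {t}) = ?m - 1" using T by simp
  have c: "?c < ?m" by (rule cnt_less_card[OF T(1,2)])
  have l: "lab (T - {t}) w = (if ?c < cnt T w then (if cnt T w = ?m then 0 else cnt T w - 1)
      else (if cnt T w = ?m - 1 then 0 else cnt T w))" for w
    using cnt_less[OF T(1,2), of w] cnt_le[OF T(1), of w] c T(3)
    unfolding lab_eq[OF f] cnt_remove[OF T(1,2)] m by auto
  \<comment> \<open>\<open>c\<close>, \<open>a\<close>, \<open>b\<close> are the counts at
    \<open>t\<close>, \<open>u\<close>, \<open>v\<close>, and \<open>m\<close> is the number of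
    cuts. For \<open>Suc c = m\<close> the cut is the last one and the block after it has label
    0.\<close>
  have A: "(if c < a then (if a = m then 0 else a - 1) else (if a = m - 1 then 0 else a)) =
      (if c < b then (if b = m then 0 else b - 1) else (if b = m - 1 then 0 else b)) \<longleftrightarrow>
      (if a = m then 0 else a) = (if b = m then 0 else b) \<or>
      ((if a = m then 0 else a) \<in> {c, if Suc c = m then 0 else Suc c} \<and>
       (if b = m then 0 else b) \<in> {c, if Suc c = m then 0 else Suc c})"
    if "a \<le> m" "b \<le> m" "c < m" "2 \<le> m" for a b c m :: nat
    using that by (cases "Suc c = m"; cases "a = m"; cases "b = m"; cases "c < a"; cases "c < b") auto
  show ?thesis
    unfolding l lab_cut[OF T(1,2)] lab_eq[OF T(1), of u] lab_eq[OF T(1), of v]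
    by (rule A) (use cnt_le[OF T(1)] c T(3) in auto)
qed

lemma merge_block_blk:
  assumes T: "T \<subseteq> {..<n}" "t \<in> T" "2 \<le> card T" and v: "v \<in> {1..n}"
    and f: "f = (blk n T (vtx n t), blk n T (Suc t)) \<or> f = (blk n T (Suc t), blk n T (vtx n t))"
  shows "merge_block f (blk n T v) = blk n (T - {t}) v"
proof -
  have fT: "finite T" using T(1) finite_subset by blast
  have tn: "t < n" using T by auto
  have M: "fst f \<union> snd f = {w \<in> {1..n}. lab T w \<in> {lab T t, lab T (Suc t)}}"
    using f by (auto simp: blk_def lab_vtx[OF T(1)])
  have E: "(blk n T v = fst f \<or> blk n T v = snd f) \<longleftrightarrow> lab T v \<in> {lab T t, lab T (Suc t)}"
    using f blk_eq_iff[OF v, of T "vtx n t"] blk_eq_iff[OF v, of T "Suc t"] lab_vtx[OF T(1), of t]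
    by (elim disjE) (simp_all add: disj_commute)
  show ?thesis
    unfolding merge_block_def E M
    by (auto simp: blk_def lab_remove[OF fT T(2,3)])
qed

text \<open>Labels change only across cuts, and a path inside \<open>S\<close> crosses none. This is
  applied to main vertices, to the blocks of a given partition and, for a contradiction, to a
  connected set with a gap.\<close>

lemma cut_free_lab_eq:
  assumes n: "3 \<le> n" and S: "induces_connected n S" and T: "T \<subseteq> {..<n}"
    and cut: "\<And>t. t \<in> T \<Longrightarrow> vtx n t \<in> S \<Longrightarrow> Suc t \<in> S \<Longrightarrow> False"
    and u: "u \<in> S" "v \<in> S"
  shows "lab T u = lab T v"
proof -
  have fT: "finite T" using T finite_subset by blast
  have "(u, v) \<in> {(a, b). a \<in> S \<and> b \<in> S \<and> {a, b} \<in> cycle_edges n}\<^sup>*"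
    using S u by (auto simp: induces_connected_def)
  then show ?thesis
  proof (induction rule: rtrancl_induct)
    case (step a b)
    then obtain t where t: "t < n" "(a = vtx n t \<and> b = Suc t) \<or> (a = Suc t \<and> b = vtx n t)"
      and ab: "a \<in> S" "b \<in> S"
      using cycle_edge_iff[OF n] by auto
    then have "t \<notin> T" using cut by blast
    then have "lab T a = lab T b"
      using t lab_Suc_uncut[OF fT, of t] lab_vtx[OF T, of t] by auto
    then show ?case using step.IH by simp
  qed simp
qed

lemma interval_connected:
  assumes n: "3 \<le> n" and "1 \<le> a" "a \<le> b" "b \<le> n" "\<And>x. a \<le> x \<Longrightarrow> x \<le> b \<Longrightarrow> x \<in> S"
  shows "(a, b) \<in> {(a, b). a \<in> S \<and> b \<in> S \<and> {a, b} \<in> cycle_edges n}\<^sup>*"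
  using assms(3,4,5)
proof (induction b rule: dec_induct)
  case (step b)
  have "vtx n b = b" using step.hyps assms(2) by (simp add: vtx_def)
  then have "{b, Suc b} \<in> cycle_edges n"
    unfolding cycle_edge_iff[OF n] using step.prems(1) by (intro exI[of _ b]) auto
  moreover have "b \<in> S" "Suc b \<in> S" using step by auto
  ultimately have "(b, Suc b) \<in> {(a, b). a \<in> S \<and> b \<in> S \<and> {a, b} \<in> cycle_edges n}" by simp
  moreover have "(a, b) \<in> {(a, b). a \<in> S \<and> b \<in> S \<and> {a, b} \<in> cycle_edges n}\<^sup>*"
    using step by auto
  ultimately show ?case by (rule rtrancl_into_rtrancl[rotated])
qed simp

lemma induces_connectedI:
  assumes "S \<noteq> {}" "S \<subseteq> {1..n}"
    and "\<And>u v. u \<in> S \<Longrightarrow> v \<in> S \<Longrightarrow> u \<le> v \<Longrightarrow>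
      (u, v) \<in> {(a, b). a \<in> S \<and> b \<in> S \<and> {a, b} \<in> cycle_edges n}\<^sup>*"
  shows "induces_connected n S"
proof -
  let ?R = "{(a, b). a \<in> S \<and> b \<in> S \<and> {a, b} \<in> cycle_edges n}"
  have "sym ?R" by (auto simp: sym_def insert_commute)
  then have "sym (?R\<^sup>*)" by (rule sym_rtrancl)
  then show ?thesis
    using assms unfolding induces_connected_def by (metis (no_types, lifting) nle_le symD)
qed

lemma induces_connected_blk:
  assumes n: "3 \<le> n" and T: "T \<subseteq> {..<n}" and v: "v \<in> {1..n}"
  shows "induces_connected n (blk n T v)"
proof (rule induces_connectedI)
  let ?S = "blk n T v"
  let ?R = "{(a, b). a \<in> ?S \<and> b \<in> ?S \<and> {a, b} \<in> cycle_edges n}"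
  show "?S \<noteq> {}" using blk_self[OF v] by blast
  show "?S \<subseteq> {1..n}" by (auto simp: blk_def)
  have fT: "finite T" using T finite_subset by blast
  have "sym ?R" by (auto simp: sym_def insert_commute)
  then have sy: "sym (?R\<^sup>*)" by (rule sym_rtrancl)
  fix a b assume ab: "a \<in> ?S" "b \<in> ?S" "a \<le> b"
  have r: "a \<in> {1..n}" "b \<in> {1..n}" and l: "lab T a = lab T b" "lab T a = lab T v"
    using ab by (auto simp: blk_def)
  show "(a, b) \<in> ?R\<^sup>*"
  proof (cases "cnt T a = cnt T b")
    case True
    have "x \<in> ?S" if x: "a \<le> x" "x \<le> b" for x
    proof -
      have "cnt T x = cnt T a" using cnt_mono[OF fT x(1)] cnt_mono[OF fT x(2)] True by simp
      then show ?thesis using x r l by (auto simp: blk_def lab_def)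
    qed
    then show ?thesis using interval_connected[OF n _ ab(3)] r by auto
  next
    case False
    \<comment> \<open>Equal labels with different counts: \<open>a\<close> lies before the first cut
      and \<open>b\<close> after the last one, so the path has to use the edge between
      \<open>1\<close> and \<open>n\<close>.\<close>
    then have c: "cnt T a = 0" "cnt T b = card T"
      using l(1) cnt_mono[OF fT ab(3)] unfolding lab_eq[OF fT] by (auto split: if_splits)
    have l0: "lab T v = 0" using c l by (simp add: lab_eq[OF fT])
    have "x \<in> ?S" if x: "1 \<le> x" "x \<le> a" for x
      using cnt_mono[OF fT x(2)] c x r l0 by (auto simp: blk_def lab_def)
    then have "(1, a) \<in> ?R\<^sup>*" using interval_connected[OF n, of 1 a] r by auto
    then have a1: "(a, 1) \<in> ?R\<^sup>*" using symD[OF sy] by blast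
    have "x \<in> ?S" if x: "b \<le> x" "x \<le> n" for x
      using cnt_mono[OF fT x(1)] cnt_le[OF fT, of x] c x r l0 by (auto simp: blk_def lab_eq[OF fT])
    then have "(b, n) \<in> ?R\<^sup>*" using interval_connected[OF n, of b n] r by auto
    then have nb: "(n, b) \<in> ?R\<^sup>*" using symD[OF sy] by blast
    have "1 \<in> ?S" "n \<in> ?S"
      using l0 lab_top[OF T] cnt_mono[OF fT, of 1 a] c r n by (auto simp: blk_def lab_def)
    moreover have "{1, n} \<in> cycle_edges n" by (simp add: cycle_edges_def)
    ultimately have "(1, n) \<in> ?R" by simp
    then show ?thesis using a1 nb by (meson rtrancl.rtrancl_into_rtrancl rtrancl_trans)
  qed
qed

lemma partition_on_blk: "partition_on {1..n} (blk n T ` {1..n})"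
  by (rule partition_onI) (auto simp: blk_def disjnt_def)

section \<open>Cells and acyclic partitions\<close>

definition tail :: "nat \<Rightarrow> nat \<times> bool \<Rightarrow> nat" where
  "tail n x = (if snd x then vtx n (fst x) else Suc (fst x))"

definition head :: "nat \<Rightarrow> nat \<times> bool \<Rightarrow> nat" where
  "head n x = (if snd x then Suc (fst x) else vtx n (fst x))"

definition cell_edge :: "nat \<Rightarrow> nat set \<Rightarrow> nat \<times> bool \<Rightarrow> nat set \<times> nat set" where
  "cell_edge n T x = (blk n T (tail n x), blk n T (head n x))"

definition opart :: "nat \<Rightarrow> (nat \<times> bool) set \<Rightarrow> oriented_partition" where
  "opart n X = (blk n (fst ` X) ` {1..n}, cell_edge n (fst ` X) ` X)"

lemma tail_mem: "fst x < n \<Longrightarrow> tail n x \<in> {1..n}"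
  using vtx_mem[of "fst x" n] by (simp add: tail_def)

lemma head_mem: "fst x < n \<Longrightarrow> head n x \<in> {1..n}"
  using vtx_mem[of "fst x" n] by (simp add: head_def)

lemma tail_head_edge:
  assumes "3 \<le> n" "fst x < n"
  shows "{tail n x, head n x} \<in> cycle_edges n"
proof -
  have "{tail n x, head n x} = {vtx n (fst x), Suc (fst x)}" by (auto simp: tail_def head_def)
  then show ?thesis unfolding cycle_edges_eq[OF assms(1)] using assms(2) by blast
qed

lemma lab_tail_head_neq:
  assumes "T \<subseteq> {..<n}" "fst x \<in> T" "2 \<le> card T"
  shows "lab T (tail n x) \<noteq> lab T (head n x)"
proof -
  have "finite T" using assms(1) finite_subset by blast
  from lab_cut_neq[OF this assms(2,3)] show ?thesis
    by (auto simp: tail_def head_def lab_vtx[OF assms(1)])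
qed

lemma lab_tail_head_uncut:
  assumes "T \<subseteq> {..<n}" "fst x \<notin> T"
  shows "lab T (tail n x) = lab T (head n x)"
proof -
  have "finite T" using assms(1) finite_subset by blast
  from lab_Suc_uncut[OF this assms(2)] show ?thesis
    by (auto simp: tail_def head_def lab_vtx[OF assms(1)])
qed

lemma cell_edge_endpoints:
  assumes "T \<subseteq> {..<n}"
  shows "cell_edge n T (t, d) = (blk n T (vtx n t), blk n T (Suc t)) \<or>
    cell_edge n T (t, d) = (blk n T (Suc t), blk n T (vtx n t))"
  by (simp add: cell_edge_def tail_def head_def)

text \<open>Merging the two blocks at a cut relabels all blocks by the remaining cuts. The
  contracted edge is the only one to become a loop, unless just two cuts were present.\<close>

lemma contract_opart:
  assumes X: "fst ` X \<subseteq> {..<n}" "inj_on fst X" "2 \<le> card X" "x \<in> X"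
  shows "contract (opart n X) (cell_edge n (fst ` X) x) = opart n (if card X = 2 then {} else X - {x})"
proof -
  define T where "T = fst ` X"
  obtain t d where x: "x = (t, d)" by (cases x)
  have T: "T \<subseteq> {..<n}" "t \<in> T" "2 \<le> card T"
    using X x card_image[OF X(2)] by (auto simp: T_def intro: rev_image_eqI)
  have fT: "finite T" using T(1) finite_subset by blast
  let ?f = "cell_edge n T x" and ?T' = "T - {t}"
  have T': "?T' \<subseteq> {..<n}" using T by auto
  have m: "merge_block ?f (blk n T v) = blk n ?T' v" if "v \<in> {1..n}" for v
    by (rule merge_block_blk[OF T that]) (use cell_edge_endpoints[OF T(1), of t d] x in simp)
  have me: "merge_edge ?f (cell_edge n T y) = cell_edge n ?T' y" if "y \<in> X" for y
  proof -
    have "fst y < n" using that X(1) by auto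
    then show ?thesis
      using m[OF tail_mem, of y] m[OF head_mem, of y] by (simp add: merge_edge_def cell_edge_def)
  qed
  have 1: "merge_block ?f ` blk n T ` {1..n} = blk n ?T' ` {1..n}"
    unfolding image_image by (rule image_cong[OF refl]) (rule m)
  have 2: "merge_edge ?f ` cell_edge n T ` X = cell_edge n ?T' ` X"
    unfolding image_image by (rule image_cong[OF refl]) (rule me)
  have eqs: "blk n ?T' (tail n y) = blk n ?T' (head n y) \<longleftrightarrow> lab ?T' (tail n y) = lab ?T' (head n y)"
    if "y \<in> X" for y
    by (rule blk_eq_iff, rule tail_mem) (use that X(1) in auto)
  have fx: "fst y = t \<longleftrightarrow> y = x" if "y \<in> X" for y
    using inj_onD[OF X(2) _ that X(4)] x by auto
  have off_diagonal: "{(A, B) \<in> S. A \<noteq> B} = {p \<in> S. fst p \<noteq> snd p}" for S :: "(nat set \<times> nat set) set"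
    by auto
  show ?thesis
  proof (cases "card X = 2")
    case True
    \<comment> \<open>The one remaining cut separates nothing, so its edge becomes a loop as
      well.\<close>
    then have c: "card ?T' = 1" using T fT card_image[OF X(2)] by (simp add: T_def)
    have "blk n ?T' v = {1..n}" for v unfolding blk_def lab_card_1[OF c] by auto
    moreover have "\<forall>p\<in>cell_edge n ?T' ` X. fst p = snd p"
      by (simp add: cell_edge_def calculation)
    then have "{(A, B) \<in> cell_edge n ?T' ` X. A \<noteq> B} = {}" unfolding off_diagonal by blast
    ultimately show ?thesis
      unfolding contract_def opart_def T_def[symmetric] fst_conv snd_conv 1 2
      using True by (simp add: blk_empty)
  next
    case False
    then have c: "2 \<le> card ?T'" using T fT card_image[OF X(2)] X(3) by (simp add: T_def)
    have T'e: "fst ` (X - {x}) = ?T'"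
      using fx x X(4) by (auto simp: T_def image_iff)
    have "fst (cell_edge n ?T' y) \<noteq> snd (cell_edge n ?T' y) \<longleftrightarrow> y \<noteq> x" if y: "y \<in> X" for y
    proof (cases "y = x")
      case True
      then show ?thesis
        using eqs[OF y] lab_tail_head_uncut[OF T', of y] x by (simp add: cell_edge_def)
    next
      case False
      then have "fst y \<in> ?T'" using y fx by (auto simp: T_def)
      then show ?thesis
        using eqs[OF y] lab_tail_head_neq[OF T' _ c, of y] False by (simp add: cell_edge_def)
    qed
    then have "{(A, B) \<in> cell_edge n ?T' ` X. A \<noteq> B} = cell_edge n ?T' ` (X - {x})"
      unfolding off_diagonal by blast
    then show ?thesis
      unfolding contract_def opart_def T_def[symmetric] fst_conv snd_conv 1 2
      using False by (simp add: T'e)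
  qed
qed

lemma sink_cell_inj: "sink_cell X \<Longrightarrow> inj_on fst X"
proof (rule inj_onI)
  fix x y assume X: "sink_cell X" and xy: "x \<in> X" "y \<in> X" "fst x = fst y"
  have "\<not> ((t, False) \<in> X \<and> (t, True) \<in> X)" for t
    using X unfolding sink_cell_def by (metis empty_iff less_irrefl)
  then have "snd x = snd y" using xy by (metis (full_types) prod.collapse)
  then show "x = y" using xy by (simp add: prod_eq_iff)
qed

lemma sink_cell_card: "sink_cell X \<Longrightarrow> finite X \<Longrightarrow> X \<noteq> {} \<Longrightarrow> 2 \<le> card X"
proof -
  assume X: "sink_cell X" "finite X" "X \<noteq> {}"
  then obtain s t where "(s, False) \<in> X" "(t, True) \<in> X" unfolding sink_cell_def by blast
  then have "card {(s, False), (t, True)} \<le> card X" using X by (intro card_mono) auto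
  then show ?thesis by simp
qed

lemma card_blocks:
  assumes T: "T \<subseteq> {..<n}" "1 \<le> n"
  shows "card (blk n T ` {1..n}) = (if T = {} then 1 else card T)"
proof (cases "T = {}")
  case True
  then have "blk n T ` {1..n} = {{1..n}}" using T(2) by (auto simp: blk_empty)
  then show ?thesis using True by simp
next
  case False
  have fT: "finite T" using T(1) finite_subset by blast
  have "lab T ` {1..n} = {..<card T}"
  proof
    show "lab T ` {1..n} \<subseteq> {..<card T}" using lab_less[OF fT False] by auto
    have "lab T ` T \<subseteq> lab T ` {1..n}"
    proof
      fix l assume "l \<in> lab T ` T"
      then obtain t where t: "t \<in> T" "l = lab T t" by blast
      have "vtx n t \<in> {1..n}" by (rule vtx_mem) (use t T in auto)
      then show "l \<in> lab T ` {1..n}" using t lab_vtx[OF T(1), of t] by (metis imageI)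
    qed
    then show "{..<card T} \<subseteq> lab T ` {1..n}" using lab_image_cuts[OF fT] by simp
  qed
  moreover have "card (blk n T ` {1..n}) = card (lab T ` {1..n})"
  proof -
    have "inj_on (\<lambda>l. {w \<in> {1..n}. lab T w = l}) (lab T ` {1..n})"
      by (rule inj_onI) blast
    moreover have "blk n T ` {1..n} = (\<lambda>l. {w \<in> {1..n}. lab T w = l}) ` lab T ` {1..n}"
      by (simp add: image_image blk_def)
    ultimately show ?thesis by (simp only: card_image)
  qed
  ultimately show ?thesis using False by simp
qed

text \<open>Along the cyclic numbering of the blocks the height rises from the sink to the source and then
  falls back, so that every directed edge goes downwards.\<close>

lemma acyclic_opart:
  assumes X: "sink_cell X" "fst ` X \<subseteq> {..<n}"
  shows "acyclic (snd (opart n X))"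
    and "(U, W) \<in> snd (opart n X) \<Longrightarrow> U \<noteq> blk n (fst ` X) n"
    and "v \<in> {1..n} \<Longrightarrow> lab (fst ` X) v \<noteq> 0 \<Longrightarrow> \<exists>W. (blk n (fst ` X) v, W) \<in> snd (opart n X)"
proof -
  define T where "T = fst ` X"
  \<comment> \<open>In a nonempty cell the backward cuts come first, so a cut points backwards iff
    its count is below \<phi>, and \<phi> is the label of the source block.\<close>
  define \<phi> where "\<phi> = card {s. (s, False) \<in> X}"
  have T: "T \<subseteq> {..<n}" using X(2) by (simp add: T_def)
  have fT: "finite T" using T finite_subset by blast
  have fX: "finite X" using fT finite_image_iff[OF sink_cell_inj[OF X(1)]] by (simp add: T_def)
  have inT: "t \<in> T" if "(t, d) \<in> X" for t d using that unfolding T_def by force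
  have lt: "s < t" if "(s, False) \<in> X" "(t, True) \<in> X" for s t
    using X(1) that unfolding sink_cell_def by blast
  have dich: "(t, False) \<in> X \<or> (t, True) \<in> X" if t: "t \<in> T" for t
  proof -
    obtain d where "(t, d) \<in> X" using t unfolding T_def by auto
    then show ?thesis by (cases d) auto
  qed
  have finF: "finite {s. (s, False) \<in> X}" by (rule finite_subset[OF _ fT]) (use inT in auto)
  have cF: "cnt T s < \<phi>" if s: "(s, False) \<in> X" for s
    unfolding cnt_def \<phi>_def
  proof (rule psubset_card_mono[OF finF])
    have "{t \<in> T. t < s} \<subseteq> {s. (s, False) \<in> X}" using dich lt[OF s] by force
    moreover have "s \<notin> {t \<in> T. t < s}" by simp
    ultimately show "{t \<in> T. t < s} \<subset> {s. (s, False) \<in> X}" using s by blast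
  qed
  have cT: "\<phi> \<le> cnt T t" if t: "(t, True) \<in> X" for t
    unfolding cnt_def \<phi>_def by (rule card_mono) (use fT inT lt t in auto)
  have \<phi>: "0 < \<phi>" "\<phi> < card T" if ne: "X \<noteq> {}"
  proof -
    obtain s t where st: "(s, False) \<in> X" "(t, True) \<in> X" using X(1) ne unfolding sink_cell_def by blast
    show "0 < \<phi>" using cF[OF st(1)] by simp
    show "\<phi> < card T" using cT[OF st(2)] cnt_less_card[OF fT inT[OF st(2)]] by simp
  qed
  have lF: "lab T (tail n x) = Suc (cnt T (fst x))" "lab T (head n x) = cnt T (fst x)" "cnt T (fst x) < \<phi>"
    if x: "x \<in> X" "\<not> snd x" for x
  proof -
    have x': "(fst x, False) \<in> X" using x by (metis (full_types) prod.collapse)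
    have "Suc (cnt T (fst x)) < card T" using cF[OF x'] \<phi> x by force
    then show "lab T (tail n x) = Suc (cnt T (fst x))" "lab T (head n x) = cnt T (fst x)"
      using lab_cut[OF fT inT[OF x']] x(2) by (simp_all add: tail_def head_def lab_vtx[OF T])
    show "cnt T (fst x) < \<phi>" by (rule cF[OF x'])
  qed
  have lT: "lab T (tail n x) = cnt T (fst x)"
    "lab T (head n x) = (if Suc (cnt T (fst x)) = card T then 0 else Suc (cnt T (fst x)))"
    "\<phi> \<le> cnt T (fst x)" "cnt T (fst x) < card T"
    if x: "x \<in> X" "snd x" for x
  proof -
    have x': "(fst x, True) \<in> X" using x by (metis (full_types) prod.collapse)
    show "lab T (tail n x) = cnt T (fst x)"
      "lab T (head n x) = (if Suc (cnt T (fst x)) = card T then 0 else Suc (cnt T (fst x)))"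
      using lab_cut[OF fT inT[OF x']] x(2) by (simp_all add: tail_def head_def lab_vtx[OF T])
    show "\<phi> \<le> cnt T (fst x)" by (rule cT[OF x'])
    show "cnt T (fst x) < card T" by (rule cnt_less_card[OF fT inT[OF x']])
  qed
  \<comment> \<open>The sink has rank 0 and the source, of label \<phi>, the largest rank
    \<open>card T\<close>; beyond the source the ranks descend to \<open>\<phi> + 1\<close>, still
    above the sink.\<close>
  define rank where "rank l = (if l < \<phi> then l else card T + \<phi> - l)" for l
  define h where "h U = rank (lab T (SOME u. u \<in> U))" for U :: "nat set"
  have hb: "h (blk n T v) = rank (lab T v)" if "v \<in> {1..n}" for v
  proof -
    have "(SOME u. u \<in> blk n T v) \<in> blk n T v" by (rule someI[of "\<lambda>u. u \<in> blk n T v", OF blk_self[OF that]])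
    then show ?thesis by (simp add: h_def blk_def)
  qed
  have fn: "fst x < n" if "x \<in> X" for x using that X(2) by auto
  show "acyclic (snd (opart n X))"
  proof (rule acyclicI_order[of _ h])
    fix U W assume "(U, W) \<in> snd (opart n X)"
    then obtain x where x: "x \<in> X" "U = blk n T (tail n x)" "W = blk n T (head n x)"
      by (auto simp: opart_def cell_edge_def T_def)
    have ne: "X \<noteq> {}" using x by blast
    have "rank (lab T (head n x)) < rank (lab T (tail n x))"
    proof (cases "snd x")
      case True
      show ?thesis using lT[OF x(1) True] \<phi>[OF ne] by (auto simp: rank_def)
    next
      case False
      show ?thesis using lF[OF x(1) False] \<phi>[OF ne] by (auto simp: rank_def)
    qed
    then show "h W < h U" using x hb tail_mem[OF fn[OF x(1)]] head_mem[OF fn[OF x(1)]] by simp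
  qed
  show "U \<noteq> blk n (fst ` X) n" if UW: "(U, W) \<in> snd (opart n X)"
  proof
    assume U: "U = blk n (fst ` X) n"
    obtain x where x: "x \<in> X" "U = blk n T (tail n x)"
      using UW by (auto simp: opart_def cell_edge_def T_def)
    have ne: "X \<noteq> {}" using x by blast
    have "lab T (tail n x) = lab T n"
      using x U blk_eq_iff[OF tail_mem[OF fn[OF x(1)]], of T n] by (simp add: T_def)
    then have "lab T (tail n x) = 0" using lab_top[OF T] by simp
    then show False using lF[OF x(1)] lT[OF x(1)] \<phi>[OF ne] by (cases "snd x") auto
  qed
  show "\<exists>W. (blk n (fst ` X) v, W) \<in> snd (opart n X)"
    if v: "v \<in> {1..n}" and l: "lab (fst ` X) v \<noteq> 0"
  proof -
    have out: "\<exists>W. (blk n (fst ` X) v, W) \<in> snd (opart n X)"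
      if "x \<in> X" "lab T (tail n x) = lab T v" for x
    proof -
      have "blk n T v = blk n T (tail n x)" using blk_eq_iff[OF v] that by simp
      then show ?thesis using that(1) by (auto simp: opart_def cell_edge_def T_def)
    qed
    have Tne: "T \<noteq> {}" using l by (auto simp: T_def lab_def cnt_def)
    have "lab T v \<in> lab T ` T" using lab_image_cuts[OF fT] lab_less[OF fT Tne] by auto
    then obtain t where t: "t \<in> T" "lab T t = lab T v" by auto
    have ct: "cnt T t = lab T v" using t lab_cut(1)[OF fT] by simp
    show ?thesis
    proof (cases "(t, True) \<in> X")
      case True
      then show ?thesis using out[OF True] lT(1)[OF True] ct by simp
    next
      case False
      then have tF: "(t, False) \<in> X" using dich[OF t(1)] by blast
      \<comment> \<open>The cut after the block of \<open>v\<close> points backwards, hence so does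
        the cut before it, and the edge at the latter leaves the block.\<close>
      have "lab T v - 1 \<in> lab T ` T" using lab_image_cuts[OF fT] lab_less[OF fT Tne, of v] by auto
      then obtain t' where t': "t' \<in> T" "lab T t' = lab T v - 1" by auto
      have ct': "Suc (cnt T t') = lab T v" using t' lab_cut(1)[OF fT t'(1)] l by (simp add: T_def)
      have "t' < t" using cnt_less[OF fT t'(1), of t] ct ct' by simp
      then have t'F: "(t', False) \<in> X" using dich[OF t'(1)] lt[OF tF, of t'] by auto
      then show ?thesis using out[OF t'F] lF(1)[OF t'F] ct' by simp
    qed
  qed
qed

lemma acyclic_asym: "acyclic r \<Longrightarrow> (a, b) \<in> r \<Longrightarrow> (b, a) \<notin> r"
proof
  assume "acyclic r" "(a, b) \<in> r" "(b, a) \<in> r"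
  then have "(a, a) \<in> r\<^sup>+" by (intro trancl_into_trancl[OF r_into_trancl])
  then show False using \<open>acyclic r\<close> by (simp add: acyclic_def)
qed

lemma orientation_opart:
  assumes n: "3 \<le> n" and X: "sink_cell X" "fst ` X \<subseteq> {..<n}"
  shows "orientation n (fst (opart n X)) (snd (opart n X))"
proof -
  define T where "T = fst ` X"
  have T: "T \<subseteq> {..<n}" using X(2) by (simp add: T_def)
  have fT: "finite T" using T finite_subset by blast
  have fX: "finite X" using fT finite_image_iff[OF sink_cell_inj[OF X(1)]] by (simp add: T_def)
  have c2: "2 \<le> card T" if "x \<in> X" for x
  proof -
    have "X \<noteq> {}" using that by blast
    then show ?thesis unfolding T_def card_image[OF sink_cell_inj[OF X(1)]] by (rule sink_cell_card[OF X(1) fX])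
  qed
  have fn: "fst x < n" if "x \<in> X" for x using that X(2) by auto
  note edge = tail_head_edge[OF n]
  have ac: "(W, U) \<notin> snd (opart n X)" if "(U, W) \<in> snd (opart n X)" for U W
    by (rule acyclic_asym[OF acyclic_opart(1)[OF X] that])
  have 1: "U \<in> fst (opart n X) \<and> W \<in> fst (opart n X) \<and> U \<noteq> W \<and> num_edges n U W > 0"
    if UW: "(U, W) \<in> snd (opart n X)" for U W
  proof -
    obtain x where x: "x \<in> X" "U = blk n T (tail n x)" "W = blk n T (head n x)"
      using UW by (auto simp: opart_def cell_edge_def T_def)
    note tm = tail_mem[OF fn[OF x(1)]] and hm = head_mem[OF fn[OF x(1)]]
    have "fst x \<in> T" using x(1) by (simp add: T_def)
    then have "U \<noteq> W"
      using lab_tail_head_neq[OF T _ c2[OF x(1)]] blk_eq_iff[OF tm, of T "head n x"] x by simp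
    moreover have "{tail n x, head n x} \<in> {e \<in> cycle_edges n. \<exists>u\<in>U. \<exists>w\<in>W. e = {u, w}}"
      using edge[OF fn[OF x(1)]] x blk_self[OF tm, of T] blk_self[OF hm, of T] by blast
    then have "num_edges n U W > 0"
      unfolding num_edges_def card_gt_0_iff
      by (intro conjI finite_subset[OF _ finite_cycle_edges[of n]]) blast+
    moreover have "U \<in> fst (opart n X)" "W \<in> fst (opart n X)"
      using x tm hm by (simp_all add: opart_def T_def)
    ultimately show ?thesis by blast
  qed
  \<comment> \<open>An edge between different blocks sits at a cut, so some direction occurs;
    acyclicity excludes the other, even when two cuts join the same pair of blocks.\<close>
  have 2: "((U, W) \<in> snd (opart n X)) \<noteq> ((W, U) \<in> snd (opart n X))"
    if UW: "U \<in> fst (opart n X)" "W \<in> fst (opart n X)" "U \<noteq> W" "num_edges n U W > 0" for U W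
  proof -
    have "card {e \<in> cycle_edges n. \<exists>u\<in>U. \<exists>w\<in>W. e = {u, w}} \<noteq> 0"
      using UW(4) by (simp add: num_edges_def)
    then have "{e \<in> cycle_edges n. \<exists>u\<in>U. \<exists>w\<in>W. e = {u, w}} \<noteq> {}"
      by (intro notI) (simp only: card.empty)
    then obtain u w where uw: "u \<in> U" "w \<in> W" "{u, w} \<in> cycle_edges n" by blast
    have blocks: "A = blk n T a" if "A \<in> fst (opart n X)" "a \<in> A" for A a
      using that by (auto simp: opart_def T_def blk_def)
    have U: "U = blk n T u" and W: "W = blk n T w" using blocks UW uw by blast+
    obtain t where t: "t < n" "(u = vtx n t \<and> w = Suc t) \<or> (u = Suc t \<and> w = vtx n t)"
      using uw(3) unfolding cycle_edge_iff[OF n] by blast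
    have "t \<in> T"
    proof (rule ccontr)
      assume "t \<notin> T"
      then have "lab T u = lab T w" using t lab_Suc_uncut[OF fT, of t] lab_vtx[OF T, of t] by auto
      then show False using UW(3) U W by (simp add: blk_def)
    qed
    then obtain d where d: "(t, d) \<in> X" by (auto simp: T_def)
    then have "cell_edge n T (t, d) \<in> snd (opart n X)" by (auto simp: opart_def T_def)
    then have "(U, W) \<in> snd (opart n X) \<or> (W, U) \<in> snd (opart n X)"
      using cell_edge_endpoints[OF T, of t d] t(2) U W by auto
    then show ?thesis using ac by blast
  qed
  show ?thesis unfolding orientation_def
  proof (intro conjI ballI impI)
    fix p assume "p \<in> snd (opart n X)"
    then show "case p of (U, W) \<Rightarrow> U \<in> fst (opart n X) \<and> W \<in> fst (opart n X) \<and> U \<noteq> W \<and> 0 < num_edges n U W"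
      using 1[of "fst p" "snd p"] by (simp add: case_prod_beta)
  qed (use 2 in simp)
qed

text \<open>Each element of the cell is a directed edge of the cycle, and mapping it to its head
  enumerates the out-neighbours of its tail.\<close>

lemma outdeg_opart:
  assumes n: "3 \<le> n" and X: "sink_cell X" "fst ` X \<subseteq> {..<n}"
  shows "lookup (outdeg_exponent n (opart n X)) i = card {x \<in> X. tail n x = i}"
proof -
  define T where "T = fst ` X"
  have T: "T \<subseteq> {..<n}" using X(2) by (simp add: T_def)
  have fT: "finite T" using T finite_subset by blast
  have fn: "fst x < n" if "x \<in> X" for x using that X(2) by auto
  have or: "orientation n (fst (opart n X)) (snd (opart n X))" by (rule orientation_opart[OF n X])
  have no_rev: False if "(U, W) \<in> snd (opart n X)" "(W, U) \<in> snd (opart n X)" for U W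
    using acyclic_asym[OF acyclic_opart(1)[OF X] that(1)] that(2) by contradiction
  have no_loop: False if "(U, U) \<in> snd (opart n X)" for U using no_rev that by blast
  note edge = tail_head_edge[OF n]
  have l: "lookup (outdeg_exponent n (opart n X)) i = (if i \<in> {1..n} then out_edges n (opart n X) i else 0)"
    unfolding outdeg_exponent_def lookup_sum by (simp add: lookup_single when_def)
  show ?thesis
  proof (cases "i \<in> {1..n}")
    case False
    then have "{x \<in> X. tail n x = i} = {}" using tail_mem fn by blast
    then have "card {x \<in> X. tail n x = i} = 0" by (simp only: card.empty)
    then show ?thesis unfolding l using False by (simp only: if_False)
  next
    case i: True
    let ?O = "{w \<in> {1..n}. {i, w} \<in> cycle_edges n \<and> (\<exists>(U, W)\<in>snd (opart n X). i \<in> U \<and> w \<in> W)}"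
    have "bij_betw (head n) {x \<in> X. tail n x = i} ?O"
      unfolding bij_betw_def
    proof
      show "inj_on (head n) {x \<in> X. tail n x = i}"
      proof (rule inj_onI)
        fix x y assume xy: "x \<in> {x \<in> X. tail n x = i}" "y \<in> {x \<in> X. tail n x = i}" "head n x = head n y"
        have t: "tail n x = tail n y" using xy by simp
        have "fst x < n" "fst y < n" using xy fn by auto
        \<comment> \<open>As \<open>n \<ge> 3\<close>, two edges of the cycle never share both
          ends.\<close>
        then show "x = y" using xy(3) t n
          by (auto simp: tail_def head_def vtx_def prod_eq_iff split: if_splits)
      qed
      show "head n ` {x \<in> X. tail n x = i} = ?O"
      proof (intro equalityI subsetI)
        fix w assume "w \<in> head n ` {x \<in> X. tail n x = i}"
        then obtain x where x: "x \<in> X" "tail n x = i" "w = head n x" by blast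
        note tm = tail_mem[OF fn[OF x(1)]] and hm = head_mem[OF fn[OF x(1)]]
        have "cell_edge n T x \<in> snd (opart n X)" using x(1) by (simp add: opart_def T_def)
        moreover have "i \<in> fst (cell_edge n T x)" "w \<in> snd (cell_edge n T x)"
          using blk_self[OF tm, of T] blk_self[OF hm, of T] x by (simp_all add: cell_edge_def)
        moreover have "{i, w} \<in> cycle_edges n" using edge[OF fn[OF x(1)]] x by simp
        ultimately show "w \<in> ?O" using hm x(3) by (auto simp: case_prod_beta)
      next
        fix w assume w: "w \<in> ?O"
        then obtain U W where UW: "(U, W) \<in> snd (opart n X)" "i \<in> U" "w \<in> W" by blast
        have ce: "{i, w} \<in> cycle_edges n" using w by blast
        have blocks: "A = blk n T a" if "A \<in> fst (opart n X)" "a \<in> A" for A a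
          using that by (auto simp: opart_def T_def blk_def)
        have "U \<in> fst (opart n X)" "W \<in> fst (opart n X)"
          using bspec[OF conjunct1[OF or[unfolded orientation_def]] UW(1)] by simp_all
        then have U: "U = blk n T i" and W: "W = blk n T w" using blocks UW by blast+
        obtain t where t: "t < n" "(i = vtx n t \<and> w = Suc t) \<or> (i = Suc t \<and> w = vtx n t)"
          using ce unfolding cycle_edge_iff[OF n] by blast
        have "t \<in> T"
        proof (rule ccontr)
          assume "t \<notin> T"
          then have "lab T i = lab T w" using t lab_Suc_uncut[OF fT, of t] lab_vtx[OF T, of t] by auto
          then have "U = W" using U W by (simp add: blk_def)
          then show False using no_loop UW(1) by blast
        qed
        then obtain d where d: "(t, d) \<in> X" by (auto simp: T_def)
        then have ed: "cell_edge n T (t, d) \<in> snd (opart n X)" by (auto simp: opart_def T_def)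
        have "tail n (t, d) = i \<and> head n (t, d) = w \<or> tail n (t, d) = w \<and> head n (t, d) = i"
          using t(2) by (auto simp: tail_def head_def)
        \<comment> \<open>The reverse reading would put both directions between the same two
          blocks.\<close>
        moreover have "\<not> (tail n (t, d) = w \<and> head n (t, d) = i)"
          using ed no_rev[OF UW(1)] U W by (auto simp: cell_edge_def)
        ultimately show "w \<in> head n ` {x \<in> X. tail n x = i}" using d by force
      qed
    qed
    then have "card {x \<in> X. tail n x = i} = card ?O" by (rule bij_betw_same_card)
    then show ?thesis using l i by (simp add: out_edges_def)
  qed
qed

section \<open>The basis of the complex\<close>

text \<open>A finite acyclic relation has a sink, but here every block has an exit: through the cut
  after it if all cuts point forwards, through the cut before it if all point backwards.\<close>

lemma one_direction_not_acyclic: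
  assumes X: "fst ` X \<subseteq> {..<n}" "X \<noteq> {}" and d: "\<And>x. x \<in> X \<Longrightarrow> snd x = d"
  shows "\<not> acyclic (snd (opart n X))"
proof
  assume ac: "acyclic (snd (opart n X))"
  define T where "T = fst ` X"
  have T: "T \<subseteq> {..<n}" "T \<noteq> {}" using X by (auto simp: T_def)
  have fT: "finite T" using T(1) finite_subset by blast
  have XT: "(t, d) \<in> X" if t: "t \<in> T" for t
  proof -
    obtain x where x: "x \<in> X" "fst x = t" using t by (auto simp: T_def)
    then have "x = (t, d)" using d[of x] by (simp add: prod_eq_iff)
    then show ?thesis using x by simp
  qed
  have "X = (\<lambda>t. (t, d)) ` T" using d by (force simp: T_def)
  then have "finite X" using fT by simp
  then have "finite (snd (opart n X))" by (simp add: opart_def)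
  then have wf: "wf ((snd (opart n X))\<inverse>)" using ac by (rule finite_acyclic_wf_converse)
  have "1 \<in> {1..n}" using T by (cases n) auto
  then have "blk n T 1 \<in> fst (opart n X)" unfolding opart_def T_def by simp
  from wfE_min[OF wf this] obtain z where z: "z \<in> fst (opart n X)"
    "\<And>y. (y, z) \<in> (snd (opart n X))\<inverse> \<Longrightarrow> y \<notin> fst (opart n X)" by blast
  obtain v where v: "v \<in> {1..n}" "z = blk n T v" using z(1) by (auto simp: opart_def T_def)
  have out: False if t: "t \<in> T" "lab T (tail n (t, d)) = lab T v" for t
  proof -
    have tn: "fst (t, d) < n" using t T by auto
    have "z = blk n T (tail n (t, d))" using t(2) v blk_eq_iff[OF v(1)] by simp
    then have "(z, blk n T (head n (t, d))) \<in> snd (opart n X)"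
      using XT[OF t(1)] by (auto simp: opart_def T_def cell_edge_def)
    moreover have "blk n T (head n (t, d)) \<in> fst (opart n X)"
      using head_mem[OF tn] by (simp add: opart_def T_def)
    ultimately show False using z(2) by blast
  qed
  have ex: "\<exists>t\<in>T. cnt T t = l" if l: "l < card T" for l
  proof -
    have "l \<in> lab T ` T" using lab_image_cuts[OF fT] l by simp
    then show ?thesis using lab_cut(1)[OF fT] by auto
  qed
  have lv: "lab T v < card T" by (rule lab_less[OF fT T(2)])
  show False
  proof (cases d)
    case True
    obtain t where "t \<in> T" "cnt T t = lab T v" using ex[OF lv] by blast
    then show False using out lab_cut(1)[OF fT] True by (simp add: tail_def lab_vtx[OF T(1)])
  next
    case False
    \<comment> \<open>For the block of label 0 the preceding cut is the last one, with count
      \<open>card T - 1\<close>.\<close>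
    have "(if lab T v = 0 then card T - 1 else lab T v - 1) < card T" using lv by auto
    then obtain t where t: "t \<in> T" "cnt T t = (if lab T v = 0 then card T - 1 else lab T v - 1)"
      using ex by blast
    then have "lab T (Suc t) = lab T v" using lab_cut(2)[OF fT t(1)] lv by (auto split: if_splits)
    then show False using out[OF t(1)] False by (simp add: tail_def)
  qed
qed

definition contract_cell :: "(nat \<times> bool) set \<Rightarrow> nat \<times> bool \<Rightarrow> (nat \<times> bool) set" where
  "contract_cell X x = (if card X = 2 then {} else X - {x})"

lemma sink_cell_two:
  assumes "sink_cell X" "card X = 2"
  obtains s t where "X = {(s, False), (t, True)}" "s < t"
proof -
  have fX: "finite X" using assms(2) card.infinite by fastforce
  have "X \<noteq> {}" using assms(2) by auto
  then obtain s t where st: "(s, False) \<in> X" "(t, True) \<in> X" "s < t"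
    using assms(1) unfolding sink_cell_def by blast
  have "{(s, False), (t, True)} = X"
    by (rule card_subset_eq[OF fX]) (use st assms(2) in auto)
  then show ?thesis using that st by blast
qed

text \<open>The two cuts bound an interval, and both give the same directed edge out of it; this is
  where parallel edges count once.\<close>

lemma opart_two:
  assumes st: "s < t" "t < n"
  shows "cell_edge n {s, t} (s, False) = ({Suc s..t}, {1..n} - {Suc s..t})"
    and "cell_edge n {s, t} (t, True) = ({Suc s..t}, {1..n} - {Suc s..t})"
proof -
  have c: "cnt {s, t} v = (if v \<le> s then 0 else if v \<le> t then 1 else 2)" for v
  proof -
    have "{r \<in> {s, t}. r < v} = (if v \<le> s then {} else if v \<le> t then {s} else {s, t})"
      using st by auto
    then show ?thesis using st by (simp add: cnt_def)
  qed
  have l: "lab {s, t} v = (if s < v \<and> v \<le> t then 1 else 0)" for v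
  proof -
    have "card {s, t} = 2" using st by simp
    then show ?thesis unfolding lab_def c by simp
  qed
  have in_blk: "blk n {s, t} v = {Suc s..t}" if "s < v" "v \<le> t" for v
    unfolding blk_def l using that st by auto
  have out_blk: "blk n {s, t} v = {1..n} - {Suc s..t}" if "\<not> (s < v \<and> v \<le> t)" for v
    unfolding blk_def l using that by auto
  have "\<not> (s < vtx n s \<and> vtx n s \<le> t)" using st by (auto simp: vtx_def)
  then show "cell_edge n {s, t} (s, False) = ({Suc s..t}, {1..n} - {Suc s..t})"
    using in_blk[of "Suc s"] out_blk[of "vtx n s"] st by (simp add: cell_edge_def tail_def head_def)
  show "cell_edge n {s, t} (t, True) = ({Suc s..t}, {1..n} - {Suc s..t})"
    using in_blk[of t] out_blk[of "Suc t"] st by (simp add: cell_edge_def tail_def head_def vtx_def)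
qed

section \<open>Cells of a parcycle and acyclic partitions with a unique sink\<close>

locale parcycle_sink =
  fixes n :: nat and \<P> :: "nat set set" and q :: "nat set"
  assumes par: "parcycle n \<P>" and q: "q \<in> \<P>" "n \<in> q"
begin

lemma n3: "3 \<le> n" and part: "partition_on {1..n} \<P>" and conn: "V \<in> \<P> \<Longrightarrow> induces_connected n V"
  using par by (auto simp: parcycle_def)

definition cuts :: "nat set" where
  "cuts = {t. t < n \<and> (\<forall>V\<in>\<P>. \<not> (vtx n t \<in> V \<and> Suc t \<in> V))}"

definition cells :: "(nat \<times> bool) set set" where
  "cells = {X. sink_cell X \<and> X \<subseteq> cuts \<times> UNIV}"

lemma finite_cuts: "finite cuts"
  by (rule finite_subset[of _ "{..<n}"]) (auto simp: cuts_def)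

lemma cells_fst: "X \<in> cells \<Longrightarrow> fst ` X \<subseteq> cuts" "X \<in> cells \<Longrightarrow> fst ` X \<subseteq> {..<n}"
  by (auto simp: cells_def cuts_def)

lemma finite_cell: "X \<in> cells \<Longrightarrow> finite X"
  by (rule finite_subset[of _ "cuts \<times> UNIV"]) (auto simp: cells_def finite_cuts)

lemma finite_cells: "finite cells"
  by (rule finite_subset[of _ "Pow (cuts \<times> UNIV)"]) (auto simp: cells_def finite_cuts)

lemma cell_sink_cell: "X \<in> cells \<Longrightarrow> sink_cell X"
  by (simp add: cells_def)

lemma cell_card: "X \<in> cells \<Longrightarrow> X \<noteq> {} \<Longrightarrow> 2 \<le> card X"
  using sink_cell_card finite_cell cell_sink_cell by blast

lemma card_fst_cell: "X \<in> cells \<Longrightarrow> card (fst ` X) = card X"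
  using card_image sink_cell_inj cell_sink_cell by blast

lemma main_vertex_blk:
  assumes "T \<subseteq> cuts" "V \<in> \<P>" "u \<in> V"
  shows "V \<subseteq> blk n T u"
proof
  fix w assume w: "w \<in> V"
  have "lab T w = lab T u"
    by (rule cut_free_lab_eq[OF n3 conn[OF assms(2)] _ _ w assms(3)])
      (use assms in \<open>auto simp: cuts_def\<close>)
  moreover have "w \<in> {1..n}" using w assms(2) partition_onD1[OF part] by blast
  ultimately show "w \<in> blk n T u" by (simp add: blk_def)
qed

lemma connected_parset_blk:
  assumes T: "T \<subseteq> cuts" and v: "v \<in> {1..n}"
  shows "connected_parset n \<P> (blk n T v)"
  unfolding connected_parset_def
proof
  show "induces_connected n (blk n T v)"
    by (rule induces_connected_blk[OF n3 _ v]) (use T in \<open>auto simp: cuts_def\<close>)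
  let ?T = "{V \<in> \<P>. V \<subseteq> blk n T v}"
  have "w \<in> \<Union>?T" if w: "w \<in> blk n T v" for w
  proof -
    have "w \<in> {1..n}" using w by (simp add: blk_def)
    then obtain V where V: "V \<in> \<P>" "w \<in> V" using partition_onD1[OF part] by blast
    have "blk n T w = blk n T v" using w by (simp add: blk_def)
    then have "V \<subseteq> blk n T v" using main_vertex_blk[OF T V] by simp
    then show ?thesis using V by blast
  qed
  then have "blk n T v = \<Union>?T" by blast
  moreover have "?T \<noteq> {}" using blk_self[OF v, of T] calculation by blast
  ultimately show "\<exists>T'\<subseteq>\<P>. T' \<noteq> {} \<and> blk n T v = \<Union>T'" by (intro exI[of _ ?T]) simp
qed

lemma opart_acyclic_partition:
  assumes X: "X \<in> cells"
  shows "acyclic_partition n \<P> (opart n X)"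
  unfolding acyclic_partition_def connected_partition_def
proof (intro conjI ballI)
  show "partition_on {1..n} (fst (opart n X))" 
    unfolding opart_def fst_conv by (rule partition_on_blk)
  show "connected_parset n \<P> W" if W: "W \<in> fst (opart n X)" for W
  proof -
    obtain v where "v \<in> {1..n}" "W = blk n (fst ` X) v" using W by (auto simp: opart_def)
    then show ?thesis using connected_parset_blk[OF cells_fst(1)[OF X]] by simp
  qed
  show "orientation n (fst (opart n X)) (snd (opart n X))"
    by (rule orientation_opart[OF n3 cell_sink_cell[OF X] cells_fst(2)[OF X]])
  show "acyclic (snd (opart n X))"
    by (rule acyclic_opart(1)[OF cell_sink_cell[OF X] cells_fst(2)[OF X]])
qed

lemma opart_unique_sink:
  assumes X: "X \<in> cells"
  shows "has_unique_sink_at q (opart n X)"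
proof -
  define T where "T = fst ` X"
  note ac = acyclic_opart[OF cell_sink_cell[OF X] cells_fst(2)[OF X], folded T_def]
  have n: "n \<in> {1..n}" using n3 by simp
  have T: "T \<subseteq> {..<n}" using cells_fst(2)[OF X] by (simp add: T_def)
  have mem: "blk n T n \<in> fst (opart n X)" using n by (simp add: opart_def T_def)
  have "S = blk n T n" if S: "S \<in> fst (opart n X)" "\<forall>W. (S, W) \<notin> snd (opart n X)" for S
  proof -
    obtain v where v: "v \<in> {1..n}" "S = blk n T v" using S(1) by (auto simp: opart_def T_def)
    have "lab T v = 0" using ac(3)[OF v(1)] S(2) v(2) by blast
    then show ?thesis using v blk_eq_iff[OF v(1)] lab_top[OF T] by simp
  qed
  moreover have "\<forall>W. (blk n T n, W) \<notin> snd (opart n X)" using ac(2) by blast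
  ultimately have "{S \<in> fst (opart n X). \<forall>W. (S, W) \<notin> snd (opart n X)} = {blk n T n}"
    using mem by blast
  moreover have "q \<subseteq> blk n T n"
    using main_vertex_blk[OF cells_fst(1)[OF X] q] by (simp add: T_def)
  ultimately show ?thesis unfolding has_unique_sink_at_def using mem by blast
qed

text \<open>An explicit inverse of \<open>opart\<close>; it also turns functions on cells into
  functions on partitions.\<close>

definition recover :: "oriented_partition \<Rightarrow> (nat \<times> bool) set" where
  "recover C = {x. fst x < n \<and> (\<forall>W\<in>fst C. \<not> (tail n x \<in> W \<and> head n x \<in> W)) \<and>
    (\<exists>U W. (U, W) \<in> snd C \<and> tail n x \<in> U \<and> head n x \<in> W)}"

lemma recover_opart:
  assumes X: "X \<in> cells"
  shows "recover (opart n X) = X"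
proof -
  define T where "T = fst ` X"
  have T: "T \<subseteq> {..<n}" using cells_fst(2)[OF X] by (simp add: T_def)
  have c2: "2 \<le> card T" if "x \<in> X" for x
    using cell_card[OF X] card_fst_cell[OF X] that unfolding T_def by (metis empty_iff)
  note af = acyclic_partition_facts[OF opart_acyclic_partition[OF X]]
  have blocks: "A = blk n T a" if "A \<in> fst (opart n X)" "a \<in> A" for A a
    using that by (auto simp: opart_def T_def blk_def)
  show ?thesis
  proof (intro equalityI subsetI)
    fix x assume x: "x \<in> X"
    have fn: "fst x < n" using x T by (auto simp: T_def)
    have "fst x \<in> T" using x by (simp add: T_def)
    then have ne: "lab T (tail n x) \<noteq> lab T (head n x)"
      using lab_tail_head_neq[OF T _ c2[OF x]] by simp
    have "\<not> (tail n x \<in> W \<and> head n x \<in> W)" if "W \<in> fst (opart n X)" for W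
      using blocks[OF that] ne blk_eq_iff[OF tail_mem[OF fn], of T "head n x"] by metis
    moreover have "(blk n T (tail n x), blk n T (head n x)) \<in> snd (opart n X)"
      using x by (auto simp: opart_def T_def cell_edge_def)
    ultimately show "x \<in> recover (opart n X)"
      unfolding recover_def using fn blk_self[OF tail_mem[OF fn], of T] blk_self[OF head_mem[OF fn], of T]
      by blast
  next
    fix x assume "x \<in> recover (opart n X)"
    then have fn: "fst x < n" and nW: "\<And>W. W \<in> fst (opart n X) \<Longrightarrow> \<not> (tail n x \<in> W \<and> head n x \<in> W)"
      and "\<exists>U W. (U, W) \<in> snd (opart n X) \<and> tail n x \<in> U \<and> head n x \<in> W"
      by (auto simp: recover_def)
    then obtain U W where UW: "(U, W) \<in> snd (opart n X)" "tail n x \<in> U" "head n x \<in> W" by blast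
    then have U: "U = blk n T (tail n x)" and W: "W = blk n T (head n x)" using blocks af(3) by blast+
    have "fst x \<in> T"
    proof (rule ccontr)
      assume "fst x \<notin> T"
      then have "U = W" using lab_tail_head_uncut[OF T] U W by (simp add: blk_def)
      then show False using af(4)[OF UW(1)] by simp
    qed
    then obtain d where d: "(fst x, d) \<in> X" by (auto simp: T_def)
    show "x \<in> X"
    proof (cases "d = snd x")
      case True
      then show ?thesis using d by simp
    next
      case False
      then have "tail n (fst x, d) = head n x" "head n (fst x, d) = tail n x"
        by (auto simp: tail_def head_def)
      then have "cell_edge n T (fst x, d) = (W, U)" using U W by (simp add: cell_edge_def)
      then have "(W, U) \<in> snd (opart n X)" using d by (force simp: opart_def T_def)
      then show ?thesis using af(7)[OF UW(1)] by simp
    qed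
  qed
qed

lemma inj_on_opart: "inj_on (opart n) cells"
  by (rule inj_on_inverseI[of _ recover]) (rule recover_opart)

text \<open>The blocks of \<open>C\<close> are the label classes of its cuts \<open>T\<close>, and
  the single sink at the block of \<open>n\<close> forces the backward cuts to precede the forward
  ones.\<close>

lemma opart_recover:
  assumes C: "acyclic_partition n \<P> C" and sink: "has_unique_sink_at q C"
  shows "recover C \<in> cells" and "opart n (recover C) = C"
proof -
  note af = acyclic_partition_facts[OF C]
  have par_blocks: "connected_parset n \<P> W" if "W \<in> fst C" for W
    using C that by (auto simp: acyclic_partition_def connected_partition_def)
  define T where "T = {t. t < n \<and> (\<forall>W\<in>fst C. \<not> (vtx n t \<in> W \<and> Suc t \<in> W))}"
  have T: "T \<subseteq> {..<n}" by (auto simp: T_def)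
  have fT: "finite T" using T finite_subset by blast
  \<comment> \<open>Lying in a common block. It holds across every uncut edge and propagates along
    arcs of equal label, including the arc through \<open>n\<close>.\<close>
  define sb where "sb u v \<longleftrightarrow> (\<exists>W\<in>fst C. u \<in> W \<and> v \<in> W)" for u v
  have uniq: "W = W'" if "W \<in> fst C" "W' \<in> fst C" "u \<in> W" "u \<in> W'" for W W' u
    using disjointD[OF partition_onD2[OF af(2)] that(1,2)] that(3,4) by blast
  have sbs: "sb v u" if "sb u v" for u v using that by (auto simp: sb_def)
  have sbt: "sb u w" if uv: "sb u v" and vw: "sb v w" for u v w
  proof -
    obtain W W' where "W \<in> fst C" "u \<in> W" "v \<in> W" "W' \<in> fst C" "v \<in> W'" "w \<in> W'"
      using uv vw unfolding sb_def by blast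
    then show ?thesis using uniq[of W W' v] unfolding sb_def by blast
  qed
  have sbr: "sb u u" if "u \<in> {1..n}" for u
    using that partition_onD1[OF af(2)] unfolding sb_def by blast
  have sbT: "sb (vtx n t) (Suc t)" if "t < n" "t \<notin> T" for t
    using that unfolding T_def sb_def by blast
  have chain: "sb a b" if "1 \<le> a" "a \<le> b" "b \<le> n" "cnt T a = cnt T b" for a b
    using that(2,3,4)
  proof (induction b rule: dec_induct)
    case base
    then show ?case using sbr that(1) by simp
  next
    case (step b)
    have e: "cnt T b = cnt T a" "b \<notin> T"
      using cnt_mono[OF fT step.hyps(1)] cnt_Suc[OF fT, of b] step.prems by (auto split: if_splits)
    have "sb (vtx n b) (Suc b)" using sbT e step.prems by simp
    moreover have "vtx n b = b" using step.hyps that(1) by (simp add: vtx_def)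
    moreover have "sb a b" using step e by simp
    ultimately show ?case using sbt by simp
  qed
  have lab_sb': "sb a b" if ab: "a \<in> {1..n}" "b \<in> {1..n}" "a \<le> b" "lab T a = lab T b" for a b
  proof (cases "cnt T a = cnt T b")
    case True
    then show ?thesis using chain ab by simp
  next
    case False
    then have c: "cnt T a = 0" "cnt T b = card T"
      using ab(4) cnt_mono[OF fT ab(3)] unfolding lab_eq[OF fT] by (auto split: if_splits)
    have bn: "sb b n" by (rule chain) (use ab c cnt_top[OF T] in auto)
    have c1: "cnt T 1 = 0" using cnt_mono[OF fT, of 1 a] c ab by simp
    have a1: "sb 1 a" by (rule chain) (use ab c c1 in auto)
    have "0 \<notin> T" using c1 cnt_Suc[OF fT, of 0] by auto
    then have n1: "sb n 1" using sbT[of 0] n3 by (simp add: vtx_def)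
    show ?thesis by (rule sbs[OF sbt[OF bn sbt[OF n1 a1]]])
  qed
  have lab_sb: "sb a b" if "a \<in> {1..n}" "b \<in> {1..n}" "lab T a = lab T b" for a b
  proof (cases "a \<le> b")
    case True
    then show ?thesis using lab_sb' that by blast
  next
    case False
    then show ?thesis using sbs[OF lab_sb'[of b a]] that by simp
  qed
  have block: "W = blk n T v" if W: "W \<in> fst C" "v \<in> W" for W v
  proof (intro equalityI subsetI)
    have v: "v \<in> {1..n}" using W partition_onD1[OF af(2)] by blast
    fix w
    show "w \<in> blk n T v" if w: "w \<in> W"
    proof -
      have "lab T w = lab T v"
        by (rule cut_free_lab_eq[OF n3 _ T _ w W(2)])
          (use par_blocks[OF W(1)] W(1) in \<open>unfold connected_parset_def T_def, blast+\<close>)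
      moreover have "w \<in> {1..n}" using w W partition_onD1[OF af(2)] by blast
      ultimately show ?thesis by (simp add: blk_def)
    qed
    show "w \<in> W" if w: "w \<in> blk n T v"
    proof -
      have "sb v w" by (rule lab_sb) (use w v in \<open>auto simp: blk_def\<close>)
      then obtain W' where "W' \<in> fst C" "v \<in> W'" "w \<in> W'" unfolding sb_def by blast
      then show ?thesis using uniq[of W W' v] W by simp
    qed
  qed
  have blocks: "fst C = blk n T ` {1..n}"
  proof (intro equalityI subsetI)
    fix W assume W: "W \<in> fst C"
    then obtain v where v: "v \<in> W" using partition_onD3[OF af(2)] by (metis all_not_in_conv)
    moreover have "v \<in> {1..n}" using W v partition_onD1[OF af(2)] by blast
    ultimately show "W \<in> blk n T ` {1..n}" using block[OF W v] by blast
  next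
    fix W assume "W \<in> blk n T ` {1..n}"
    then obtain v where v: "v \<in> {1..n}" "W = blk n T v" by blast
    then obtain W' where "W' \<in> fst C" "v \<in> W'" using partition_onD1[OF af(2)] by blast
    then show "W \<in> fst C" using block v by metis
  qed
  have Tcuts: "T \<subseteq> cuts"
  proof
    fix t assume t: "t \<in> T"
    have False if V: "V \<in> \<P>" "vtx n t \<in> V" "Suc t \<in> V" for V
    proof -
      have tn: "t < n" using t by (simp add: T_def)
      obtain W where W: "W \<in> fst C" "Suc t \<in> W"
        using partition_onD1[OF af(2)] tn by (metis Suc_leI UnionE atLeastAtMost_iff le_add1 plus_1_eq_Suc)
      obtain \<T> where \<T>: "\<T> \<subseteq> \<P>" "W = \<Union>\<T>" using par_blocks[OF W(1)] by (auto simp: connected_parset_def)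
      then obtain V' where V': "V' \<in> \<T>" "Suc t \<in> V'" using W by blast
      have "V' = V" using disjointD[OF partition_onD2[OF part], of V' V] V V' \<T> by blast
      then have "vtx n t \<in> W" using V V' \<T> by blast
      then show False using t W by (auto simp: T_def)
    qed
    then show "t \<in> cuts" using t by (auto simp: cuts_def T_def)
  qed
  define X where "X = recover C"
  have rec: "x \<in> X \<longleftrightarrow> fst x \<in> T \<and> (blk n T (tail n x), blk n T (head n x)) \<in> snd C" for x
  proof
    assume "x \<in> X"
    then have fn: "fst x < n" and nW: "\<And>W. W \<in> fst C \<Longrightarrow> \<not> (tail n x \<in> W \<and> head n x \<in> W)"
      and "\<exists>U W. (U, W) \<in> snd C \<and> tail n x \<in> U \<and> head n x \<in> W"
      by (auto simp: recover_def X_def)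
    then obtain U W where UW: "(U, W) \<in> snd C" "tail n x \<in> U" "head n x \<in> W" by blast
    then have "U = blk n T (tail n x)" "W = blk n T (head n x)" using block af(3) by blast+
    moreover have "fst x \<in> T" using fn nW by (cases "snd x") (auto simp: T_def tail_def head_def)
    ultimately show "fst x \<in> T \<and> (blk n T (tail n x), blk n T (head n x)) \<in> snd C" using UW by simp
  next
    assume x: "fst x \<in> T \<and> (blk n T (tail n x), blk n T (head n x)) \<in> snd C"
    then have fn: "fst x < n" by (simp add: T_def)
    have "\<not> (tail n x \<in> W \<and> head n x \<in> W)" if "W \<in> fst C" for W
      using x that by (cases "snd x") (auto simp: T_def tail_def head_def)
    then show "x \<in> X" unfolding X_def recover_def
      using x fn blk_self[OF tail_mem[OF fn], of T] blk_self[OF head_mem[OF fn], of T] by blast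
  qed
  have cut_edge: "num_edges n (blk n T (tail n x)) (blk n T (head n x)) > 0" if "fst x < n" for x
    unfolding num_edges_def card_gt_0_iff
    using tail_head_edge[OF n3 that] blk_self[OF tail_mem[OF that], of T] blk_self[OF head_mem[OF that], of T]
    by (intro conjI finite_subset[OF _ finite_cycle_edges[of n]]) blast+
  have dich: "(t, False) \<in> X \<or> (t, True) \<in> X" if t: "t \<in> T" for t
  proof -
    have tn: "t < n" using t by (simp add: T_def)
    let ?U = "blk n T (vtx n t)" and ?W = "blk n T (Suc t)"
    have m: "vtx n t \<in> {1..n}" "Suc t \<in> {1..n}" using vtx_mem[OF tn] tn by auto
    have "?U \<in> fst C" "?W \<in> fst C" using m blocks by auto
    moreover from this have "?U \<noteq> ?W"
      using t blk_self[OF m(1), of T] blk_self[OF m(2), of T] unfolding T_def by blast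
    moreover have "num_edges n ?U ?W > 0" using cut_edge[of "(t, True)"] tn by (simp add: tail_def head_def)
    ultimately have "(?U, ?W) \<in> snd C \<or> (?W, ?U) \<in> snd C" by (rule af(6))
    then show ?thesis using t by (auto simp: rec tail_def head_def)
  qed
  have fstX: "fst ` X = T" using rec dich by force
  have edges: "snd C = cell_edge n T ` X"
  proof (intro equalityI subsetI)
    fix p assume p: "p \<in> snd C"
    obtain U W where UW: "p = (U, W)" by (cases p)
    have UWC: "U \<in> fst C" "W \<in> fst C" using p af(3) UW by auto
    have "card {e \<in> cycle_edges n. \<exists>u\<in>U. \<exists>w\<in>W. e = {u, w}} \<noteq> 0"
      using af(5)[of U W] p UW by (simp add: num_edges_def)
    then have "{e \<in> cycle_edges n. \<exists>u\<in>U. \<exists>w\<in>W. e = {u, w}} \<noteq> {}"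
      by (intro notI) (simp only: card.empty)
    then obtain u w where uw: "u \<in> U" "w \<in> W" "{u, w} \<in> cycle_edges n" by blast
    have U: "U = blk n T u" and W: "W = blk n T w" using block UWC uw by blast+
    obtain t where t: "t < n" "(u = vtx n t \<and> w = Suc t) \<or> (u = Suc t \<and> w = vtx n t)"
      using uw(3) unfolding cycle_edge_iff[OF n3] by blast
    have "U \<noteq> W" using af(4) p UW by blast
    then have "t \<in> T"
      using t lab_Suc_uncut[OF fT, of t] lab_vtx[OF T, of t] U W by (auto simp: blk_def)
    moreover have "\<exists>d. tail n (t, d) = u \<and> head n (t, d) = w"
      using t(2)
    proof
      assume "u = vtx n t \<and> w = Suc t"
      then show ?thesis by (intro exI[of _ True]) (simp add: tail_def head_def)
    next
      assume "u = Suc t \<and> w = vtx n t"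
      then show ?thesis by (intro exI[of _ False]) (simp add: tail_def head_def)
    qed
    then obtain d where d: "tail n (t, d) = u \<and> head n (t, d) = w" by blast
    ultimately have "(t, d) \<in> X" "cell_edge n T (t, d) = p"
      using p UW U W by (auto simp: rec cell_edge_def)
    then show "p \<in> cell_edge n T ` X" by blast
  next
    fix p assume "p \<in> cell_edge n T ` X"
    then show "p \<in> snd C" by (auto simp: rec cell_edge_def)
  qed
  show op: "opart n (recover C) = C"
    using blocks edges fstX by (simp add: opart_def X_def[symmetric] prod_eq_iff)
  have "sink_cell X"
  proof (cases "X = {}")
    case True
    then show ?thesis by (simp add: sink_cell_def)
  next
    case False
    have Tne: "T \<noteq> {}" using False fstX by auto
    obtain W0 where W0: "W0 \<in> fst C" "q \<subseteq> W0" "{S \<in> fst C. \<forall>W. (S, W) \<notin> snd C} = {W0}"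
      using sink by (auto simp: has_unique_sink_at_def)
    have W0n: "W0 = blk n T n" using block[OF W0(1)] W0(2) q by blast
    have sink0: "lab T v = 0 \<longleftrightarrow> (\<forall>W. (blk n T v, W) \<notin> snd C)" if v: "v \<in> {1..n}" for v
    proof -
      have "(\<forall>W. (blk n T v, W) \<notin> snd C) \<longleftrightarrow> blk n T v = W0" using W0(3) blocks v by blast
      then show ?thesis using W0n blk_eq_iff[OF v] lab_top[OF T] by simp
    qed
    have ex: "\<exists>t\<in>T. cnt T t = l" if l: "l < card T" for l
    proof -
      have "l \<in> lab T ` T" using lab_image_cuts[OF fT] l by simp
      then show ?thesis using lab_cut(1)[OF fT] by auto
    qed
    have cinj: "s = t" if "s \<in> T" "t \<in> T" "cnt T s = cnt T t" for s t
      using inj_onD[OF inj_on_cnt[OF fT] that(3)] that by simp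
    have xT: "fst x \<in> T" if "x \<in> X" for x using that rec by blast
    have fn: "fst x < n" if "x \<in> X" for x using xT[OF that] T by auto
    have lt0: "lab T (tail n x) \<noteq> 0" if x: "x \<in> X" for x
      using sink0[OF tail_mem[OF fn[OF x]]] x rec by blast
    have out: "\<exists>x\<in>X. lab T (tail n x) = lab T v" if v: "v \<in> {1..n}" and l: "lab T v \<noteq> 0" for v
    proof -
      obtain W where "(blk n T v, W) \<in> snd C" using sink0[OF v] l by blast
      then obtain x where x: "x \<in> X" "blk n T v = blk n T (tail n x)" unfolding edges by (auto simp: cell_edge_def)
      then show ?thesis using blk_eq_iff[OF v] by auto
    qed
    have card0: "0 < card T" using Tne fT by (simp add: card_gt_0_iff)
    have not_both: "\<not> ((t, False) \<in> X \<and> (t, True) \<in> X)" for t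
      using af(7) by (auto simp: rec tail_def head_def)
    \<comment> \<open>A block other than the sink needs an exit. If the cut before it points
      forwards, into the block, the exit is the cut after it, which then points forwards as
      well.\<close>
    have up: "(t', True) \<in> X" if "(t, True) \<in> X" "t' \<in> T" "cnt T t' = cnt T t + k" for t t' k
      using that
    proof (induction k arbitrary: t')
      case 0
      then have "t' = t" using cinj[of t' t] xT[of "(t, True)"] by auto
      then show ?case using 0 by simp
    next
      case (Suc k)
      have c: "cnt T t' < card T" by (rule cnt_less_card[OF fT Suc.prems(2)])
      then have "cnt T t + k < card T" using Suc.prems(3) by simp
      then obtain t'' where t'': "t'' \<in> T" "cnt T t'' = cnt T t + k" using ex by blast
      have t''T: "(t'', True) \<in> X" by (rule Suc.IH[OF Suc.prems(1) t''])
      have t'n: "t' < n" using Suc.prems(2) T by auto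
      have "lab T (vtx n t') = cnt T t'" using lab_cut(1)[OF fT Suc.prems(2)] lab_vtx[OF T] by simp
      then have l: "lab T (vtx n t') = Suc (cnt T t'')" using Suc.prems(3) t''(2) by simp
      then have "lab T (vtx n t') \<noteq> 0" by simp
      from out[OF vtx_mem[OF t'n] this] obtain x
        where x: "x \<in> X" "lab T (tail n x) = Suc (cnt T t'')" unfolding l by blast
      show ?case
      proof (cases "snd x")
        case True
        then have "lab T (tail n x) = cnt T (fst x)"
          using lab_cut(1)[OF fT xT[OF x(1)]] lab_vtx[OF T] by (simp add: tail_def)
        then have "cnt T (fst x) = cnt T t'" using x(2) Suc.prems(3) t''(2) by simp
        from cinj[OF xT[OF x(1)] Suc.prems(2) this]
        have "x = (t', True)" using True by (simp add: prod_eq_iff)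
        then show ?thesis using x(1) by simp
      next
        case False
        then have "cnt T (fst x) = cnt T t''"
          using lab_cut(2)[OF fT xT[OF x(1)]] x(2) by (auto simp: tail_def split: if_splits)
        from cinj[OF xT[OF x(1)] t''(1) this]
        have "x = (t'', False)" using False by (simp add: prod_eq_iff)
        then show ?thesis using not_both[of t''] t''T x(1) by simp
      qed
    qed
    \<comment> \<open>The first and the last cut bound the block of \<open>n\<close>, which has no
      exit as it is the sink: the first one must point backwards and the last one forwards.\<close>
    obtain s0 where s0: "s0 \<in> T" "cnt T s0 = 0" using ex[OF card0] by blast
    have "(s0, True) \<notin> X"
      using lt0[of "(s0, True)"] lab_cut(1)[OF fT s0(1)] s0(2) lab_vtx[OF T] by (auto simp: tail_def)
    then have F: "(s0, False) \<in> X" using dich[OF s0(1)] by blast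
    obtain t0 where t0: "t0 \<in> T" "cnt T t0 = card T - 1" using ex[of "card T - 1"] card0 by auto
    have "(t0, False) \<notin> X"
      using lt0[of "(t0, False)"] lab_cut(2)[OF fT t0(1)] t0(2) card0 by (auto simp: tail_def)
    then have Tr: "(t0, True) \<in> X" using dich[OF t0(1)] by blast
    have "s < t" if st: "(s, False) \<in> X" "(t, True) \<in> X" for s t
    proof (rule ccontr)
      assume "\<not> s < t"
      then have "cnt T t \<le> cnt T s" using cnt_mono[OF fT] by simp
      then obtain k where "cnt T s = cnt T t + k" using le_Suc_ex by blast
      then have "(s, True) \<in> X" using up[OF st(2)] xT[OF st(1)] by simp
      then show False using not_both st(1) by blast
    qed
    then show ?thesis using F Tr unfolding sink_cell_def by blast
  qed
  then show "recover C \<in> cells"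
    using rec Tcuts by (auto simp: cells_def X_def)
qed

lemma contract_cell_opart:
  assumes X: "X \<in> cells" "x \<in> X"
  shows "contract (opart n X) (cell_edge n (fst ` X) x) = opart n (contract_cell X x)"
  unfolding contract_cell_def
  by (rule contract_opart[OF cells_fst(2)[OF X(1)] sink_cell_inj[OF cell_sink_cell[OF X(1)]] _ X(2)])
    (use X cell_card in blast)

lemma empty_cell: "{} \<in> cells"
  by (simp add: cells_def sink_cell_def)

text \<open>Deleting an edge never disturbs the order of the two directions. It can only lose one
  direction, and then the remaining edges contain a directed cycle.\<close>

lemma contract_cell_mem_iff:
  assumes X: "X \<in> cells" "x \<in> X"
  shows "acyclic_partition n \<P> (opart n (contract_cell X x)) \<longleftrightarrow> contract_cell X x \<in> cells"
proof
  assume ac: "acyclic_partition n \<P> (opart n (contract_cell X x))"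
  show "contract_cell X x \<in> cells"
  proof (cases "card X = 2")
    case True
    then show ?thesis by (simp add: contract_cell_def empty_cell)
  next
    case False
    define Y where "Y = X - {x}"
    have Y: "contract_cell X x = Y" using False by (simp add: contract_cell_def Y_def)
    have "2 < card X" using cell_card[OF X(1)] X(2) False by force
    then have "card Y \<noteq> 0" using X finite_cell[OF X(1)] by (simp add: Y_def)
    then have Yne: "Y \<noteq> {}" by auto
    have Yn: "fst ` Y \<subseteq> {..<n}" using cells_fst(2)[OF X(1)] by (auto simp: Y_def)
    have "\<not> (\<forall>y\<in>Y. snd y = d)" for d
      using one_direction_not_acyclic[OF Yn Yne, of d] ac unfolding Y acyclic_partition_def by blast
    then have "\<exists>s. (s, False) \<in> Y" "\<exists>t. (t, True) \<in> Y" by (metis (full_types) prod.collapse)+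
    moreover have "\<forall>s t. (s, False) \<in> Y \<longrightarrow> (t, True) \<in> Y \<longrightarrow> s < t"
      using cell_sink_cell[OF X(1)] unfolding sink_cell_def Y_def by blast
    ultimately have "sink_cell Y" unfolding sink_cell_def by blast
    then show ?thesis using X unfolding Y by (auto simp: cells_def Y_def)
  qed
qed (rule opart_acyclic_partition)

lemma contractible_opart_iff:
  assumes X: "X \<in> cells"
  shows "contractible n \<P> (opart n X) f \<longleftrightarrow>
    (\<exists>x\<in>X. f = cell_edge n (fst ` X) x \<and> contract_cell X x \<in> cells)"
proof -
  have "f \<in> snd (opart n X) \<longleftrightarrow> (\<exists>x\<in>X. f = cell_edge n (fst ` X) x)" by (auto simp: opart_def)
  then show ?thesis
    unfolding contractible_def using contract_cell_opart[OF X] contract_cell_mem_iff[OF X] by metis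
qed

text \<open>Truncated subtraction serves both cases: a nonempty cell has as many blocks as cuts, and
  the empty cell has one block.\<close>

lemma card_opart:
  assumes X: "X \<in> cells"
  shows "card (fst (opart n X)) = Suc (card X - 1)"
proof -
  have "card (fst (opart n X)) = (if fst ` X = {} then 1 else card (fst ` X))"
    unfolding opart_def fst_conv by (rule card_blocks[OF cells_fst(2)[OF X]]) (use n3 in simp)
  then show ?thesis
    using card_fst_cell[OF X] cell_card[OF X] by (cases "X = {}") simp_all
qed

text \<open>Distinct blocks contain distinct main vertices. Hence every cell meets the bound on the
  degree in \<open>F0_basis\<close>.\<close>

lemma card_connected_partition:
  assumes C: "acyclic_partition n \<P> C"
  shows "card (fst C) \<le> card \<P>"
proof -
  note af = acyclic_partition_facts[OF C]
  have par_blocks: "\<exists>V. V \<in> \<P> \<and> V \<subseteq> W" if W: "W \<in> fst C" for W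
  proof -
    have "connected_parset n \<P> W"
      using C W unfolding acyclic_partition_def connected_partition_def by blast
    then obtain \<T> where "\<T> \<subseteq> \<P>" "\<T> \<noteq> {}" "W = \<Union>\<T>" unfolding connected_parset_def by blast
    then show ?thesis by blast
  qed
  define g where "g W = (SOME V. V \<in> \<P> \<and> V \<subseteq> W)" for W
  have g: "g W \<in> \<P> \<and> g W \<subseteq> W" if "W \<in> fst C" for W
    unfolding g_def by (rule someI_ex[OF par_blocks[OF that]])
  have "inj_on g (fst C)"
  proof (rule inj_onI)
    fix W W' assume W: "W \<in> fst C" "W' \<in> fst C" "g W = g W'"
    have "g W \<noteq> {}" using g[OF W(1)] partition_onD3[OF part] by metis
    then show "W = W'"
      using disjointD[OF partition_onD2[OF af(2)] W(1,2)] g[OF W(1)] g[OF W(2)] W(3) by blast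
  qed
  moreover have "finite \<P>" using part by (rule finite_elements[OF finite_atLeastAtMost])
  ultimately show ?thesis using g by (intro card_inj_on_le[of g]) auto
qed

lemma F0_basis_eq: "F0_basis n \<P> q j = opart n ` {X \<in> cells. card X - 1 = j}"
proof (intro equalityI subsetI)
  fix C assume "C \<in> F0_basis n \<P> q j"
  then have C: "acyclic_partition n \<P> C" "card (fst C) = j + 1" "has_unique_sink_at q C"
    by (auto simp: F0_basis_def)
  note r = opart_recover[OF C(1,3)]
  have "card (recover C) - 1 = j" using card_opart[OF r(1)] r(2) C(2) by simp
  then show "C \<in> opart n ` {X \<in> cells. card X - 1 = j}" using r by (metis (mono_tags, lifting) imageI mem_Collect_eq)
next
  fix C assume "C \<in> opart n ` {X \<in> cells. card X - 1 = j}"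
  then obtain X where X: "X \<in> cells" "card X - 1 = j" "C = opart n X" by blast
  then show "C \<in> F0_basis n \<P> q j"
    using opart_acyclic_partition[OF X(1)] opart_unique_sink[OF X(1)] card_opart[OF X(1)]
      card_connected_partition[OF opart_acyclic_partition[OF X(1)]]
    by (simp add: F0_basis_def)
qed

end

section \<open>The differential\<close>

lemma single_sum: "Poly_Mapping.single m (\<Sum>x\<in>S. f x) = (\<Sum>x\<in>S. Poly_Mapping.single m (f x))"
  by (induction S rule: infinite_finite_induct) (simp_all add: single_add)

lemma of_int_mult_monomial: "of_int z * (monomial m :: 'a::field mpoly) = Poly_Mapping.single m (of_int z)"
proof -
  have "of_int z = (Poly_Mapping.single 0 (of_int z) :: 'a mpoly)" by simp
  then show ?thesis unfolding monomial_def by (simp only: mult_single) simp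
qed

lemma merge_edge_cell_edge:
  assumes "T \<subseteq> {..<n}" "fst x \<in> T" "2 \<le> card T" "fst y < n"
  shows "merge_edge (cell_edge n T x) (cell_edge n T y) = cell_edge n (T - {fst x}) y"
proof -
  have "merge_block (cell_edge n T x) (blk n T v) = blk n (T - {fst x}) v" if "v \<in> {1..n}" for v
    by (rule merge_block_blk[OF assms(1-3) that])
      (use cell_edge_endpoints[OF assms(1), of "fst x" "snd x"] in simp)
  from this[OF tail_mem[OF assms(4)]] this[OF head_mem[OF assms(4)]] show ?thesis
    by (simp add: merge_edge_def cell_edge_def)
qed

lemma lookup_cut_exponent:
  assumes "finite S"
  shows "lookup (cut_exponent n S) i = (if i \<in> S then card {w \<in> {1..n} - S. {i, w} \<in> cycle_edges n} else 0)"
  unfolding cut_exponent_def lookup_sum using assms by (simp add: lookup_single when_def)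

text \<open>The only directed edge leaves the interval, so outdegrees count neighbours outside it.
  Thus the basis elements of degree 1 carry cut monomials.\<close>

lemma outdeg_two:
  assumes st: "s < t" "t < n"
  shows "outdeg_exponent n (opart n {(s, False), (t, True)}) = cut_exponent n {Suc s..t}"
proof (rule poly_mapping_eqI)
  fix i
  let ?S = "{Suc s..t}" and ?C = "opart n {(s, False), (t, True)}"
  have "snd ?C = {(?S, {1..n} - ?S)}" using opart_two[OF st] by (simp add: opart_def)
  then have o: "out_edges n ?C i = card {w \<in> {1..n}. {i, w} \<in> cycle_edges n \<and> i \<in> ?S \<and> w \<in> {1..n} - ?S}"
    unfolding out_edges_def by simp
  have "out_edges n ?C i = (if i \<in> ?S then card {w \<in> {1..n} - ?S. {i, w} \<in> cycle_edges n} else 0)"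
  proof (cases "i \<in> ?S")
    case True
    then have "{w \<in> {1..n}. {i, w} \<in> cycle_edges n \<and> i \<in> ?S \<and> w \<in> {1..n} - ?S}
        = {w \<in> {1..n} - ?S. {i, w} \<in> cycle_edges n}" by blast
    then show ?thesis unfolding o using True by (simp only: if_True)
  next
    case False
    then have "{w \<in> {1..n}. {i, w} \<in> cycle_edges n \<and> i \<in> ?S \<and> w \<in> {1..n} - ?S} = {}" by blast
    then show ?thesis unfolding o using False by (simp only: if_False card.empty)
  qed
  moreover have "lookup (outdeg_exponent n ?C) i = (if i \<in> {1..n} then out_edges n ?C i else 0)"
    unfolding outdeg_exponent_def lookup_sum by (simp add: lookup_single when_def)
  moreover have "i \<in> ?S \<Longrightarrow> i \<in> {1..n}" using st by auto
  ultimately show "lookup (outdeg_exponent n ?C) i = lookup (cut_exponent n ?S) i"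
    unfolding lookup_cut_exponent[OF finite_atLeastAtMost] by simp
qed

section \<open>Generators of the parking function ideal\<close>

context parcycle_sink
begin

text \<open>A union of main vertices that does not contain \<open>q\<close> misses \<open>q\<close>
  and hence \<open>n\<close>, and a connected set of vertices of the cycle that misses
  \<open>n\<close> is an interval.\<close>

lemma connected_parset_interval:
  assumes S: "connected_parset n \<P> S" "\<not> q \<subseteq> S"
  obtains s t where "s < t" "s \<in> cuts" "t \<in> cuts" "S = {Suc s..t}"
proof -
  obtain \<T> where \<T>: "\<T> \<subseteq> \<P>" "\<T> \<noteq> {}" "S = \<Union>\<T>" and c: "induces_connected n S"
    using S(1) unfolding connected_parset_def by blast
  have S0: "S \<noteq> {}" and Sn: "S \<subseteq> {1..n}" using c by (simp_all add: induces_connected_def)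
  have finS: "finite S" using Sn finite_subset by blast
  have absorb: "V \<subseteq> S" if V: "V \<in> \<P>" "u \<in> V" "u \<in> S" for V u
  proof -
    obtain V' where "V' \<in> \<T>" "u \<in> V'" using V \<T> by blast
    moreover from this have "V' = V"
      using disjointD[OF partition_onD2[OF part], of V' V] V \<T> by blast
    ultimately show ?thesis using \<T> by blast
  qed
  have nS: "n \<notin> S" using absorb[OF q] S(2) by blast
  define a b where "a = Min S" and "b = Max S"
  have a: "a \<in> S" and b: "b \<in> S" using Min_in[OF finS S0] Max_in[OF finS S0] by (simp_all add: a_def b_def)
  have le: "a \<le> x \<and> x \<le> b" if "x \<in> S" for x using that finS by (simp add: a_def b_def)
  have a1: "1 \<le> a" using a Sn by auto
  have bn: "b < n" 
  proof -
    have "b \<noteq> n" "b \<le> n" using b Sn nS by auto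
    then show ?thesis by simp
  qed
  \<comment> \<open>If \<open>x\<close> were missing, no edge inside \<open>S\<close> would cross
    the cuts \<open>0\<close> and \<open>x\<close>, although they separate the minimum from the
    maximum: the labels are 1 and \<open>2 mod 2 = 0\<close>.\<close>
  have ge: "x \<in> S" if x: "a \<le> x" "x \<le> b" for x
  proof (rule ccontr)
    assume xS: "x \<notin> S"
    have "x \<noteq> a" "x \<noteq> b" using xS a b by blast+
    then have x': "a < x" "x < b" using x by simp_all
    have T: "{0, x} \<subseteq> {..<n}" using x' bn by auto
    have "lab {0, x} a = lab {0, x} b"
    proof (rule cut_free_lab_eq[OF n3 c T _ a b])
      fix t assume "t \<in> {0, x}" "vtx n t \<in> S"
      then show False using nS xS x' by (auto simp: vtx_def split: if_splits)
    qed
    moreover have c2: "card {0, x} = 2" using x' by simp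
    moreover have "{t \<in> {0, x}. t < a} = {0}" "{t \<in> {0, x}. t < b} = {0, x}" using x' a1 by auto
    then have "cnt {0, x} a = 1" "cnt {0, x} b = 2" unfolding cnt_def using c2 by simp_all
    ultimately show False unfolding lab_def by simp
  qed
  have Seq: "S = {a..b}"
  proof (intro equalityI subsetI)
    fix x
    show "x \<in> {a..b}" if "x \<in> S" using le[OF that] by simp
    show "x \<in> S" if "x \<in> {a..b}" by (rule ge) (use that in auto)
  qed
  \<comment> \<open>A main vertex that meets \<open>S\<close> lies in \<open>S\<close>, so the two
    edges leaving the interval join different main vertices.\<close>
  have "b \<in> cuts"
  proof -
    have "\<not> (vtx n b \<in> V \<and> Suc b \<in> V)" if V: "V \<in> \<P>" for V
    proof
      assume A: "vtx n b \<in> V \<and> Suc b \<in> V"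
      have "vtx n b = b" using a1 le[OF b] by (simp add: vtx_def)
      then have "b \<in> V" using A by simp
      from absorb[OF V this b] have "Suc b \<in> S" using A by blast
      then show False using le[of "Suc b"] by simp
    qed
    then show ?thesis using bn by (simp add: cuts_def)
  qed
  moreover have "a - 1 \<in> cuts"
  proof -
    have "\<not> (vtx n (a - 1) \<in> V \<and> Suc (a - 1) \<in> V)" if V: "V \<in> \<P>" for V
    proof
      assume A: "vtx n (a - 1) \<in> V \<and> Suc (a - 1) \<in> V"
      have "a \<in> V" using A a1 by simp
      from absorb[OF V this a] have m: "vtx n (a - 1) \<in> S" using A by blast
      show False
      proof (cases "a = 1")
        case True
        then show ?thesis using m nS by (simp add: vtx_def)
      next
        case False
        then have "a - 1 \<in> S" using m a1 by (simp add: vtx_def)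
        then show ?thesis using le[of "a - 1"] a1 by arith
      qed
    qed
    then show ?thesis using bn le[OF a] a1 by (simp add: cuts_def)
  qed
  moreover have "a - 1 < b" "S = {Suc (a - 1)..b}" using Seq a1 le[OF a] by auto
  ultimately show ?thesis using that by blast
qed

lemma pair_cell: "s < t \<Longrightarrow> s \<in> cuts \<Longrightarrow> t \<in> cuts \<Longrightarrow> {(s, False), (t, True)} \<in> cells"
  by (auto simp: cells_def sink_cell_def)

lemma parking_ideal_eq:
  "(parking_ideal n \<P> q :: 'a::field mpoly set) =
    Idl\<^bsub>mpoly_ring n\<^esub> {monomial (outdeg_exponent n C) | C. C \<in> F0_basis n \<P> q 1}"
proof -
  have "cut_exponent n ` {S. connected_parset n \<P> S \<and> \<not> q \<subseteq> S} = outdeg_exponent n ` F0_basis n \<P> q 1"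
  proof (intro equalityI subsetI)
    fix e assume "e \<in> cut_exponent n ` {S. connected_parset n \<P> S \<and> \<not> q \<subseteq> S}"
    then obtain S where S: "connected_parset n \<P> S" "\<not> q \<subseteq> S" "e = cut_exponent n S" by blast
    obtain s t where st: "s < t" "s \<in> cuts" "t \<in> cuts" "S = {Suc s..t}"
      using connected_parset_interval[OF S(1,2)] by blast
    have "t < n" using st by (simp add: cuts_def)
    then have "e = outdeg_exponent n (opart n {(s, False), (t, True)})"
      using outdeg_two[OF st(1)] S(3) st(4) by simp
    moreover have "opart n {(s, False), (t, True)} \<in> F0_basis n \<P> q 1"
      unfolding F0_basis_eq using pair_cell[OF st(1-3)] by (intro imageI) simp
    ultimately show "e \<in> outdeg_exponent n ` F0_basis n \<P> q 1" by blast
  next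
    fix e assume "e \<in> outdeg_exponent n ` F0_basis n \<P> q 1"
    then obtain X where X: "X \<in> cells" "card X - 1 = 1" "e = outdeg_exponent n (opart n X)"
      unfolding F0_basis_eq by blast
    have "card X = 2" using X(2) by simp
    then obtain s t where st: "X = {(s, False), (t, True)}" "s < t"
      using sink_cell_two[OF cell_sink_cell[OF X(1)]] by metis
    have tc: "t \<in> cuts" using X(1) st by (auto simp: cells_def)
    then have tn: "t < n" by (simp add: cuts_def)
    have sc: "fst ` X = {s, t}" using st by auto
    have "blk n {s, t} (Suc s) = {Suc s..t}"
      using opart_two(1)[OF st(2) tn] by (simp add: cell_edge_def tail_def)
    moreover have "connected_parset n \<P> (blk n {s, t} (Suc s))"
      by (rule connected_parset_blk) (use cells_fst(1)[OF X(1)] sc st tn in auto)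
    ultimately have "connected_parset n \<P> {Suc s..t}" by simp
    moreover have "\<not> q \<subseteq> {Suc s..t}" using q tn by auto
    moreover have "e = cut_exponent n {Suc s..t}" using X(3) st outdeg_two[OF st(2) tn] by simp
    ultimately show "e \<in> cut_exponent n ` {S. connected_parset n \<P> S \<and> \<not> q \<subseteq> S}" by blast
  qed
  note e = this
  have "{monomial (cut_exponent n S) :: 'a mpoly | S. connected_parset n \<P> S \<and> \<not> q \<subseteq> S}
      = monomial ` (cut_exponent n ` {S. connected_parset n \<P> S \<and> \<not> q \<subseteq> S})" by blast
  also have "\<dots> = {monomial (outdeg_exponent n C) | C. C \<in> F0_basis n \<P> q 1}"
    unfolding e by blast
  finally show ?thesis unfolding parking_ideal_def by (rule arg_cong)
qed

section \<open>Faces of cells\<close>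

lemma cell_face_iff:
  assumes X: "X \<in> cells" and Y: "Y \<in> cells"
  shows "cell_face X Y \<longleftrightarrow> (\<exists>x\<in>X. contract_cell X x = Y)"
proof (cases "Y = {}")
  case True
  have "X \<noteq> {}" if "card X = 2" using that by auto
  moreover have "card X = 2" if "x \<in> X" "X - {x} = {}" for x
  proof -
    have "X = {x}" using that by blast
    then show ?thesis using cell_card[OF X] by simp
  qed
  ultimately show ?thesis using True unfolding cell_face_def contract_cell_def by auto
next
  case False
  have "card X \<noteq> 2" if "x \<in> X" "Y = X - {x}" for x
    using that cell_card[OF Y False] finite_cell[OF X] by auto
  then show ?thesis using False unfolding cell_face_def contract_cell_def by auto
qed

lemma cell_face_subset: "cell_face X Y \<Longrightarrow> Y \<subseteq> X"
  by (auto simp: cell_face_def split: if_splits)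

lemma cell_face_card:
  assumes X: "X \<in> cells" and Y: "Y \<in> cells" and f: "cell_face X Y"
  shows "card X - 1 = Suc (card Y - 1)"
proof (cases "Y = {}")
  case True
  then show ?thesis using f by (simp add: cell_face_def)
next
  case False
  then obtain x where "x \<in> X" "Y = X - {x}" using f by (auto simp: cell_face_def)
  then show ?thesis using cell_card[OF Y False] finite_cell[OF X] by simp
qed

lemma cell_supset:
  assumes "X \<in> cells" "Y \<subseteq> X" "Z \<subseteq> Y" "Z \<in> cells" "Z \<noteq> {}"
  shows "Y \<in> cells"
proof -
  obtain s t where "(s, False) \<in> Z" "(t, True) \<in> Z"
    using assms(4,5) unfolding cells_def sink_cell_def by blast
  then have "(\<exists>s. (s, False) \<in> Y) \<and> (\<exists>t. (t, True) \<in> Y)" using assms(3) by blast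
  moreover have "\<forall>s t. (s, False) \<in> Y \<longrightarrow> (t, True) \<in> Y \<longrightarrow> s < t"
    using assms(1,2) unfolding cells_def sink_cell_def by blast
  moreover have "Y \<subseteq> cuts \<times> UNIV" using assms(1,2) unfolding cells_def by blast
  ultimately show ?thesis unfolding cells_def sink_cell_def by blast
qed

text \<open>This is the cancellation pattern behind the square of the differential: exactly two
  cells lie between \<open>X\<close> and \<open>Z\<close>, reached by deleting \<open>x\<close> or
  \<open>y\<close> first.\<close>

lemma cell_face_diamond:
  assumes X: "X \<in> cells" and Y: "Y \<in> cells" and Z: "Z \<in> cells"
    and XY: "cell_face X Y" and YZ: "cell_face Y Z"
  obtains x y where "x \<in> X" "y \<in> X" "x \<noteq> y" "3 \<le> card X" "X - {x} \<in> cells" "X - {y} \<in> cells"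
    "contract_cell (X - {x}) y = Z" "contract_cell (X - {y}) x = Z"
    "\<And>Y'. Y' \<in> cells \<Longrightarrow> cell_face X Y' \<Longrightarrow> cell_face Y' Z \<Longrightarrow> Y' = X - {x} \<or> Y' = X - {y}"
proof -
  have Yne: "Y \<noteq> {}" using YZ by (auto simp: cell_face_def split: if_splits)
  then obtain x where x: "x \<in> X" "Y = X - {x}" using XY by (auto simp: cell_face_def)
  have fX: "finite X" by (rule finite_cell[OF X])
  have c3: "3 \<le> card X" using cell_card[OF Y Yne] x fX by simp
  have cX: "card (X - {z}) = card X - 1" if "z \<in> X" for z using that fX by simp
  have face_ne: "\<exists>x'\<in>X. Y' = X - {x'}" if "Y' \<in> cells" "cell_face X Y'" "cell_face Y' Z" for Y'
  proof -
    have "Y' \<noteq> {}" using that(3) by (auto simp: cell_face_def split: if_splits)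
    then show ?thesis using that(2) by (simp add: cell_face_def)
  qed
  show ?thesis
  proof (cases "Z = {}")
    case False
    then obtain y where y: "y \<in> Y" "Z = Y - {y}" using YZ by (auto simp: cell_face_def)
    have yX: "y \<in> X" "x \<noteq> y" using y x by auto
    have Zeq: "Z = X - {x} - {y}" using x y by simp
    have Xy: "X - {y} \<in> cells" by (rule cell_supset[OF X _ _ Z False]) (use Zeq in auto)
    have "2 \<le> card Z" by (rule cell_card[OF Z False])
    moreover have "card Z = card Y - 1" using y finite_cell[OF Y] by simp
    ultimately have cY: "card Y \<noteq> 2" by simp
    show ?thesis
    proof (rule that[OF x(1) yX c3 _ Xy])
      show "X - {x} \<in> cells" using Y x by simp
      show "contract_cell (X - {x}) y = Z" using cY x Zeq by (simp add: contract_cell_def)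
      have "card (X - {y}) \<noteq> 2" using cY x(2) cX[OF x(1)] cX[OF yX(1)] by simp
      then show "contract_cell (X - {y}) x = Z" using Zeq by (auto simp: contract_cell_def)
      fix Y' assume Y': "Y' \<in> cells" "cell_face X Y'" "cell_face Y' Z"
      then obtain x' where x': "x' \<in> X" "Y' = X - {x'}" using face_ne by blast
      have "x' \<notin> Z" using cell_face_subset[OF Y'(3)] x' by blast
      then show "Y' = X - {x} \<or> Y' = X - {y}" using Zeq x' by blast
    qed
  next
    case True
    then have cY: "card Y = 2" using YZ by (simp add: cell_face_def)
    obtain s t where st: "Y = {(s, False), (t, True)}" "s < t"
      using sink_cell_two[OF cell_sink_cell[OF Y] cY] by metis
    obtain u d where u: "x = (u, d)" by (cases x)
    \<comment> \<open>Three edges repeat a direction: \<open>y\<close> is the edge of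
      \<open>Y\<close> directed like \<open>x\<close>, and \<open>z\<close> is the other one.
      Deleting \<open>z\<close> would leave one direction only, which is not a cell.\<close>
    define y where "y = (if d then (t, True) else (s, False))"
    define z where "z = (if d then (s, False) else (t, True))"
    have yz: "Y = {y, z}" by (cases d) (simp_all add: y_def z_def st(1) insert_commute)
    have "X = insert x Y" using x by blast
    then have Xeq: "X = {x, y, z}" unfolding yz .
    have "y \<noteq> z" by (cases d) (simp_all add: y_def z_def)
    moreover have "x \<notin> Y" using x(2) by blast
    ultimately have xy: "x \<noteq> y" "x \<noteq> z" "y \<noteq> z" unfolding yz by blast+
    have Xy: "X - {y} = {x, z}" unfolding Xeq using xy by blast
    have Xz: "X - {z} = {x, y}" unfolding Xeq using xy by blast
    have Xyc: "X - {y} \<in> cells"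
    proof -
      have sub: "X - {y} \<subseteq> X" by blast
      have "(\<exists>s. (s, False) \<in> X - {y}) \<and> (\<exists>t. (t, True) \<in> X - {y})"
        unfolding Xy u z_def by (cases d) auto
      moreover have "\<forall>s t. (s, False) \<in> X - {y} \<longrightarrow> (t, True) \<in> X - {y} \<longrightarrow> s < t"
        using X unfolding cells_def sink_cell_def by blast
      moreover have "X - {y} \<subseteq> cuts \<times> UNIV" using X unfolding cells_def by blast
      ultimately show ?thesis unfolding cells_def sink_cell_def by blast
    qed
    show ?thesis
    proof (rule that[OF x(1) _ xy(1) c3 _ Xyc])
      show "y \<in> X" using Xeq by simp
      show "X - {x} \<in> cells" using Y x by simp
      show "contract_cell (X - {x}) y = Z" using cY x True by (simp add: contract_cell_def)
      have "card (X - {y}) = 2" unfolding Xy using xy by simp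
      then show "contract_cell (X - {y}) x = Z" using True by (simp add: contract_cell_def)
      fix Y' assume Y': "Y' \<in> cells" "cell_face X Y'" "cell_face Y' Z"
      then obtain x' where x': "x' \<in> X" "Y' = X - {x'}" using face_ne by blast
      have "x' \<noteq> z"
      proof
        assume "x' = z"
        then have Y'eq: "Y' = {x, y}" using x' Xz by simp
        then have "(\<exists>s. (s, False) \<in> {x, y}) \<and> (\<exists>t. (t, True) \<in> {x, y})"
          using Y'(1) unfolding cells_def sink_cell_def by blast
        then show False unfolding u y_def by (cases d) auto
      qed
      then show "Y' = X - {x} \<or> Y' = X - {y}" using x' Xeq by auto
    qed
  qed
qed

section \<open>Matrix entries of the differential\<close>

definition weight ::
    "(oriented_partition set \<Rightarrow> nat set \<times> nat set \<Rightarrow> int) \<Rightarrow> oriented_partition \<Rightarrow> oriented_partition \<Rightarrow> 'a::field"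
  where "weight sg C C' =
    (\<Sum>f | contractible n \<P> C f \<and> contract C f = C'. of_int (sg (chip_class n \<P> C) f))"

definition cell_sign ::
    "(oriented_partition set \<Rightarrow> nat set \<times> nat set \<Rightarrow> int) \<Rightarrow> (nat \<times> bool) set \<Rightarrow> nat \<times> bool \<Rightarrow> int"
  where "cell_sign sg X x = sg (chip_class n \<P> (opart n X)) (cell_edge n (fst ` X) x)"

text \<open>Different elements have the same contraction only in a cell of two elements, where they
  are parallel. So no entry of the differential adds up several signs.\<close>

lemma cell_edge_eq_if_contract_eq:
  assumes X: "X \<in> cells" "x \<in> X" "y \<in> X" "contract_cell X x = contract_cell X y"
  shows "cell_edge n (fst ` X) x = cell_edge n (fst ` X) y"
proof (cases "card X = 2")
  case True
  then obtain s t where st: "X = {(s, False), (t, True)}" "s < t"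
    using sink_cell_two[OF cell_sink_cell[OF X(1)]] by metis
  have "t < n" using X(1) st by (auto simp: cells_def cuts_def)
  moreover have "fst ` X = {s, t}" using st by auto
  ultimately show ?thesis using opart_two[OF st(2)] X(2,3) st(1) by auto
next
  case False
  then have "x = y" using X by (auto simp: contract_cell_def)
  then show ?thesis by simp
qed

lemma weight_opart:
  assumes X: "X \<in> cells" "x \<in> X" and Y: "contract_cell X x \<in> cells"
  shows "weight sg (opart n X) (opart n (contract_cell X x)) = of_int (cell_sign sg X x)"
proof -
  have "{f. contractible n \<P> (opart n X) f \<and> contract (opart n X) f = opart n (contract_cell X x)}
      = {cell_edge n (fst ` X) x}"
  proof (intro equalityI subsetI)
    fix f assume "f \<in> {f. contractible n \<P> (opart n X) f \<and> contract (opart n X) f = opart n (contract_cell X x)}"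
    then have "contractible n \<P> (opart n X) f" and e: "contract (opart n X) f = opart n (contract_cell X x)" by auto
    then obtain y where y: "y \<in> X" "f = cell_edge n (fst ` X) y" "contract_cell X y \<in> cells"
      using contractible_opart_iff[OF X(1)] by blast
    then have "opart n (contract_cell X y) = opart n (contract_cell X x)"
      using e contract_cell_opart[OF X(1)] by simp
    then have "contract_cell X y = contract_cell X x" by (rule inj_onD[OF inj_on_opart _ y(3) Y])
    then show "f \<in> {cell_edge n (fst ` X) x}" using cell_edge_eq_if_contract_eq[OF X(1) y(1) X(2)] y by simp
  next
    fix f assume "f \<in> {cell_edge n (fst ` X) x}"
    then show "f \<in> {f. contractible n \<P> (opart n X) f \<and> contract (opart n X) f = opart n (contract_cell X x)}"
      using contractible_opart_iff[OF X(1), of f] contract_cell_opart[OF X] X Y by auto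
  qed
  then show ?thesis by (simp add: weight_def cell_sign_def)
qed

lemma weight_nonzeroD:
  assumes X: "X \<in> cells" and w: "weight sg (opart n X) C \<noteq> 0"
  shows "\<exists>Y\<in>cells. C = opart n Y \<and> cell_face X Y"
proof -
  have "{f. contractible n \<P> (opart n X) f \<and> contract (opart n X) f = C} \<noteq> {}"
    using w unfolding weight_def by (intro notI) (simp only: sum.empty simp_thms)
  then obtain f where f: "contractible n \<P> (opart n X) f" "contract (opart n X) f = C" by blast
  then obtain x where x: "x \<in> X" "f = cell_edge n (fst ` X) x" "contract_cell X x \<in> cells"
    using contractible_opart_iff[OF X] by blast
  then have "C = opart n (contract_cell X x)" using f contract_cell_opart[OF X] by simp
  moreover have "cell_face X (contract_cell X x)" using cell_face_iff[OF X x(3)] x(1) by blast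
  ultimately show ?thesis using x(3) by blast
qed

end

section \<open>Signs and the square of the differential\<close>

locale parcycle_signs = parcycle_sink +
  fixes sg :: "oriented_partition set \<Rightarrow> nat set \<times> nat set \<Rightarrow> int"
  assumes signs: "sign_system n \<P> sg"
begin

lemma class_contractible_cell:
  assumes X: "X \<in> cells" "x \<in> X" and Y: "contract_cell X x \<in> cells"
  shows "class_contractible n \<P> (chip_class n \<P> (opart n X)) (cell_edge n (fst ` X) x)"
    and "contractible n \<P> (opart n X) (cell_edge n (fst ` X) x)"
proof -
  show c: "contractible n \<P> (opart n X) (cell_edge n (fst ` X) x)"
    using contractible_opart_iff[OF X(1)] X(2) Y by blast
  have "opart n X \<in> chip_class n \<P> (opart n X)"
    using opart_acyclic_partition[OF X(1)] chip_firing_equiv_refl by (simp add: chip_class_def)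
  then show "class_contractible n \<P> (chip_class n \<P> (opart n X)) (cell_edge n (fst ` X) x)"
    using c unfolding class_contractible_def by blast
qed

lemma chip_class_mem: "X \<in> cells \<Longrightarrow> chip_class n \<P> (opart n X) \<in> chip_classes n \<P>"
  using opart_acyclic_partition unfolding chip_classes_def by blast

lemma cell_sign_unit:
  assumes X: "X \<in> cells" "x \<in> X" "contract_cell X x \<in> cells"
  shows "cell_sign sg X x \<in> {1, -1}"
proof -
  have "\<forall>f. class_contractible n \<P> (chip_class n \<P> (opart n X)) f \<longrightarrow> sg (chip_class n \<P> (opart n X)) f \<in> {1, -1}"
    using bspec[OF signs[unfolded sign_system_def] chip_class_mem[OF X(1)]] by (rule conjunct1)
  then show ?thesis using class_contractible_cell(1)[OF X] unfolding cell_sign_def by blast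
qed

text \<open>On a face the entry is 1 or -1, which is nonzero in a field of any
  characteristic.\<close>

lemma weight_nonzero_iff:
  assumes X: "X \<in> cells" and Y: "Y \<in> cells"
  shows "(weight sg (opart n X) (opart n Y) :: 'a::field) \<noteq> 0 \<longleftrightarrow> cell_face X Y"
proof
  assume "(weight sg (opart n X) (opart n Y) :: 'a) \<noteq> 0"
  from weight_nonzeroD[OF X this] obtain Y' where "Y' \<in> cells" "opart n Y = opart n Y'" "cell_face X Y'" by blast
  then show "cell_face X Y" using inj_onD[OF inj_on_opart, of Y Y'] Y by simp
next
  assume "cell_face X Y"
  then obtain x where x: "x \<in> X" "contract_cell X x = Y" using cell_face_iff[OF X Y] by blast
  have c: "contract_cell X x \<in> cells" using x Y by simp
  have "(weight sg (opart n X) (opart n Y) :: 'a) = of_int (cell_sign sg X x)"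
    using weight_opart[OF X x(1) c] x(2) by simp
  then show "(weight sg (opart n X) (opart n Y) :: 'a) \<noteq> 0" using cell_sign_unit[OF X x(1) c] by auto
qed

text \<open>The sign law for classes, read at representatives. With at least three edges the first
  contraction deletes just one, so the merged second edge is the same directed cut, taken with
  respect to the smaller set of cuts.\<close>

lemma cell_sign_anticommute:
  assumes X: "X \<in> cells" "x \<in> X" "y \<in> X" "x \<noteq> y" "3 \<le> card X" "X - {x} \<in> cells" "X - {y} \<in> cells"
    and Z: "contract_cell (X - {x}) y \<in> cells" "contract_cell (X - {y}) x \<in> cells"
  shows "cell_sign sg X x * cell_sign sg (X - {x}) y = - (cell_sign sg X y * cell_sign sg (X - {y}) x)"
proof -
  let ?T = "fst ` X" and ?C = "opart n X"
  let ?c = "chip_class n \<P> ?C" and ?f = "cell_edge n ?T x" and ?g = "cell_edge n ?T y"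
  have cc: "contract_cell X z = X - {z}" for z using X(5) by (simp add: contract_cell_def)
  have fx: "fst ` (X - {z}) = ?T - {fst z}" if "z \<in> X" for z
    using inj_onD[OF sink_cell_inj[OF cell_sink_cell[OF X(1)]] _ _ that] that by (auto simp: image_iff)
  have T: "?T \<subseteq> {..<n}" "2 \<le> card ?T" using cells_fst(2)[OF X(1)] card_fst_cell[OF X(1)] X(5) by simp_all
  have me: "merge_edge (cell_edge n ?T z) (cell_edge n ?T z') = cell_edge n (fst ` (X - {z})) z'"
    if "z \<in> X" "z' \<in> X" for z z'
    unfolding fx[OF that(1)] by (rule merge_edge_cell_edge[OF T(1) _ T(2)]) (use that T(1) in auto)
  have con: "contract ?C (cell_edge n ?T z) = opart n (X - {z})" if "z \<in> X" for z
    using contract_cell_opart[OF X(1) that] cc by simp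
  have cf: "class_contractible n \<P> ?c ?f" "contractible n \<P> ?C ?f"
    using class_contractible_cell[OF X(1,2)] cc X(6) by simp_all
  have cg: "class_contractible n \<P> ?c ?g" "contractible n \<P> ?C ?g"
    using class_contractible_cell[OF X(1,3)] cc X(7) by simp_all
  have kf: "class_contract n \<P> ?c ?f = chip_class n \<P> (opart n (X - {x}))"
    using class_contract_chip_class[OF opart_acyclic_partition[OF X(1)] cf(2)] con[OF X(2)] by simp
  have kg: "class_contract n \<P> ?c ?g = chip_class n \<P> (opart n (X - {y}))"
    using class_contract_chip_class[OF opart_acyclic_partition[OF X(1)] cg(2)] con[OF X(3)] by simp
  \<comment> \<open>The law concerns distinct directed edges, and these are distinct because their
    contractions are.\<close>
  have ne: "?f \<noteq> ?g"
  proof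
    assume "?f = ?g"
    then have "opart n (X - {x}) = opart n (X - {y})" using con X(2,3) by metis
    then have "X - {x} = X - {y}" by (rule inj_onD[OF inj_on_opart _ X(6,7)])
    then show False using X(2,4) by blast
  qed
  have y: "y \<in> X - {x}" and x: "x \<in> X - {y}" using X by auto
  have 1: "class_contractible n \<P> (class_contract n \<P> ?c ?f) (merge_edge ?f ?g)"
    unfolding kf me[OF X(2,3)] by (rule class_contractible_cell(1)[OF X(6) y Z(1)])
  have 2: "class_contractible n \<P> (class_contract n \<P> ?c ?g) (merge_edge ?g ?f)"
    unfolding kg me[OF X(3,2)] by (rule class_contractible_cell(1)[OF X(7) x Z(2)])
  have "sg ?c ?f * sg (class_contract n \<P> ?c ?f) (merge_edge ?f ?g)
      = - (sg ?c ?g * sg (class_contract n \<P> ?c ?g) (merge_edge ?g ?f))"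
    using conjunct1[OF conjunct2[OF bspec[OF signs[unfolded sign_system_def] chip_class_mem[OF X(1)]]]]
      ne cf(1) cg(1) 1 2 by blast
  then show ?thesis unfolding kf kg me[OF X(2,3)] me[OF X(3,2)] cell_sign_def .
qed

text \<open>Keeping \<open>S\<close> free serves two sums: over a strand in all degrees at once, and
  over the cells of one homological degree.\<close>

lemma weight_weight:
  assumes X: "X \<in> cells" and Z: "Z \<in> cells" and S: "finite S" "S \<subseteq> cells"
    and mid: "\<And>Y. Y \<in> cells \<Longrightarrow> cell_face X Y \<Longrightarrow> cell_face Y Z \<Longrightarrow> Y \<in> S"
  shows "(\<Sum>Y\<in>S. weight sg (opart n X) (opart n Y) * weight sg (opart n Y) (opart n Z) :: 'a::field) = 0"
proof (cases "\<exists>Y\<in>cells. cell_face X Y \<and> cell_face Y Z")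
  case False
  show ?thesis
  proof (rule sum.neutral, rule ballI)
    fix Y assume "Y \<in> S"
    then have Y: "Y \<in> cells" using S by blast
    then show "(weight sg (opart n X) (opart n Y) * weight sg (opart n Y) (opart n Z) :: 'a) = 0"
      using weight_nonzero_iff[OF X Y, where 'a='a] weight_nonzero_iff[OF Y Z, where 'a='a] False by auto
  qed
next
  case True
  then obtain Y where Y: "Y \<in> cells" "cell_face X Y" "cell_face Y Z" by blast
  obtain x y where xy: "x \<in> X" "y \<in> X" "x \<noteq> y" "3 \<le> card X" "X - {x} \<in> cells" "X - {y} \<in> cells"
    "contract_cell (X - {x}) y = Z" "contract_cell (X - {y}) x = Z"
    and only: "\<And>Y'. Y' \<in> cells \<Longrightarrow> cell_face X Y' \<Longrightarrow> cell_face Y' Z \<Longrightarrow> Y' = X - {x} \<or> Y' = X - {y}"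
    by (rule cell_face_diamond[OF X Y(1) Z Y(2,3)]) blast
  let ?t = "\<lambda>Y. weight sg (opart n X) (opart n Y) * weight sg (opart n Y) (opart n Z) :: 'a"
  have cc: "contract_cell X z = X - {z}" for z using xy(4) by (simp add: contract_cell_def)
  have mem: "y \<in> X - {x}" "x \<in> X - {y}" using xy by auto
  have ne: "X - {x} \<noteq> X - {y}" using xy(1,3) by blast
  have inS: "X - {x} \<in> S" "X - {y} \<in> S"
    using mid[OF xy(5)] mid[OF xy(6)] cell_face_iff[OF X xy(5)] cell_face_iff[OF X xy(6)]
      cell_face_iff[OF xy(5) Z] cell_face_iff[OF xy(6) Z] cc xy mem by blast+
  have "(\<Sum>Y\<in>S. ?t Y) = (\<Sum>Y\<in>{X - {x}, X - {y}}. ?t Y)"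
  proof (rule sum.mono_neutral_right[OF S(1)])
    show "\<forall>Y\<in>S - {X - {x}, X - {y}}. ?t Y = 0"
    proof
      fix Y' assume Y': "Y' \<in> S - {X - {x}, X - {y}}"
      then have "Y' \<in> cells" using S by blast
      then show "?t Y' = 0"
        using weight_nonzero_iff[OF X, of Y', where 'a='a] weight_nonzero_iff[OF _ Z, of Y', where 'a='a]
          only[of Y'] Y' by auto
    qed
  qed (use inS in auto)
  also have "\<dots> = ?t (X - {x}) + ?t (X - {y})" using ne by simp
  also have "?t (X - {x}) = of_int (cell_sign sg X x * cell_sign sg (X - {x}) y)"
    using weight_opart[OF X xy(1), of sg, where 'a='a] weight_opart[OF xy(5) mem(1), of sg, where 'a='a] cc xy(5,7) Z by simp
  also have "?t (X - {y}) = of_int (cell_sign sg X y * cell_sign sg (X - {y}) x)"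
    using weight_opart[OF X xy(2), of sg, where 'a='a] weight_opart[OF xy(6) mem(2), of sg, where 'a='a] cc xy(6,8) Z by simp
  also have "cell_sign sg X x * cell_sign sg (X - {x}) y = - (cell_sign sg X y * cell_sign sg (X - {y}) x)"
    by (rule cell_sign_anticommute[OF X xy(1-6)]) (use xy(7,8) Z in simp_all)
  finally show ?thesis by simp
qed

end

section \<open>Multidegrees, strands and the resolution\<close>

context parcycle_signs
begin

lemma lookup_outdeg:
  "X \<in> cells \<Longrightarrow> lookup (outdeg_exponent n (opart n X)) i = card {x \<in> X. tail n x = i}"
  by (rule outdeg_opart[OF n3 cell_sink_cell cells_fst(2)])

lemma face_exponent:
  assumes X: "X \<in> cells" and Y: "Y \<in> cells" and f: "cell_face X Y"
  shows "exp_le (outdeg_exponent n (opart n Y)) (outdeg_exponent n (opart n X))"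
    and "outdeg_exponent n (opart n Y) \<noteq> outdeg_exponent n (opart n X)"
proof -
  have sub: "Y \<subseteq> X" by (rule cell_face_subset[OF f])
  have fX: "finite X" by (rule finite_cell[OF X])
  show "exp_le (outdeg_exponent n (opart n Y)) (outdeg_exponent n (opart n X))"
    unfolding exp_le_def lookup_outdeg[OF X] lookup_outdeg[OF Y]
    using sub fX by (auto intro!: card_mono)
  have "Y \<noteq> X" using cell_face_card[OF X Y f] by auto
  then obtain x where x: "x \<in> X" "x \<notin> Y" using sub by blast
  \<comment> \<open>The count drops at the tail of a deleted edge; this strictness is what yields
    minimality.\<close>
  have "card {y \<in> Y. tail n y = tail n x} < card {y \<in> X. tail n y = tail n x}"
    by (rule psubset_card_mono) (use x sub fX in auto)
  then show "outdeg_exponent n (opart n Y) \<noteq> outdeg_exponent n (opart n X)"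
    using lookup_outdeg[OF X, of "tail n x"] lookup_outdeg[OF Y, of "tail n x"] by auto
qed

text \<open>A vertex \<open>i\<close> is the tail of at most two elements of a cell, the backward
  one at \<open>i - 1\<close> and the forward one at \<open>i\<close>; only when both are present is
  exponent 2 required.\<close>

lemma exp_le_outdeg_iff:
  assumes X: "X \<in> cells"
  shows "exp_le (outdeg_exponent n (opart n X)) m \<longleftrightarrow>
    (\<forall>x\<in>X. 1 \<le> lookup m (tail n x)) \<and>
    (\<forall>t. lookup m (Suc t) = 1 \<longrightarrow> \<not> ((t, False) \<in> X \<and> (Suc t, True) \<in> X))"
proof -
  have fX: "finite X" by (rule finite_cell[OF X])
  have "(\<forall>i. card {x \<in> X. tail n x = i} \<le> lookup m i) \<longleftrightarrow>
    (\<forall>x\<in>X. 1 \<le> lookup m (tail n x)) \<and>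
    (\<forall>t. lookup m (Suc t) = 1 \<longrightarrow> \<not> ((t, False) \<in> X \<and> (Suc t, True) \<in> X))"
  proof (intro iffI conjI ballI allI impI)
    assume le: "\<forall>i. card {x \<in> X. tail n x = i} \<le> lookup m i"
    fix x assume "x \<in> X"
    then have "{y \<in> X. tail n y = tail n x} \<noteq> {}" by blast
    then have "card {y \<in> X. tail n y = tail n x} > 0" using fX by (simp add: card_gt_0_iff)
    then show "1 \<le> lookup m (tail n x)" using spec[OF le, of "tail n x"] by simp
  next
    assume le: "\<forall>i. card {x \<in> X. tail n x = i} \<le> lookup m i"
    fix t assume m: "lookup m (Suc t) = 1"
    show "\<not> ((t, False) \<in> X \<and> (Suc t, True) \<in> X)"
    proof
      assume "(t, False) \<in> X \<and> (Suc t, True) \<in> X"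
      then have "{(t, False), (Suc t, True)} \<subseteq> {x \<in> X. tail n x = Suc t}"
        by (auto simp: tail_def vtx_def)
      then have "card {(t, False), (Suc t, True)} \<le> card {x \<in> X. tail n x = Suc t}"
        using fX by (intro card_mono) auto
      then show False using spec[OF le, of "Suc t"] m by simp
    qed
  next
    fix i
    assume h: "(\<forall>x\<in>X. 1 \<le> lookup m (tail n x)) \<and>
      (\<forall>t. lookup m (Suc t) = 1 \<longrightarrow> \<not> ((t, False) \<in> X \<and> (Suc t, True) \<in> X))"
    let ?S = "{x \<in> X. tail n x = i}"
    \<comment> \<open>The forward edge at position 0 would have tail \<open>n\<close>; it is
      excluded because some backward edge has a smaller position.\<close>
    have tp: "0 < t" if "(t, True) \<in> X" for t
    proof -
      have "\<exists>s. (s, False) \<in> X \<and> s < t"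
        using cell_sink_cell[OF X] that unfolding sink_cell_def by blast
      then show ?thesis by auto
    qed
    have sub: "?S \<subseteq> {(i - 1, False), (i, True)}"
    proof
      fix x assume x: "x \<in> ?S"
      obtain t d where td: "x = (t, d)" by (cases x)
      show "x \<in> {(i - 1, False), (i, True)}"
        using x td tp[of t] by (cases d) (auto simp: tail_def vtx_def)
    qed
    have "card ?S \<le> card {(i - 1, False), (i, True)}" by (rule card_mono[OF _ sub]) simp
    then have c2: "card ?S \<le> 2" by simp
    show "card ?S \<le> lookup m i"
    proof (cases "?S = {}")
      case True
      then have "card ?S = 0" by (simp only: card.empty)
      then show ?thesis by simp
    next
      case False
      then have m1: "1 \<le> lookup m i" using h by blast
      show ?thesis
      proof (cases "card ?S = 2")
        case True
        then have "?S = {(i - 1, False), (i, True)}" by (intro card_subset_eq sub) simp_all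
        then have "(i - 1, False) \<in> ?S" "(i, True) \<in> ?S" by simp_all
        then have in_X: "(i - 1, False) \<in> X" "(i, True) \<in> X" by blast+
        then have "Suc (i - 1) = i" using tp by simp
        then have "lookup m i \<noteq> 1" using h in_X by metis
        then show ?thesis using m1 True by simp
      next
        case False
        then show ?thesis using c2 m1 by simp
      qed
    qed
  qed
  then show ?thesis unfolding exp_le_def lookup_outdeg[OF X] .
qed

lemma exact_on_strand:
  assumes ne: "X0 \<in> cells" "X0 \<noteq> {}" "exp_le (outdeg_exponent n (opart n X0)) m"
  shows "exact_on (\<lambda>X Y. weight sg (opart n X) (opart n Y) :: 'a::field)
    {X \<in> cells. exp_le (outdeg_exponent n (opart n X)) m}"
proof -
  let ?G = "{X \<in> cells. exp_le (outdeg_exponent n (opart n X)) m}"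
  define P where "P = {x \<in> cuts \<times> UNIV. 1 \<le> lookup m (tail n x)}"
  define N where "N = {t. lookup m (Suc t) = 1}"
  have G: "?G = {X. sink_cell X \<and> X \<subseteq> P \<and> (\<forall>t\<in>N. \<not> ((t, False) \<in> X \<and> (Suc t, True) \<in> X))}"
  proof (intro Collect_cong iffI)
    fix X assume "X \<in> cells \<and> exp_le (outdeg_exponent n (opart n X)) m"
    then have X: "X \<in> cells" and h: "(\<forall>x\<in>X. 1 \<le> lookup m (tail n x)) \<and>
      (\<forall>t. lookup m (Suc t) = 1 \<longrightarrow> \<not> ((t, False) \<in> X \<and> (Suc t, True) \<in> X))"
      using exp_le_outdeg_iff by blast+
    have "X \<subseteq> P" using X h unfolding P_def cells_def by blast
    then show "sink_cell X \<and> X \<subseteq> P \<and> (\<forall>t\<in>N. \<not> ((t, False) \<in> X \<and> (Suc t, True) \<in> X))"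
      using cell_sink_cell[OF X] h unfolding N_def by blast
  next
    fix X assume h: "sink_cell X \<and> X \<subseteq> P \<and> (\<forall>t\<in>N. \<not> ((t, False) \<in> X \<and> (Suc t, True) \<in> X))"
    then have X: "X \<in> cells" unfolding cells_def P_def by blast
    have "(\<forall>x\<in>X. 1 \<le> lookup m (tail n x)) \<and>
      (\<forall>t. lookup m (Suc t) = 1 \<longrightarrow> \<not> ((t, False) \<in> X \<and> (Suc t, True) \<in> X))"
      using h unfolding P_def N_def by blast
    then show "X \<in> cells \<and> exp_le (outdeg_exponent n (opart n X)) m"
      using X exp_le_outdeg_iff[OF X] by blast
  qed
  show ?thesis
  proof (rule strand_exact[OF _ G])
    show "finite P" by (rule finite_subset[of _ "cuts \<times> UNIV"]) (auto simp: P_def finite_cuts)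
    show "X0 \<in> ?G" "X0 \<noteq> {}" using ne by simp_all
    show "(weight sg (opart n X) (opart n Y) :: 'a) \<noteq> 0 \<longleftrightarrow> cell_face X Y"
      if "X \<in> ?G" "Y \<in> ?G" for X Y
      using weight_nonzero_iff that by blast
    show "(\<Sum>Y\<in>?G. weight sg (opart n X) (opart n Y) * weight sg (opart n Y) (opart n Z) :: 'a) = 0"
      if X: "X \<in> ?G" and Z: "Z \<in> ?G" for X Z
    proof (rule weight_weight)
      show "X \<in> cells" "Z \<in> cells" using X Z by simp_all
      show "finite ?G" by (rule finite_subset[OF _ finite_cells]) blast
      fix Y assume Y: "Y \<in> cells" "cell_face X Y"
      have "exp_le (outdeg_exponent n (opart n Y)) (outdeg_exponent n (opart n X))"
        using face_exponent(1)[OF _ Y] X by blast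
      then show "Y \<in> ?G" using exp_le_trans X Y by blast
    qed blast
  qed
qed

lemma sum_basis_below:
  fixes h :: "oriented_partition \<Rightarrow> 'a::field"
  shows "(\<Sum>C\<in>{C \<in> F0_basis n \<P> q j. exp_le (outdeg_exponent n C) m}. h C) =
    (\<Sum>X\<in>{X \<in> {X \<in> cells. exp_le (outdeg_exponent n (opart n X)) m}. card X - 1 = j}. h (opart n X))"
proof -
  have "{C \<in> F0_basis n \<P> q j. exp_le (outdeg_exponent n C) m} =
      opart n ` {X \<in> {X \<in> cells. exp_le (outdeg_exponent n (opart n X)) m}. card X - 1 = j}"
    unfolding F0_basis_eq by blast
  moreover have "inj_on (opart n) {X \<in> {X \<in> cells. exp_le (outdeg_exponent n (opart n X)) m}. card X - 1 = j}"
    by (rule inj_on_subset[OF inj_on_opart]) blast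
  ultimately show ?thesis by (simp only: sum.reindex o_def)
qed

text \<open>Exactness on all cells at once yields exactness in one degree: \<open>a\<close> is
  extended by zero and the preimage restricted, since \<open>w\<close> lowers the degree by exactly
  one.\<close>

lemma strand:
  fixes a :: "oriented_partition \<Rightarrow> 'a::field"
  assumes cyc: "\<And>C'. C' \<in> F0_basis n \<P> q j \<Longrightarrow> exp_le (outdeg_exponent n C') m \<Longrightarrow>
    (\<Sum>C\<in>{C \<in> F0_basis n \<P> q (Suc j). exp_le (outdeg_exponent n C) m}. a C * weight sg C C') = 0"
  shows "\<exists>a'. \<forall>C\<in>F0_basis n \<P> q (Suc j). exp_le (outdeg_exponent n C) m \<longrightarrow>
    a C = (\<Sum>C''\<in>{C'' \<in> F0_basis n \<P> q (Suc (Suc j)). exp_le (outdeg_exponent n C'') m}.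
      a' C'' * weight sg C'' C)"
proof -
  define G where "G = {X \<in> cells. exp_le (outdeg_exponent n (opart n X)) m}"
  define w where "w X Y = (weight sg (opart n X) (opart n Y) :: 'a)" for X Y
  have Gc: "X \<in> cells" if "X \<in> G" for X using that by (simp add: G_def)
  have finG: "finite G" by (rule finite_subset[OF _ finite_cells]) (auto simp: G_def)
  have w_card: "card X - 1 = Suc (card Y - 1)" if "X \<in> G" "Y \<in> G" "w X Y \<noteq> 0" for X Y
    using cell_face_card[OF Gc[OF that(1)] Gc[OF that(2)]] weight_nonzero_iff[OF Gc[OF that(1)] Gc[OF that(2)]] that(3)
    unfolding w_def by blast
  show ?thesis
  proof (cases "\<exists>X0\<in>G. X0 \<noteq> {}")
    case False
    \<comment> \<open>Here the strand consists of the empty cell alone. It is not exact in degree 0,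
      but it has no basis element of positive degree.\<close>
    have "\<not> exp_le (outdeg_exponent n C) m" if C: "C \<in> F0_basis n \<P> q (Suc j)" for C
    proof
      assume le: "exp_le (outdeg_exponent n C) m"
      obtain X where X: "X \<in> cells" "card X - 1 = Suc j" "C = opart n X"
        using C unfolding F0_basis_eq by blast
      then have "X \<in> G" using le by (simp add: G_def)
      moreover have "X \<noteq> {}" using X(2) by auto
      ultimately show False using False by blast
    qed
    then show ?thesis by blast
  next
    case True
    then obtain X0 where "X0 \<in> cells" "X0 \<noteq> {}" "exp_le (outdeg_exponent n (opart n X0)) m"
      unfolding G_def by blast
    from exact_on_strand[OF this, where 'a='a] have ex: "exact_on w G"
      unfolding w_def G_def by simp
    define \<alpha> where "\<alpha> X = (if card X - 1 = Suc j then a (opart n X) else 0)" for X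
    have "(\<Sum>X\<in>G. \<alpha> X * w X Y) = 0" if Y: "Y \<in> G" for Y
    proof (cases "card Y - 1 = j")
      case False
      show ?thesis
      proof (rule sum.neutral, rule ballI)
        fix X assume "X \<in> G"
        then show "\<alpha> X * w X Y = 0" using w_card[OF _ Y, of X] False by (auto simp: \<alpha>_def)
      qed
    next
      case True
      have "(\<Sum>X\<in>G. \<alpha> X * w X Y) = (\<Sum>X\<in>{X \<in> G. card X - 1 = Suc j}. a (opart n X) * w X Y)"
        by (rule sum.mono_neutral_cong_right) (use finG in \<open>auto simp: \<alpha>_def\<close>)
      also have "\<dots> = (\<Sum>C\<in>{C \<in> F0_basis n \<P> q (Suc j). exp_le (outdeg_exponent n C) m}.
          a C * weight sg C (opart n Y))"
        unfolding sum_basis_below G_def w_def ..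
      also have "\<dots> = 0"
        by (rule cyc) (use Y True in \<open>auto simp: G_def F0_basis_eq\<close>)
      finally show ?thesis .
    qed
    then obtain \<beta> where \<beta>: "\<And>Y. Y \<in> G \<Longrightarrow> \<alpha> Y = (\<Sum>X\<in>G. \<beta> X * w X Y)"
      using ex unfolding exact_on_def by blast
    show ?thesis
    proof (intro exI ballI impI)
      fix C assume C: "C \<in> F0_basis n \<P> q (Suc j)" "exp_le (outdeg_exponent n C) m"
      obtain Y where Y: "Y \<in> cells" "card Y - 1 = Suc j" "C = opart n Y"
        using C(1) unfolding F0_basis_eq by blast
      then have YG: "Y \<in> G" using C(2) by (simp add: G_def)
      have "a C = \<alpha> Y" using Y by (simp add: \<alpha>_def)
      also have "\<dots> = (\<Sum>X\<in>G. \<beta> X * w X Y)" by (rule \<beta>[OF YG])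
      \<comment> \<open>Only cells of one degree higher have a nonzero entry at \<open>Y\<close>,
        and \<open>recover\<close> expresses the coefficient through the partition.\<close>
      also have "\<dots> = (\<Sum>X\<in>{X \<in> G. card X - 1 = Suc (Suc j)}. \<beta> (recover (opart n X)) * weight sg (opart n X) C)"
      proof (rule sum.mono_neutral_cong_right[OF finG])
        show "\<forall>X\<in>G - {X \<in> G. card X - 1 = Suc (Suc j)}. \<beta> X * w X Y = 0"
        proof
          fix X assume "X \<in> G - {X \<in> G. card X - 1 = Suc (Suc j)}"
          then show "\<beta> X * w X Y = 0" using w_card[OF _ YG, of X] Y(2) by auto
        qed
        show "\<beta> X * w X Y = \<beta> (recover (opart n X)) * weight sg (opart n X) C"
          if "X \<in> {X \<in> G. card X - 1 = Suc (Suc j)}" for X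
          using that recover_opart[OF Gc, of X] Y(3) by (simp add: w_def)
      qed blast
      also have "\<dots> = (\<Sum>C''\<in>{C'' \<in> F0_basis n \<P> q (Suc (Suc j)). exp_le (outdeg_exponent n C'') m}.
          \<beta> (recover C'') * weight sg C'' C)"
        unfolding sum_basis_below G_def ..
      finally show "a C = (\<Sum>C''\<in>{C'' \<in> F0_basis n \<P> q (Suc (Suc j)). exp_le (outdeg_exponent n C'') m}.
          \<beta> (recover C'') * weight sg C'' C)" .
    qed
  qed
qed

lemma multigraded_complex_F0:
  "multigraded_complex n (F0_basis n \<P> q) (outdeg_exponent n)
    (weight sg :: oriented_partition \<Rightarrow> oriented_partition \<Rightarrow> 'a::field) (opart n {})"
proof
  show "finite (F0_basis n \<P> q j)" for j
    unfolding F0_basis_eq by (rule finite_imageI, rule finite_subset[OF _ finite_cells]) blast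
  show "F0_basis n \<P> q 0 = {opart n {}}"
  proof -
    have "{X \<in> cells. card X - 1 = 0} = {{}}"
    proof (intro equalityI subsetI)
      fix X assume "X \<in> {X \<in> cells. card X - 1 = 0}"
      then show "X \<in> {{}}" using cell_card[of X] by force
    qed (use empty_cell in simp)
    then show ?thesis unfolding F0_basis_eq by simp
  qed
  show "outdeg_exponent n (opart n {}) = 0"
    by (rule poly_mapping_eqI) (simp add: lookup_outdeg[OF empty_cell])
  show "Poly_Mapping.keys (outdeg_exponent n C) \<subseteq> {1..n}" if C: "C \<in> F0_basis n \<P> q j" for C j
  proof
    fix i assume i: "i \<in> Poly_Mapping.keys (outdeg_exponent n C)"
    obtain X where X: "X \<in> cells" "C = opart n X" using C unfolding F0_basis_eq by blast
    have "card {x \<in> X. tail n x = i} \<noteq> 0"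
      using i lookup_outdeg[OF X(1), of i] X(2) by (simp add: in_keys_iff)
    then have "{x \<in> X. tail n x = i} \<noteq> {}" by (intro notI) (simp only: card.empty)
    then obtain x where "x \<in> X" "tail n x = i" by blast
    then show "i \<in> {1..n}" using tail_mem[of x n] cells_fst(2)[OF X(1)] by auto
  qed
  have faceE: "\<exists>X Y. X \<in> cells \<and> Y \<in> cells \<and> C = opart n X \<and> C' = opart n Y \<and>
      cell_face X Y \<and> card X - 1 = j"
    if C: "C \<in> F0_basis n \<P> q j" "(weight sg C C' :: 'a) \<noteq> 0" for C C' j
  proof -
    obtain X where X: "X \<in> cells" "card X - 1 = j" "C = opart n X"
      using C(1) unfolding F0_basis_eq by blast
    have "(weight sg (opart n X) C' :: 'a) \<noteq> 0" using C(2) X(3) by simp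
    from weight_nonzeroD[OF X(1) this] show ?thesis using X by blast
  qed
  show "C' \<in> F0_basis n \<P> q j"
    if C: "C \<in> F0_basis n \<P> q (Suc j)" "(weight sg C C' :: 'a) \<noteq> 0" for C C' j
  proof -
    obtain X Y where XY: "X \<in> cells" "Y \<in> cells" "C' = opart n Y" "cell_face X Y" "card X - 1 = Suc j"
      using faceE[OF C] by blast
    have "card Y - 1 = j" using cell_face_card[OF XY(1,2,4)] XY(5) by simp
    then show ?thesis unfolding F0_basis_eq using XY by blast
  qed
  show "exp_le (outdeg_exponent n C') (outdeg_exponent n C) \<and> outdeg_exponent n C' \<noteq> outdeg_exponent n C"
    if C: "C \<in> F0_basis n \<P> q (Suc j)" "(weight sg C C' :: 'a) \<noteq> 0" for C C' j
  proof -
    obtain X Y where XY: "X \<in> cells" "Y \<in> cells" "C = opart n X" "C' = opart n Y" "cell_face X Y"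
      using faceE[OF C] by blast
    then show ?thesis using face_exponent[OF XY(1,2,5)] by simp
  qed
  show "(\<Sum>C'\<in>F0_basis n \<P> q (Suc j). weight sg C C' * weight sg C' C'' :: 'a) = 0"
    if C: "C \<in> F0_basis n \<P> q (Suc (Suc j))" "C'' \<in> F0_basis n \<P> q j" for C C'' j
  proof -
    obtain X where X: "X \<in> cells" "card X - 1 = Suc (Suc j)" "C = opart n X"
      using C(1) unfolding F0_basis_eq by blast
    obtain Z where Z: "Z \<in> cells" "C'' = opart n Z" using C(2) unfolding F0_basis_eq by blast
    let ?S = "{Y \<in> cells. card Y - 1 = Suc j}"
    have "(\<Sum>C'\<in>F0_basis n \<P> q (Suc j). weight sg C C' * weight sg C' C'' :: 'a)
        = (\<Sum>Y\<in>?S. weight sg (opart n X) (opart n Y) * weight sg (opart n Y) (opart n Z))"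
      unfolding F0_basis_eq X(3) Z(2)
      by (subst sum.reindex[OF inj_on_subset[OF inj_on_opart]]) auto
    also have "\<dots> = 0"
    proof (rule weight_weight[OF X(1) Z(1)])
      show "finite ?S" by (rule finite_subset[OF _ finite_cells]) blast
      show "Y \<in> ?S" if "Y \<in> cells" "cell_face X Y" for Y
        using cell_face_card[OF X(1) that] X(2) that by simp
    qed blast
    finally show ?thesis .
  qed
  show "(weight sg C (opart n {}) :: 'a) \<noteq> 0" if C: "C \<in> F0_basis n \<P> q 1" for C
  proof -
    obtain X where X: "X \<in> cells" "card X - 1 = 1" "C = opart n X"
      using C unfolding F0_basis_eq by blast
    then have "cell_face X {}" by (simp add: cell_face_def)
    then show ?thesis using weight_nonzero_iff[OF X(1) empty_cell] X(3) by simp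
  qed
qed (rule strand)

lemma F0_diff_eq:
  "F0_diff n \<P> q sg =
    multigraded_complex.d (F0_basis n \<P> q) (outdeg_exponent n)
      (weight sg :: oriented_partition \<Rightarrow> oriented_partition \<Rightarrow> 'a::field)"
proof (intro ext)
  fix j C' and v :: "oriented_partition \<Rightarrow> 'a mpoly"
  \<comment> \<open>The monomial depends only on \<open>C\<close> and \<open>C'\<close>, so the
    signs collect into the scalar \<open>weight\<close>.\<close>
  have "(\<Sum>f | contractible n \<P> C f \<and> contract C f = C'. of_int (sg (chip_class n \<P> C) f)
        * monomial (outdeg_exponent n C - outdeg_exponent n (contract C f)) * v C)
      = Poly_Mapping.single (outdeg_exponent n C - outdeg_exponent n C') (weight sg C C') * v C" for C
    unfolding weight_def single_sum sum_distrib_right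
    by (rule sum.cong) (auto simp: of_int_mult_monomial)
  then show "F0_diff n \<P> q sg j v C' =
      multigraded_complex.d (F0_basis n \<P> q) (outdeg_exponent n) (weight sg) j v C'"
    unfolding F0_diff_def multigraded_complex.d_def[OF multigraded_complex_F0] by simp
qed

end

theorem theorem3p16:
  fixes n k :: nat
    and V :: "nat \<Rightarrow> nat set"
    and \<P> :: "nat set set"
    and sg :: "oriented_partition set \<Rightarrow> nat set \<times> nat set \<Rightarrow> int"
  assumes "k \<ge> 1"
    and "\<P> = V ` {1..k}"
    and "inj_on V {1..k}"
    and "parcycle n \<P>"
    and "n \<in> V k"
    and "sign_system n \<P> sg"
  shows "minimal_free_resolution (mpoly_ring n :: 'a::field mpoly ring) (irrelevant_ideal n)
           (F0_basis n \<P> (V k)) (F0_diff n \<P> (V k) sg)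
           (quotient_module (mpoly_ring n) (parking_ideal n \<P> (V k)))
       \<and> multigraded_differential (F0_basis n \<P> (V k)) (outdeg_exponent n)
           (F0_diff n \<P> (V k) sg :: nat \<Rightarrow> (oriented_partition \<Rightarrow> 'a mpoly) \<Rightarrow> (oriented_partition \<Rightarrow> 'a mpoly))"
proof -
  have "1 \<in> {1..k}" "k \<in> {1..k}" using assms(1) by auto
  then interpret parcycle_signs n \<P> "V k" sg
    by unfold_locales (use assms in auto)
  interpret C: multigraded_complex n "F0_basis n \<P> (V k)" "outdeg_exponent n"
    "weight sg :: oriented_partition \<Rightarrow> oriented_partition \<Rightarrow> 'a" "opart n {}"
    by (rule multigraded_complex_F0)
  show ?thesis
    unfolding F0_diff_eq using C.minimal_resolution[OF parking_ideal_eq] C.multigraded by blast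
qed

end
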